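(* Let $H$ be a Hilbert space, let $X=(X_{ij})$ be an $n\times n$ magic decomposition of $H$, and let $A$ be the quantum permutation algebra associated to $X$. The following are equivalent: (1) $A$ is commutative; (2) $X=X^E$ for a certain magic partition $E$, that is, there exist a finite orthogonal decomposition $H=\bigoplus_{k=1}^NX_k$ and a magic partition $E=(E_{ij})$ of $\{1,\dots,N\}$ such that $X_{ij}=\bigoplus_{k\in E_{ij}}X_k$ for all $i,j$.
   Context: A magic decomposition of $H$ is a square matrix $(X_{ij})$ of closed subspaces of $H$ (possibly zero) such that each row and each column is an orthogonal decomposition of $H$. A magic partition of a finite set $I$ is a square matrix $(E_{ij})$ of subsets of $I$ (possibly empty) such that each row and each column is a partition of $I$. C*-algebras and morphisms are unital. A magic unitary over a C*-algebra $A$ is a matrix $u\in M_n(A)$ of projections such that on each row and each column the entries are pairwise orthogonal and sum to $1$. $A_s(n)$ is the universal C*-algebra generated by $n^2$ elements $u_{ij}$ with the relations making $(u_{ij})$ a magic unitary. A quantum permutation algebra is a C*-algebra $A$ with a magic unitary $u\in M_n(A)$ whose entries generate $A$, and such that $\Delta(u_{ij})=\sum_k u_{ik}\otimes u_{kj}$, $\varepsilon(u_{ij})=\delta_{ij}$, $S(u_{ij})=u_{ji}$ define morphisms $\Delta:A\to A\otimes A$, $\varepsilon:A\to\mathbb C$, $S:A\to A^{op}$. All quantum permutation algebras are taken full: $A$ is the enveloping C*-algebra of the $*$-algebra generated by the $u_{ij}$. Given a representation $\pi:A_s(n)\to B(H)$, its Hopf image is the smallest quantum permutation algebra $A$ (with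 $n\times n$ magic unitary) realizing a factorization $A_s(n)\to A\to B(H)$ of $\pi$, the first map sending generators to generators; smallest means that any other algebra realizing such a factorization maps onto $A$, generators being sent to generators. The quantum permutation algebra associated to a magic decomposition $X$ is the Hopf image of $\pi:A_s(n)\to B(H)$, $\pi(u_{ij})=P_{ij}$, where $P_{ij}$ is the orthogonal projection onto $X_{ij}$. *)

theory Defs
  imports
    "HOL-Analysis.Analysis"
    "HOL-Algebra.Ring"
    "HOL-Library.Poly_Mapping"
    "HOL-Library.Disjoint_Sets"
begin

section \<open>Complex Hilbert spaces, decompositions, magic decompositions and partitions\<close>

text \<open>The inner product is linear in the first argument. Its real part is the real inner product
  of the underlying real Hilbert space, which provides norm, topology and completeness.\<close>

class complex_hilbert_space = real_inner + complete_space +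
  fixes scaleC :: "complex \<Rightarrow> 'a \<Rightarrow> 'a"  (infixr "*\<^sub>C" 75)
    and cinner :: "'a \<Rightarrow> 'a \<Rightarrow> complex"
  assumes scaleC_add_right: "c *\<^sub>C (x + y) = c *\<^sub>C x + c *\<^sub>C y"
    and scaleC_add_left: "(c + d) *\<^sub>C x = c *\<^sub>C x + d *\<^sub>C x"
    and scaleC_scaleC: "c *\<^sub>C d *\<^sub>C x = (c * d) *\<^sub>C x"
    and scaleR_scaleC: "r *\<^sub>R x = complex_of_real r *\<^sub>C x"
    and cinner_commute: "cinner x y = cnj (cinner y x)"
    and cinner_add_left: "cinner (x + y) z = cinner x z + cinner y z"
    and cinner_scaleC_left: "cinner (c *\<^sub>C x) y = c * cinner x y"
    and inner_eq_Re_cinner: "inner x y = Re (cinner x y)"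

instantiation complex :: complex_hilbert_space
begin
definition "scaleC_complex (c :: complex) (x :: complex) = c * x"
definition "cinner_complex (x :: complex) (y :: complex) = x * cnj y"
instance
  by standard
    (auto simp: scaleC_complex_def cinner_complex_def algebra_simps scaleR_conv_of_real
      inner_complex_def)
end

definition closed_subspace :: "'h::complex_hilbert_space set \<Rightarrow> bool" where
  "closed_subspace S \<longleftrightarrow> 0 \<in> S \<and> (\<forall>x\<in>S. \<forall>y\<in>S. x + y \<in> S) \<and> (\<forall>c. \<forall>x\<in>S. c *\<^sub>C x \<in> S) \<and> closed S"

definition sum_of_subspaces :: "'i set \<Rightarrow> ('i \<Rightarrow> 'h::complex_hilbert_space set) \<Rightarrow> 'h set" where
  "sum_of_subspaces K Y = {\<Sum>k\<in>K. f k | f. \<forall>k\<in>K. f k \<in> Y k}"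

text \<open>Components of a decomposition may be zero.\<close>

definition orthogonal_decomposition ::
    "'i set \<Rightarrow> ('i \<Rightarrow> 'h::complex_hilbert_space set) \<Rightarrow> 'h set \<Rightarrow> bool" where
  "orthogonal_decomposition K Y V \<longleftrightarrow>
     finite K \<and> (\<forall>k\<in>K. closed_subspace (Y k)) \<and>
     (\<forall>k\<in>K. \<forall>l\<in>K. k \<noteq> l \<longrightarrow> (\<forall>x\<in>Y k. \<forall>y\<in>Y l. cinner x y = 0)) \<and>
     V = sum_of_subspaces K Y"

definition magic_decomposition ::
    "nat \<Rightarrow> (nat \<Rightarrow> nat \<Rightarrow> 'h::complex_hilbert_space set) \<Rightarrow> bool" where
  "magic_decomposition n X \<longleftrightarrow>
     (\<forall>i\<in>{1..n}. orthogonal_decomposition {1..n} (\<lambda>j. X i j) UNIV) \<and>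
     (\<forall>j\<in>{1..n}. orthogonal_decomposition {1..n} (\<lambda>i. X i j) UNIV)"

text \<open>Parts may be empty, hence this is not \<^const>\<open>partition_on\<close>.\<close>

definition indexed_partition :: "'i set \<Rightarrow> ('i \<Rightarrow> 'k set) \<Rightarrow> 'k set \<Rightarrow> bool" where
  "indexed_partition J F I \<longleftrightarrow> disjoint_family_on F J \<and> (\<Union>j\<in>J. F j) = I"

definition magic_partition :: "nat \<Rightarrow> 'k set \<Rightarrow> (nat \<Rightarrow> nat \<Rightarrow> 'k set) \<Rightarrow> bool" where
  "magic_partition n I E \<longleftrightarrow>
     finite I \<and>
     (\<forall>i\<in>{1..n}. \<forall>j\<in>{1..n}. E i j \<subseteq> I) \<and>
     (\<forall>i\<in>{1..n}. indexed_partition {1..n} (\<lambda>j. E i j) I) \<and>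
     (\<forall>j\<in>{1..n}. indexed_partition {1..n} (\<lambda>i. E i j) I)"

section \<open>C*-algebras and their morphisms\<close>

record 'a star_alg = "'a ring" +
  cscale :: "complex \<Rightarrow> 'a \<Rightarrow> 'a"
  star :: "'a \<Rightarrow> 'a"

record 'a cstar = "'a star_alg" +
  nrm :: "'a \<Rightarrow> real"

locale star_algebra = ring A for A :: "('a, 'm) star_alg_scheme" (structure) +
  assumes cscale_closed: "x \<in> carrier A \<Longrightarrow> cscale A c x \<in> carrier A"
    and cscale_add_right: "\<lbrakk>x \<in> carrier A; y \<in> carrier A\<rbrakk> \<Longrightarrow>
      cscale A c (x \<oplus> y) = cscale A c x \<oplus> cscale A c y"
    and cscale_add_left: "x \<in> carrier A \<Longrightarrow>
      cscale A (c + d) x = cscale A c x \<oplus> cscale A d x"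
    and cscale_cscale: "x \<in> carrier A \<Longrightarrow> cscale A c (cscale A d x) = cscale A (c * d) x"
    and cscale_one: "x \<in> carrier A \<Longrightarrow> cscale A 1 x = x"
    and cscale_mult_left: "\<lbrakk>x \<in> carrier A; y \<in> carrier A\<rbrakk> \<Longrightarrow>
      cscale A c x \<otimes> y = cscale A c (x \<otimes> y)"
    and cscale_mult_right: "\<lbrakk>x \<in> carrier A; y \<in> carrier A\<rbrakk> \<Longrightarrow>
      x \<otimes> cscale A c y = cscale A c (x \<otimes> y)"
    and star_closed: "x \<in> carrier A \<Longrightarrow> star A x \<in> carrier A"
    and star_star: "x \<in> carrier A \<Longrightarrow> star A (star A x) = x"
    and star_add: "\<lbrakk>x \<in> carrier A; y \<in> carrier A\<rbrakk> \<Longrightarrow>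
      star A (x \<oplus> y) = star A x \<oplus> star A y"
    and star_cscale: "x \<in> carrier A \<Longrightarrow> star A (cscale A c x) = cscale A (cnj c) (star A x)"
    and star_mult: "\<lbrakk>x \<in> carrier A; y \<in> carrier A\<rbrakk> \<Longrightarrow>
      star A (x \<otimes> y) = star A y \<otimes> star A x"

definition cstar_seminorm :: "('a, 'm) star_alg_scheme \<Rightarrow> ('a \<Rightarrow> real) \<Rightarrow> bool" where
  "cstar_seminorm A p \<longleftrightarrow>
     (\<forall>x\<in>carrier A. 0 \<le> p x) \<and>
     (\<forall>x\<in>carrier A. \<forall>y\<in>carrier A. p (x \<oplus>\<^bsub>A\<^esub> y) \<le> p x + p y) \<and>
     (\<forall>c. \<forall>x\<in>carrier A. p (cscale A c x) = cmod c * p x) \<and>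
     (\<forall>x\<in>carrier A. \<forall>y\<in>carrier A. p (x \<otimes>\<^bsub>A\<^esub> y) \<le> p x * p y) \<and>
     (\<forall>x\<in>carrier A. p (star A x \<otimes>\<^bsub>A\<^esub> x) = (p x)\<^sup>2)"

definition seminorm_Cauchy ::
    "('a, 'm) star_alg_scheme \<Rightarrow> ('a \<Rightarrow> real) \<Rightarrow> (nat \<Rightarrow> 'a) \<Rightarrow> bool" where
  "seminorm_Cauchy A p s \<longleftrightarrow>
     (\<forall>k. s k \<in> carrier A) \<and> (\<forall>e>0. \<exists>M. \<forall>k\<ge>M. \<forall>l\<ge>M. p (s k \<ominus>\<^bsub>A\<^esub> s l) < e)"

text \<open>The zero algebra is not excluded: it is the algebra of operators on the zero space.\<close>

locale cstar_algebra = star_algebra A for A :: "('a, 'm) cstar_scheme" (structure) +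
  assumes nrm_cstar: "cstar_seminorm A (nrm A)"
    and nrm_definite: "\<lbrakk>x \<in> carrier A; nrm A x = 0\<rbrakk> \<Longrightarrow> x = \<zero>"
    and nrm_complete: "seminorm_Cauchy A (nrm A) s \<Longrightarrow>
      \<exists>x\<in>carrier A. (\<lambda>k. nrm A (s k \<ominus> x)) \<longlonglongrightarrow> 0"

definition cstar_hom ::
    "('a, 'm) star_alg_scheme \<Rightarrow> ('b, 'l) star_alg_scheme \<Rightarrow> ('a \<Rightarrow> 'b) set" where
  "cstar_hom A B = {f \<in> ring_hom A B.
     (\<forall>c. \<forall>x\<in>carrier A. f (cscale A c x) = cscale B c (f x)) \<and>
     (\<forall>x\<in>carrier A. f (star A x) = star B (f x))}"

definition complex_cstar :: "complex cstar" where
  "complex_cstar = \<lparr>carrier = UNIV, monoid.mult = (*), one = 1, ring.zero = 0, add = (+),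
     cscale = (*), star = cnj, nrm = cmod\<rparr>"

definition opposite :: "('a, 'm) star_alg_scheme \<Rightarrow> ('a, 'm) star_alg_scheme" where
  "opposite A = A\<lparr>monoid.mult := \<lambda>x y. y \<otimes>\<^bsub>A\<^esub> x\<rparr>"

text \<open>The C*-algebra \<open>B(H)\<close>. Its elements are the real bounded operators of the library that are
  complex linear; the operator norm does not depend on the scalars.\<close>

definition adjoint_op :: "('h::complex_hilbert_space \<Rightarrow>\<^sub>L 'h) \<Rightarrow> ('h \<Rightarrow>\<^sub>L 'h)" where
  "adjoint_op T = (THE S. \<forall>x y. cinner (blinfun_apply T x) y = cinner x (blinfun_apply S y))"

definition bounded_operators :: "('h::complex_hilbert_space \<Rightarrow>\<^sub>L 'h) cstar" where
  "bounded_operators =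
     \<lparr>carrier = {T. \<forall>c x. blinfun_apply T (c *\<^sub>C x) = c *\<^sub>C blinfun_apply T x},
      monoid.mult = (o\<^sub>L), one = id_blinfun, ring.zero = 0, add = (+),
      cscale = (\<lambda>c T. Blinfun (\<lambda>x. c *\<^sub>C blinfun_apply T x)), star = adjoint_op, nrm = norm\<rparr>"

definition orth_projection :: "'h::complex_hilbert_space set \<Rightarrow> ('h \<Rightarrow>\<^sub>L 'h)" where
  "orth_projection S = Blinfun (\<lambda>x. THE y. y \<in> S \<and> (\<forall>z\<in>S. cinner (x - y) z = 0))"

section \<open>Universal C*-algebras and the tensor product\<close>

text \<open>The Hausdorff completion of a *-algebra for a seminorm: Cauchy sequences modulo null
  sequences, with the operations computed on representatives.\<close>

definition cauchy_class ::
    "('a, 'm) star_alg_scheme \<Rightarrow> ('a \<Rightarrow> real) \<Rightarrow> (nat \<Rightarrow> 'a) \<Rightarrow> (nat \<Rightarrow> 'a) set" where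
  "cauchy_class A p s =
     {t. seminorm_Cauchy A p t \<and> (\<lambda>k. p (s k \<ominus>\<^bsub>A\<^esub> t k)) \<longlonglongrightarrow> 0}"

definition cauchy_rep :: "(nat \<Rightarrow> 'a) set \<Rightarrow> nat \<Rightarrow> 'a" where
  "cauchy_rep S = (SOME s. s \<in> S)"

definition completion ::
    "('a, 'm) star_alg_scheme \<Rightarrow> ('a \<Rightarrow> real) \<Rightarrow> ((nat \<Rightarrow> 'a) set) cstar" where
  "completion A p =
     \<lparr>carrier = cauchy_class A p ` {s. seminorm_Cauchy A p s},
      monoid.mult = (\<lambda>S T. cauchy_class A p (\<lambda>k. cauchy_rep S k \<otimes>\<^bsub>A\<^esub> cauchy_rep T k)),
      one = cauchy_class A p (\<lambda>k. \<one>\<^bsub>A\<^esub>),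
      ring.zero = cauchy_class A p (\<lambda>k. \<zero>\<^bsub>A\<^esub>),
      add = (\<lambda>S T. cauchy_class A p (\<lambda>k. cauchy_rep S k \<oplus>\<^bsub>A\<^esub> cauchy_rep T k)),
      cscale = (\<lambda>c S. cauchy_class A p (\<lambda>k. cscale A c (cauchy_rep S k))),
      star = (\<lambda>S. cauchy_class A p (\<lambda>k. star A (cauchy_rep S k))),
      nrm = (\<lambda>S. lim (\<lambda>k. p (cauchy_rep S k)))\<rparr>"

text \<open>The largest C*-seminorm on \<open>A\<close> vanishing on the relators \<open>R\<close>. It makes sense only
  if these seminorms are pointwise bounded, as is the case in the two uses below: the entries of
  a magic unitary are projections, and \<open>p (a \<otimes> b) \<le> \<parallel>a\<parallel> \<parallel>b\<parallel>\<close> on a tensor product of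
  C*-algebras.\<close>

definition max_cstar_seminorm :: "('a, 'm) star_alg_scheme \<Rightarrow> 'a set \<Rightarrow> 'a \<Rightarrow> real" where
  "max_cstar_seminorm A R x = (SUP p\<in>{p. cstar_seminorm A p \<and> (\<forall>r\<in>R. p r = 0)}. p x)"

definition enveloping_cstar ::
    "('a, 'm) star_alg_scheme \<Rightarrow> 'a set \<Rightarrow> ((nat \<Rightarrow> 'a) set) cstar" where
  "enveloping_cstar A R = completion A (max_cstar_seminorm A R)"

definition enveloping_class ::
    "('a, 'm) star_alg_scheme \<Rightarrow> 'a set \<Rightarrow> 'a \<Rightarrow> (nat \<Rightarrow> 'a) set" where
  "enveloping_class A R x = cauchy_class A (max_cstar_seminorm A R) (\<lambda>k. x)"

text \<open>The *-algebra of a monoid \<open>M\<close> with involution \<open>adj\<close>: finite formal linear combinations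
  of elements of \<open>M\<close>.\<close>

definition monoid_star_algebra ::
    "('m, 'k) monoid_scheme \<Rightarrow> ('m \<Rightarrow> 'm) \<Rightarrow> ('m \<Rightarrow>\<^sub>0 complex) star_alg" where
  "monoid_star_algebra M adj =
     \<lparr>carrier = {f. Poly_Mapping.keys f \<subseteq> carrier M},
      monoid.mult = (\<lambda>f g. \<Sum>v\<in>Poly_Mapping.keys f. \<Sum>w\<in>Poly_Mapping.keys g.
        Poly_Mapping.single (v \<otimes>\<^bsub>M\<^esub> w) (Poly_Mapping.lookup f v * Poly_Mapping.lookup g w)),
      one = Poly_Mapping.single \<one>\<^bsub>M\<^esub> 1,
      ring.zero = 0,
      add = (+),
      cscale = (\<lambda>c. Poly_Mapping.map ((*) c)),
      star = (\<lambda>f. \<Sum>v\<in>Poly_Mapping.keys f.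
        Poly_Mapping.single (adj v) (cnj (Poly_Mapping.lookup f v)))\<rparr>"

text \<open>The letter \<open>(g, False)\<close> stands for the generator \<open>g\<close> and \<open>(g, True)\<close> for its adjoint.\<close>

definition free_star_algebra :: "'g set \<Rightarrow> (('g \<times> bool) list \<Rightarrow>\<^sub>0 complex) star_alg" where
  "free_star_algebra G = monoid_star_algebra
     \<lparr>carrier = lists (G \<times> UNIV), monoid.mult = (@), one = []\<rparr>
     (\<lambda>w. rev (map (\<lambda>(g, b). (g, \<not> b)) w))"

text \<open>The C*-tensor product is the maximal one, that is, the enveloping C*-algebra of the algebraic
  tensor product. The latter is presented as formal combinations of pairs modulo bilinearity.
  For the full algebras considered below, the minimal tensor product would give the same notion
  of comultiplication, because the comultiplication takes values in the algebraic tensor product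
  on the dense *-algebra generated by the entries of the magic unitary.\<close>

definition pair_star_algebra ::
    "('a, 'm) star_alg_scheme \<Rightarrow> ('b, 'l) star_alg_scheme \<Rightarrow> ('a \<times> 'b \<Rightarrow>\<^sub>0 complex) star_alg" where
  "pair_star_algebra A B = monoid_star_algebra (A \<times>\<times> B) (map_prod (star A) (star B))"

definition bilinearity_relators ::
    "('a, 'm) star_alg_scheme \<Rightarrow> ('b, 'l) star_alg_scheme \<Rightarrow> ('a \<times> 'b \<Rightarrow>\<^sub>0 complex) set" where
  "bilinearity_relators A B =
     (let pr = \<lambda>a b. Poly_Mapping.single (a, b) (1 :: complex) in
       {pr (a \<oplus>\<^bsub>A\<^esub> a') b - pr a b - pr a' b | a a' b.
          a \<in> carrier A \<and> a' \<in> carrier A \<and> b \<in> carrier B} \<union>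
       {pr a (b \<oplus>\<^bsub>B\<^esub> b') - pr a b - pr a b' | a b b'.
          a \<in> carrier A \<and> b \<in> carrier B \<and> b' \<in> carrier B} \<union>
       {pr (cscale A c a) b - Poly_Mapping.single (a, b) c | c a b.
          a \<in> carrier A \<and> b \<in> carrier B} \<union>
       {pr a (cscale B c b) - Poly_Mapping.single (a, b) c | c a b.
          a \<in> carrier A \<and> b \<in> carrier B})"

definition cstar_tensor :: "('a, 'm) star_alg_scheme \<Rightarrow> ('b, 'l) star_alg_scheme \<Rightarrow>
    ((nat \<Rightarrow> ('a \<times> 'b \<Rightarrow>\<^sub>0 complex)) set) cstar" where
  "cstar_tensor A B = enveloping_cstar (pair_star_algebra A B) (bilinearity_relators A B)"

definition elem_tensor :: "('a, 'm) star_alg_scheme \<Rightarrow> ('b, 'l) star_alg_scheme \<Rightarrow>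
    'a \<Rightarrow> 'b \<Rightarrow> (nat \<Rightarrow> ('a \<times> 'b \<Rightarrow>\<^sub>0 complex)) set" where
  "elem_tensor A B a b =
     enveloping_class (pair_star_algebra A B) (bilinearity_relators A B)
       (Poly_Mapping.single (a, b) 1)"

section \<open>Magic unitaries and quantum permutation algebras\<close>

definition magic_unitary :: "('a, 'm) star_alg_scheme \<Rightarrow> nat \<Rightarrow> (nat \<Rightarrow> nat \<Rightarrow> 'a) \<Rightarrow> bool" where
  "magic_unitary A n u \<longleftrightarrow>
     (\<forall>i\<in>{1..n}. \<forall>j\<in>{1..n}. u i j \<in> carrier A \<and> star A (u i j) = u i j \<and>
        u i j \<otimes>\<^bsub>A\<^esub> u i j = u i j) \<and>
     (\<forall>i\<in>{1..n}. \<forall>j\<in>{1..n}. \<forall>k\<in>{1..n}. j \<noteq> k \<longrightarrow>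
        u i j \<otimes>\<^bsub>A\<^esub> u i k = \<zero>\<^bsub>A\<^esub> \<and> u j i \<otimes>\<^bsub>A\<^esub> u k i = \<zero>\<^bsub>A\<^esub>) \<and>
     (\<forall>i\<in>{1..n}. (\<Oplus>\<^bsub>A\<^esub>j\<in>{1..n}. u i j) = \<one>\<^bsub>A\<^esub> \<and> (\<Oplus>\<^bsub>A\<^esub>j\<in>{1..n}. u j i) = \<one>\<^bsub>A\<^esub>)"

type_synonym magic_poly = "((nat \<times> nat) \<times> bool) list \<Rightarrow>\<^sub>0 complex"

definition magic_free :: "nat \<Rightarrow> magic_poly star_alg" where
  "magic_free n = free_star_algebra ({1..n} \<times> {1..n})"

definition magic_var :: "nat \<Rightarrow> nat \<Rightarrow> magic_poly" where
  "magic_var i j = Poly_Mapping.single [((i, j), False)] 1"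

definition magic_relators :: "nat \<Rightarrow> magic_poly set" where
  "magic_relators n =
     (let F = magic_free n; x = magic_var; I = {1..n} in
       {x i j - star F (x i j) | i j. i \<in> I \<and> j \<in> I} \<union>
       {x i j \<otimes>\<^bsub>F\<^esub> x i j - x i j | i j. i \<in> I \<and> j \<in> I} \<union>
       {x i j \<otimes>\<^bsub>F\<^esub> x i k | i j k. i \<in> I \<and> j \<in> I \<and> k \<in> I \<and> j \<noteq> k} \<union>
       {x j i \<otimes>\<^bsub>F\<^esub> x k i | i j k. i \<in> I \<and> j \<in> I \<and> k \<in> I \<and> j \<noteq> k} \<union>
       {(\<Sum>j\<in>I. x i j) - \<one>\<^bsub>F\<^esub> | i. i \<in> I} \<union>
       {(\<Sum>j\<in>I. x j i) - \<one>\<^bsub>F\<^esub> | i. i \<in> I})"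

text \<open>The universal algebra \<open>A\<^sub>s(n)\<close> and its generators.\<close>

type_synonym magic_elem = "(nat \<Rightarrow> magic_poly) set"

definition A\<^sub>s :: "nat \<Rightarrow> magic_elem cstar" where
  "A\<^sub>s n = enveloping_cstar (magic_free n) (magic_relators n)"

definition A\<^sub>s_gen :: "nat \<Rightarrow> nat \<Rightarrow> nat \<Rightarrow> magic_elem" where
  "A\<^sub>s_gen n i j = enveloping_class (magic_free n) (magic_relators n) (magic_var i j)"

inductive_set generated_star_algebra :: "('a, 'm) star_alg_scheme \<Rightarrow> 'a set \<Rightarrow> 'a set"
  for A :: "('a, 'm) star_alg_scheme" and G :: "'a set" where
  gen: "x \<in> G \<Longrightarrow> x \<in> generated_star_algebra A G"
| one: "\<one>\<^bsub>A\<^esub> \<in> generated_star_algebra A G"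
| add: "\<lbrakk>x \<in> generated_star_algebra A G; y \<in> generated_star_algebra A G\<rbrakk> \<Longrightarrow>
    x \<oplus>\<^bsub>A\<^esub> y \<in> generated_star_algebra A G"
| mult: "\<lbrakk>x \<in> generated_star_algebra A G; y \<in> generated_star_algebra A G\<rbrakk> \<Longrightarrow>
    x \<otimes>\<^bsub>A\<^esub> y \<in> generated_star_algebra A G"
| cscale: "x \<in> generated_star_algebra A G \<Longrightarrow> cscale A c x \<in> generated_star_algebra A G"
| star: "x \<in> generated_star_algebra A G \<Longrightarrow> star A x \<in> generated_star_algebra A G"

text \<open>A C*-algebra \<open>A\<close> is the enveloping C*-algebra of a *-subalgebra \<open>D\<close> when \<open>D\<close> is dense
  and the norm of \<open>A\<close> is, on \<open>D\<close>, the largest C*-seminorm of \<open>D\<close>.\<close>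

definition dense_in :: "('a, 'm) cstar_scheme \<Rightarrow> 'a set \<Rightarrow> bool" where
  "dense_in A D \<longleftrightarrow> (\<forall>x\<in>carrier A. \<forall>e>0. \<exists>y\<in>D. nrm A (x \<ominus>\<^bsub>A\<^esub> y) < e)"

definition is_enveloping_of :: "('a, 'm) cstar_scheme \<Rightarrow> 'a set \<Rightarrow> bool" where
  "is_enveloping_of A D \<longleftrightarrow>
     D \<subseteq> carrier A \<and> dense_in A D \<and>
     (\<forall>p. cstar_seminorm (A\<lparr>carrier := D\<rparr>) p \<longrightarrow> (\<forall>x\<in>D. p x \<le> nrm A x))"

definition quantum_permutation_algebra ::
    "nat \<Rightarrow> 'a cstar \<Rightarrow> (nat \<Rightarrow> nat \<Rightarrow> 'a) \<Rightarrow> bool" where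
  "quantum_permutation_algebra n A u \<longleftrightarrow>
     cstar_algebra A \<and> magic_unitary A n u \<and>
     is_enveloping_of A
       (generated_star_algebra A {u i j | i j. i \<in> {1..n} \<and> j \<in> {1..n}}) \<and>
     (\<exists>\<Delta>\<in>cstar_hom A (cstar_tensor A A). \<forall>i\<in>{1..n}. \<forall>j\<in>{1..n}.
        \<Delta> (u i j) = (\<Oplus>\<^bsub>cstar_tensor A A\<^esub>k\<in>{1..n}. elem_tensor A A (u i k) (u k j))) \<and>
     (\<exists>\<epsilon>\<in>cstar_hom A complex_cstar. \<forall>i\<in>{1..n}. \<forall>j\<in>{1..n}.
        \<epsilon> (u i j) = (if i = j then 1 else 0)) \<and>
     (\<exists>S\<in>cstar_hom A (opposite A). \<forall>i\<in>{1..n}. \<forall>j\<in>{1..n}. S (u i j) = u j i)"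

section \<open>Hopf images\<close>

definition realizes_factorization :: "nat \<Rightarrow> 'c cstar \<Rightarrow> (magic_elem \<Rightarrow> 'c) \<Rightarrow>
    'a cstar \<Rightarrow> (nat \<Rightarrow> nat \<Rightarrow> 'a) \<Rightarrow> bool" where
  "realizes_factorization n C \<pi> A u \<longleftrightarrow>
     quantum_permutation_algebra n A u \<and>
     (\<exists>\<phi>\<in>cstar_hom (A\<^sub>s n) A. \<exists>\<rho>\<in>cstar_hom A C.
        (\<forall>i\<in>{1..n}. \<forall>j\<in>{1..n}. \<phi> (A\<^sub>s_gen n i j) = u i j) \<and>
        (\<forall>x\<in>carrier (A\<^sub>s n). \<pi> x = \<rho> (\<phi> x)))"

text \<open>The competing algebras \<open>B\<close> have their carrier in the type of elements of \<open>A\<^sub>s(n)\<close>. This is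
  no restriction: a quantum permutation algebra is a quotient of \<open>A\<^sub>s(n)\<close>, so a choice of
  representatives identifies it with a C*-algebra whose carrier is a subset of this type.\<close>

definition hopf_image :: "nat \<Rightarrow> 'c cstar \<Rightarrow> (magic_elem \<Rightarrow> 'c) \<Rightarrow>
    'a cstar \<Rightarrow> (nat \<Rightarrow> nat \<Rightarrow> 'a) \<Rightarrow> bool" where
  "hopf_image n C \<pi> A u \<longleftrightarrow>
     realizes_factorization n C \<pi> A u \<and>
     (\<forall>(B :: magic_elem cstar) v. realizes_factorization n C \<pi> B v \<longrightarrow>
        (\<exists>f\<in>cstar_hom B A. f ` carrier B = carrier A \<and>
           (\<forall>i\<in>{1..n}. \<forall>j\<in>{1..n}. f (v i j) = u i j)))"

definition associated_algebra :: "nat \<Rightarrow> (nat \<Rightarrow> nat \<Rightarrow> 'h::complex_hilbert_space set) \<Rightarrow>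
    'a cstar \<Rightarrow> (nat \<Rightarrow> nat \<Rightarrow> 'a) \<Rightarrow> bool" where
  "associated_algebra n X A u \<longleftrightarrow>
     (\<exists>\<pi>\<in>cstar_hom (A\<^sub>s n) bounded_operators.
        (\<forall>i\<in>{1..n}. \<forall>j\<in>{1..n}. \<pi> (A\<^sub>s_gen n i j) = orth_projection (X i j)) \<and>
        hopf_image n bounded_operators \<pi> A u)"

end

theory Submission
  imports Defs "HOL-Combinatorics.Permutations"
begin

text \<open>If \<open>A\<close> is commutative, the projections \<open>P i j\<close> onto \<open>X i j\<close> are images of the commuting \<open>u i j\<close>,
  so \<open>H\<close> is the orthogonal sum of their joint ranges \<open>\<Inter>i. X i (\<sigma> i)\<close>, indexed by the permutations \<open>\<sigma>\<close>.

  Conversely, let \<open>B\<close> be the universal C*-algebra generated by a magic unitary with commuting entries.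
  It is a quantum permutation algebra: \<open>\<Delta>\<close>, \<open>\<epsilon>\<close> and \<open>S\<close> exist because their prescribed values on the generators
  are again commuting magic unitaries. If \<open>X = X\<^sup>E\<close>, the \<open>P i j\<close> commute, whence a representation of \<open>B\<close>; it
  factorizes \<open>\<pi>\<close> since morphisms of C*-algebras are automatically continuous. By minimality \<open>A\<close> is a
  quotient of the commutative algebra \<open>B\<close>.\<close>

section \<open>Seminorms on star-algebras and automatic continuity\<close>

text \<open>Morphisms in \<open>cstar_hom\<close> are purely algebraic, and the norm of a universal
  algebra is a supremum of C*-seminorms, which has a meaning only when these are bounded at every
  element. Automatic continuity answers both: any C*-seminorm on a C*-algebra lies below its norm.
  Hence morphisms are contractive and determined on dense subsets, and on a tensor product both legs
  of a seminorm are bounded, which gives the cross bound. For the magic relators the bound comes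
  instead from the variables being projections up to seminorm zero. \<open>A\<^sub>s n\<close> and
  \<open>B\<close> are completions of the same free *-algebra for two sets of relators, so one
  treatment of presentations serves both, and the elements of \<open>B\<close> have the very type
  over which minimality in \<open>hopf_image\<close> quantifies.\<close>

context star_algebra
begin

declare cscale_closed [simp, intro] star_closed [simp, intro] star_star [simp] cscale_one [simp]

lemma cscale_zero_left [simp]:
  assumes "x \<in> carrier A"
  shows "cscale A 0 x = \<zero>"
proof -
  have "cscale A 0 x \<oplus> cscale A 0 x = cscale A 0 x"
    using cscale_add_left [of x 0 0] assms by simp
  then show ?thesis
    using assms cscale_closed [OF assms, of 0] add.l_cancel_one by blast
qed

text \<open>Turns negation into a scalar multiple, so that morphisms, seminorms and the completion
  treat subtraction through \<open>cscale\<close>.\<close>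

lemma cscale_minus_one:
  assumes "x \<in> carrier A"
  shows "cscale A (- 1) x = \<ominus> x"
proof -
  have "cscale A (- 1) x \<oplus> x = \<zero>"
    using cscale_add_left [of x "- 1" 1] assms by simp
  then show ?thesis
    using assms by (simp add: minus_equality)
qed

lemma cscale_a_inv:
  assumes "x \<in> carrier A"
  shows "cscale A c (\<ominus> x) = \<ominus> cscale A c x"
proof -
  have "cscale A c (\<ominus> x) = cscale A c (cscale A (- 1) x)"
    using assms by (simp add: cscale_minus_one)
  also have "\<dots> = cscale A (- 1) (cscale A c x)"
    using assms by (simp add: cscale_cscale)
  finally show ?thesis
    using assms by (simp add: cscale_minus_one)
qed

lemma cscale_minus_left:
  assumes "x \<in> carrier A"
  shows "cscale A (- c) x = \<ominus> cscale A c x"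
proof -
  have "cscale A (- c) x = cscale A (- 1) (cscale A c x)"
    using assms by (simp add: cscale_cscale)
  then show ?thesis
    using assms by (simp add: cscale_minus_one)
qed

lemma cscale_diff_right:
  "\<lbrakk>x \<in> carrier A; y \<in> carrier A\<rbrakk> \<Longrightarrow> cscale A c (x \<ominus> y) = cscale A c x \<ominus> cscale A c y"
  by (simp add: a_minus_def cscale_add_right cscale_a_inv)

lemma cscale_zero_right [simp]: "cscale A c \<zero> = \<zero>"
  using cscale_diff_right [of \<zero> \<zero> c] by (simp add: r_neg a_minus_def)

lemma star_a_inv: "x \<in> carrier A \<Longrightarrow> star A (\<ominus> x) = \<ominus> star A x"
  using star_cscale [of x "- 1"] by (simp add: cscale_minus_one)

lemma star_diff:
  "\<lbrakk>x \<in> carrier A; y \<in> carrier A\<rbrakk> \<Longrightarrow> star A (x \<ominus> y) = star A x \<ominus> star A y"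
  by (simp add: a_minus_def star_add star_a_inv)

lemma star_zero [simp]: "star A \<zero> = \<zero>"
  using star_diff [of \<zero> \<zero>] by (simp add: r_neg a_minus_def)

text \<open>By antimultiplicativity \<open>star A \<one> \<otimes> \<one>\<close> is its own
  adjoint, so \<open>star A \<one>\<close> is selfadjoint and equals \<open>\<one>\<close>.\<close>

lemma star_one [simp]: "star A \<one> = \<one>"
proof -
  have "star A \<one> = star A (star A (star A \<one> \<otimes> \<one>))"
    by simp
  also have "\<dots> = \<one>"
    by (subst star_mult) simp_all
  finally show ?thesis .
qed

lemma star_finsum:
  assumes "finite I" "f \<in> I \<rightarrow> carrier A"
  shows "star A (\<Oplus>i\<in>I. f i) = (\<Oplus>i\<in>I. star A (f i))"
  using assms by (induction I) (auto simp: star_add Pi_def)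

lemma minus_split:
  assumes "x \<in> carrier A" "y \<in> carrier A" "z \<in> carrier A"
  shows "x \<ominus> z = (x \<ominus> y) \<oplus> (y \<ominus> z)"
  using assms by (simp add: a_minus_def a_assoc r_neg1)

lemma mult_minus_split:
  assumes "x \<in> carrier A" "y \<in> carrier A" "x' \<in> carrier A" "y' \<in> carrier A"
  shows "x \<otimes> y \<ominus> x' \<otimes> y' = (x \<ominus> x') \<otimes> y \<oplus> x' \<otimes> (y \<ominus> y')"
  using assms by (simp add: a_minus_def l_distr r_distr l_minus r_minus a_assoc r_neg1)

lemma add_minus_add:
  assumes "x \<in> carrier A" "y \<in> carrier A" "x' \<in> carrier A" "y' \<in> carrier A"
  shows "(x \<oplus> y) \<ominus> (x' \<oplus> y') = (x \<ominus> x') \<oplus> (y \<ominus> y')"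
  using assms by (simp add: a_minus_def minus_add a_ac)

lemma minus_swap:
  assumes "x \<in> carrier A" "y \<in> carrier A"
  shows "y \<ominus> x = cscale A (- 1) (x \<ominus> y)"
  using assms by (simp add: cscale_minus_one a_minus_def minus_add a_ac)

lemma minus_eq_zero_iff:
  assumes "x \<in> carrier A" "y \<in> carrier A"
  shows "x \<ominus> y = \<zero> \<longleftrightarrow> x = y"
  using assms by (metis a_minus_def minus_equality minus_minus a_inv_closed r_neg)

lemma minus_self [simp]: "x \<in> carrier A \<Longrightarrow> x \<ominus> x = \<zero>"
  by (simp add: a_minus_def r_neg)

text \<open>Cancellation for the case that sorting by \<open>a_ac\<close> leaves a term between an
  element and its negative.\<close>

lemma add_cancel_right:
  assumes "x \<in> carrier A" "y \<in> carrier A"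
  shows "x \<oplus> (y \<oplus> \<ominus> x) = y" "\<ominus> x \<oplus> (y \<oplus> x) = y"
  using assms by (simp_all add: a_lcomm [of _ y] r_neg l_neg)

lemma minus_zero_right [simp]: "x \<in> carrier A \<Longrightarrow> x \<ominus> \<zero> = x"
  by (simp add: a_minus_def)

end

text \<open>The seminorm is a parameter because the same estimates serve the norm of a C*-algebra, a
  competing seminorm on it, and the maximal seminorm that defines a universal algebra.\<close>

locale cstar_seminormed = star_algebra A for A :: "('a, 'm) star_alg_scheme" (structure) +
  fixes p :: "'a \<Rightarrow> real"
  assumes cstar_seminorm: "cstar_seminorm A p"
begin

lemma p_nonneg [simp]: "x \<in> carrier A \<Longrightarrow> 0 \<le> p x"
  and p_triangle: "\<lbrakk>x \<in> carrier A; y \<in> carrier A\<rbrakk> \<Longrightarrow> p (x \<oplus> y) \<le> p x + p y"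
  and p_cscale: "x \<in> carrier A \<Longrightarrow> p (cscale A c x) = cmod c * p x"
  and p_mult: "\<lbrakk>x \<in> carrier A; y \<in> carrier A\<rbrakk> \<Longrightarrow> p (x \<otimes> y) \<le> p x * p y"
  and p_cstar: "x \<in> carrier A \<Longrightarrow> p (star A x \<otimes> x) = (p x)\<^sup>2"
  using cstar_seminorm unfolding cstar_seminorm_def by auto

lemma p_zero [simp]: "p \<zero> = 0"
  using p_cscale [of \<zero> 0] by simp

lemma p_minus_commute: "\<lbrakk>x \<in> carrier A; y \<in> carrier A\<rbrakk> \<Longrightarrow> p (x \<ominus> y) = p (y \<ominus> x)"
  using minus_swap [of x y] by (simp add: p_cscale)

lemma p_minus_triangle:
  "\<lbrakk>x \<in> carrier A; y \<in> carrier A; z \<in> carrier A\<rbrakk> \<Longrightarrow> p (x \<ominus> z) \<le> p (x \<ominus> y) + p (y \<ominus> z)"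
  using minus_split [of x y z] p_triangle [of "x \<ominus> y" "y \<ominus> z"] by simp

lemma p_le_add_minus: "\<lbrakk>x \<in> carrier A; y \<in> carrier A\<rbrakk> \<Longrightarrow> p x \<le> p (x \<ominus> y) + p y"
  using p_minus_triangle [of x y \<zero>] by simp

lemma p_abs_diff:
  assumes "x \<in> carrier A" "y \<in> carrier A"
  shows "\<bar>p x - p y\<bar> \<le> p (x \<ominus> y)"
  using p_le_add_minus [of x y] p_le_add_minus [of y x] p_minus_commute [of x y] assms by linarith

text \<open>Divide \<open>p x * p x = p (star A x \<otimes> x) \<le> p (star A x) * p x\<close> by
  \<open>p x\<close>. Applied to the adjoint as well, this makes the involution isometric.\<close>

lemma p_star_le: "x \<in> carrier A \<Longrightarrow> p x \<le> p (star A x)"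
proof (cases "p x = 0")
  case False
  assume x: "x \<in> carrier A"
  have "p x * p x \<le> p (star A x) * p x"
    using p_cstar [OF x] p_mult [of "star A x" x] x by (simp add: power2_eq_square)
  then show ?thesis
    using False x p_nonneg [OF x] by simp
qed simp

lemma p_star [simp]: "x \<in> carrier A \<Longrightarrow> p (star A x) = p x"
  using p_star_le [of x] p_star_le [of "star A x"] by simp

text \<open>\<open>p \<one>\<close> equals its square, so it is 0 or 1. The value 0 occurs for the
  zero seminorm, for instance on the zero algebra, hence an inequality.\<close>

lemma p_one_le: "p \<one> \<le> 1"
proof -
  have "p \<one> = (p \<one>)\<^sup>2"
    using p_cstar [of \<one>] by simp
  then show ?thesis
    by (metis order_refl power2_eq_square mult_cancel_right1 zero_le_one)
qed

lemma p_mult_minus: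
  assumes "x \<in> carrier A" "y \<in> carrier A" "x' \<in> carrier A" "y' \<in> carrier A"
  shows "p (x \<otimes> y \<ominus> x' \<otimes> y') \<le> p (x \<ominus> x') * p y + p x' * p (y \<ominus> y')"
proof -
  have "p (x \<otimes> y \<ominus> x' \<otimes> y') \<le> p ((x \<ominus> x') \<otimes> y) + p (x' \<otimes> (y \<ominus> y'))"
    using assms by (simp add: mult_minus_split p_triangle)
  also have "\<dots> \<le> p (x \<ominus> x') * p y + p x' * p (y \<ominus> y')"
    using assms by (intro add_mono p_mult) auto
  finally show ?thesis .
qed

text \<open>Equality of classes in the Hausdorff completion. With a constant second sequence it is
  convergence, so limits and classes share one calculus.\<close>

definition null_diff :: "(nat \<Rightarrow> 'a) \<Rightarrow> (nat \<Rightarrow> 'a) \<Rightarrow> bool" where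
  "null_diff s t \<longleftrightarrow> range s \<subseteq> carrier A \<and> range t \<subseteq> carrier A \<and> (\<lambda>k. p (s k \<ominus> t k)) \<longlonglongrightarrow> 0"

lemma null_diff_closed:
  assumes "null_diff s t"
  shows "s k \<in> carrier A" "t k \<in> carrier A"
  using assms unfolding null_diff_def by auto

lemma null_diff_limit: "null_diff s t \<Longrightarrow> (\<lambda>k. p (s k \<ominus> t k)) \<longlonglongrightarrow> 0"
  by (simp add: null_diff_def)

lemma null_diff_refl: "range s \<subseteq> carrier A \<Longrightarrow> null_diff s s"
  by (auto simp: null_diff_def image_subset_iff)

lemma null_diff_squeeze:
  assumes "range s \<subseteq> carrier A" "range t \<subseteq> carrier A"
    and "\<And>k. p (s k \<ominus> t k) \<le> f k" "f \<longlonglongrightarrow> 0"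
  shows "null_diff s t"
  unfolding null_diff_def
  by (intro conjI assms real_tendsto_sandwich [OF _ _ tendsto_const assms(4)])
     (use assms(1,2) in \<open>auto simp: assms(3) image_subset_iff\<close>)

lemma null_diff_sym: "null_diff s t \<Longrightarrow> null_diff t s"
  using p_minus_commute unfolding null_diff_def by (simp add: image_subset_iff)

lemma null_diff_trans [trans]:
  assumes "null_diff s t" "null_diff t r"
  shows "null_diff s r"
proof (rule null_diff_squeeze)
  show "(\<lambda>k. p (s k \<ominus> t k) + p (t k \<ominus> r k)) \<longlonglongrightarrow> 0"
    using tendsto_add [OF null_diff_limit [OF assms(1)] null_diff_limit [OF assms(2)]] by simp
qed (use assms null_diff_closed p_minus_triangle in auto)

lemma null_diff_add:
  assumes "null_diff s t" "null_diff s' t'"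
  shows "null_diff (\<lambda>k. s k \<oplus> s' k) (\<lambda>k. t k \<oplus> t' k)"
proof (rule null_diff_squeeze)
  note c = null_diff_closed [OF assms(1)] null_diff_closed [OF assms(2)]
  show "p ((s k \<oplus> s' k) \<ominus> (t k \<oplus> t' k)) \<le> p (s k \<ominus> t k) + p (s' k \<ominus> t' k)" for k
    using c by (simp add: add_minus_add p_triangle)
  show "(\<lambda>k. p (s k \<ominus> t k) + p (s' k \<ominus> t' k)) \<longlonglongrightarrow> 0"
    using tendsto_add [OF null_diff_limit [OF assms(1)] null_diff_limit [OF assms(2)]] by simp
qed (use assms null_diff_closed in auto)

lemma null_diff_cscale:
  assumes "null_diff s t"
  shows "null_diff (\<lambda>k. cscale A c (s k)) (\<lambda>k. cscale A c (t k))"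
proof (rule null_diff_squeeze)
  note c = null_diff_closed [OF assms]
  show "p (cscale A c (s k) \<ominus> cscale A c (t k)) \<le> cmod c * p (s k \<ominus> t k)" for k
    using c by (simp add: cscale_diff_right [symmetric] p_cscale)
  show "(\<lambda>k. cmod c * p (s k \<ominus> t k)) \<longlonglongrightarrow> 0"
    using tendsto_mult_right_zero [OF null_diff_limit [OF assms]] .
qed (use assms null_diff_closed in auto)

lemma null_diff_star:
  assumes "null_diff s t"
  shows "null_diff (\<lambda>k. star A (s k)) (\<lambda>k. star A (t k))"
proof (rule null_diff_squeeze)
  note c = null_diff_closed [OF assms]
  show "p (star A (s k) \<ominus> star A (t k)) \<le> p (s k \<ominus> t k)" for k
    using c by (simp add: star_diff [symmetric])
qed (use assms null_diff_closed null_diff_limit in auto)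

text \<open>In \<open>(s - t) s' + t (s' - t')\<close> the null factors are multiplied by
  \<open>s'\<close> and by \<open>t\<close>, hence the bounds on these two sequences.\<close>

lemma null_diff_mult:
  assumes "null_diff s t" "null_diff s' t'"
    and "\<And>k. p (s' k) \<le> K" "\<And>k. p (t k) \<le> L"
  shows "null_diff (\<lambda>k. s k \<otimes> s' k) (\<lambda>k. t k \<otimes> t' k)"
proof (rule null_diff_squeeze)
  note c = null_diff_closed [OF assms(1)] null_diff_closed [OF assms(2)]
  show "p (s k \<otimes> s' k \<ominus> t k \<otimes> t' k) \<le> p (s k \<ominus> t k) * K + L * p (s' k \<ominus> t' k)" for k
  proof -
    have "p (s k \<otimes> s' k \<ominus> t k \<otimes> t' k) \<le> p (s k \<ominus> t k) * p (s' k) + p (t k) * p (s' k \<ominus> t' k)"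
      using c by (intro p_mult_minus) auto
    also have "\<dots> \<le> p (s k \<ominus> t k) * K + L * p (s' k \<ominus> t' k)"
      using c assms(3,4) by (intro add_mono mult_left_mono mult_right_mono) auto
    finally show ?thesis .
  qed
  show "(\<lambda>k. p (s k \<ominus> t k) * K + L * p (s' k \<ominus> t' k)) \<longlonglongrightarrow> 0"
    using tendsto_add [OF tendsto_mult_left_zero [OF null_diff_limit [OF assms(1)]]
        tendsto_mult_right_zero [OF null_diff_limit [OF assms(2)]]] by simp
qed (use assms null_diff_closed in auto)

lemma seminorm_Cauchy_closed: "seminorm_Cauchy A p s \<Longrightarrow> s k \<in> carrier A"
  by (simp add: seminorm_Cauchy_def)

lemma seminorm_CauchyD:
  "\<lbrakk>seminorm_Cauchy A p s; e > 0\<rbrakk> \<Longrightarrow> \<exists>M. \<forall>k\<ge>M. \<forall>l\<ge>M. p (s k \<ominus> s l) < e"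
  by (simp add: seminorm_Cauchy_def)

lemma seminorm_Cauchy_const: "x \<in> carrier A \<Longrightarrow> seminorm_Cauchy A p (\<lambda>k. x)"
  by (simp add: seminorm_Cauchy_def)

lemma seminorm_Cauchy_p:
  assumes "seminorm_Cauchy A p s"
  shows "Cauchy (\<lambda>k. p (s k))"
proof (rule metric_CauchyI)
  fix e :: real
  assume "e > 0"
  then obtain M where M: "\<And>k l. \<lbrakk>k \<ge> M; l \<ge> M\<rbrakk> \<Longrightarrow> p (s k \<ominus> s l) < e"
    using seminorm_CauchyD [OF assms] by blast
  have "dist (p (s k)) (p (s l)) < e" if "k \<ge> M" "l \<ge> M" for k l
    using M [OF that] p_abs_diff [of "s k" "s l"] seminorm_Cauchy_closed [OF assms]
    by (simp add: dist_real_def)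
  then show "\<exists>M. \<forall>k\<ge>M. \<forall>l\<ge>M. dist (p (s k)) (p (s l)) < e"
    by blast
qed

lemma seminorm_Cauchy_bounded:
  assumes "seminorm_Cauchy A p s"
  obtains K where "K > 0" "\<And>k. p (s k) \<le> K"
proof -
  have "Bseq (\<lambda>k. p (s k))"
    using seminorm_Cauchy_p [OF assms] Cauchy_Bseq by blast
  then obtain K where "K > 0" "\<And>k. norm (p (s k)) \<le> K"
    unfolding Bseq_def by blast
  then show ?thesis
    using that seminorm_Cauchy_closed [OF assms] by simp
qed

lemma null_diff_Cauchy:
  assumes st: "null_diff s t" and s: "seminorm_Cauchy A p s"
  shows "seminorm_Cauchy A p t"
  unfolding seminorm_Cauchy_def
proof (intro conjI allI impI)
  note c = null_diff_closed [OF st]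
  show "t k \<in> carrier A" for k
    using c by simp
  fix e :: real
  assume e: "e > 0"
  obtain M where M: "\<And>k l. \<lbrakk>k \<ge> M; l \<ge> M\<rbrakk> \<Longrightarrow> p (s k \<ominus> s l) < e / 3"
    using seminorm_CauchyD [OF s, of "e / 3"] e by auto
  obtain N where N: "\<And>k. k \<ge> N \<Longrightarrow> p (s k \<ominus> t k) < e / 3"
    using LIMSEQ_D [OF null_diff_limit [OF st], of "e / 3"] e c by auto
  have "p (t k \<ominus> t l) < e" if "k \<ge> max M N" "l \<ge> max M N" for k l
  proof -
    have "p (t k \<ominus> t l) \<le> p (t k \<ominus> s k) + (p (s k \<ominus> s l) + p (s l \<ominus> t l))"
      using p_minus_triangle [of "t k" "s k" "t l"] p_minus_triangle [of "s k" "s l" "t l"] c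
      by force
    then show ?thesis
      using M [of k l] N [of k] N [of l] that p_minus_commute [of "s k" "t k"] c by auto
  qed
  then show "\<exists>M. \<forall>k\<ge>M. \<forall>l\<ge>M. p (t k \<ominus> t l) < e"
    by blast
qed

text \<open>Common source of the closure of Cauchy sequences under sum, product and scaling: each
  operation is Lipschitz along its operands, for the product with constants that bound the other
  factor.\<close>

lemma seminorm_Cauchy_bound:
  assumes s: "seminorm_Cauchy A p s" and t: "seminorm_Cauchy A p t" and r: "\<And>k. r k \<in> carrier A"
    and le: "\<And>k l. p (r k \<ominus> r l) \<le> K * p (s k \<ominus> s l) + L * p (t k \<ominus> t l)" and KL: "0 \<le> K" "0 \<le> L"
  shows "seminorm_Cauchy A p r"
  unfolding seminorm_Cauchy_def
proof (intro conjI allI impI r)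
  fix e :: real
  assume e: "e > 0"
  \<comment> \<open>The added 1 keeps the divisor positive when \<open>K = L = 0\<close> and makes
    \<open>(K + L) * d\<close> strictly smaller than \<open>e\<close>.\<close>
  define d where "d = e / (K + L + 1)"
  have d: "d > 0" "(K + L) * d < e"
    using e KL by (simp_all add: d_def field_simps)
  obtain M where M: "\<And>k l. \<lbrakk>k \<ge> M; l \<ge> M\<rbrakk> \<Longrightarrow> p (s k \<ominus> s l) < d"
    using seminorm_CauchyD [OF s d(1)] by blast
  obtain N where N: "\<And>k l. \<lbrakk>k \<ge> N; l \<ge> N\<rbrakk> \<Longrightarrow> p (t k \<ominus> t l) < d"
    using seminorm_CauchyD [OF t d(1)] by blast
  have "p (r k \<ominus> r l) < e" if "k \<ge> max M N" "l \<ge> max M N" for k l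
  proof -
    have "K * p (s k \<ominus> s l) \<le> K * d" "L * p (t k \<ominus> t l) \<le> L * d"
      using M [of k l] N [of k l] that KL by (auto intro!: mult_left_mono)
    then show ?thesis
      using le [of k l] d(2) by (simp add: distrib_right)
  qed
  then show "\<exists>M. \<forall>k\<ge>M. \<forall>l\<ge>M. p (r k \<ominus> r l) < e"
    by blast
qed

lemma seminorm_Cauchy_add:
  assumes "seminorm_Cauchy A p s" "seminorm_Cauchy A p t"
  shows "seminorm_Cauchy A p (\<lambda>k. s k \<oplus> t k)"
  by (rule seminorm_Cauchy_bound [OF assms, where K = 1 and L = 1])
     (simp_all add: seminorm_Cauchy_closed [OF assms(1)] seminorm_Cauchy_closed [OF assms(2)]
       add_minus_add p_triangle)

lemma seminorm_Cauchy_mult: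
  assumes "seminorm_Cauchy A p s" "seminorm_Cauchy A p t"
  shows "seminorm_Cauchy A p (\<lambda>k. s k \<otimes> t k)"
proof -
  note c = seminorm_Cauchy_closed [OF assms(1)] seminorm_Cauchy_closed [OF assms(2)]
  obtain K where K: "K > 0" "\<And>k. p (s k) \<le> K"
    using seminorm_Cauchy_bounded [OF assms(1)] by blast
  obtain L where L: "L > 0" "\<And>k. p (t k) \<le> L"
    using seminorm_Cauchy_bounded [OF assms(2)] by blast
  have "p (s k \<otimes> t k \<ominus> s l \<otimes> t l) \<le> L * p (s k \<ominus> s l) + K * p (t k \<ominus> t l)" for k l
  proof -
    have "p (s k \<otimes> t k \<ominus> s l \<otimes> t l) \<le> p (s k \<ominus> s l) * p (t k) + p (s l) * p (t k \<ominus> t l)"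
      using c by (intro p_mult_minus) auto
    also have "\<dots> \<le> p (s k \<ominus> s l) * L + K * p (t k \<ominus> t l)"
      using c K L by (intro add_mono mult_left_mono mult_right_mono) auto
    finally show ?thesis
      by (simp add: mult.commute)
  qed
  then show ?thesis
    using seminorm_Cauchy_bound [OF assms] c K L by (meson less_imp_le m_closed)
qed

lemma seminorm_Cauchy_cscale:
  assumes "seminorm_Cauchy A p s"
  shows "seminorm_Cauchy A p (\<lambda>k. cscale A c (s k))"
  by (rule seminorm_Cauchy_bound [OF assms assms, where K = "cmod c" and L = 0])
     (simp_all add: seminorm_Cauchy_closed [OF assms] p_cscale flip: cscale_diff_right)

lemma seminorm_Cauchy_star:
  assumes "seminorm_Cauchy A p s"
  shows "seminorm_Cauchy A p (\<lambda>k. star A (s k))"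
  using assms seminorm_Cauchy_closed [OF assms]
  by (simp add: seminorm_Cauchy_def star_diff [symmetric])

lemma null_diff_const_Cauchy:
  assumes "null_diff s (\<lambda>k. x)"
  shows "seminorm_Cauchy A p s"
  using null_diff_Cauchy [OF null_diff_sym [OF assms]] null_diff_closed [OF assms]
  by (simp add: seminorm_Cauchy_const)

lemma null_diff_mult_Cauchy:
  assumes "null_diff s t" "null_diff s' t'" "seminorm_Cauchy A p s" "seminorm_Cauchy A p s'"
  shows "null_diff (\<lambda>k. s k \<otimes> s' k) (\<lambda>k. t k \<otimes> t' k)"
proof -
  obtain K where "\<And>k. p (s' k) \<le> K"
    using seminorm_Cauchy_bounded [OF assms(4)] by blast
  moreover obtain L where "\<And>k. p (t k) \<le> L"
    using seminorm_Cauchy_bounded [OF null_diff_Cauchy [OF assms(1,3)]] by blast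
  ultimately show ?thesis
    using null_diff_mult assms(1,2) by blast
qed

end

section \<open>Limits in a C*-algebra and the comparison of its norm with C*-seminorms\<close>

sublocale cstar_algebra \<subseteq> cstar_seminormed A "nrm A"
  by unfold_locales (rule nrm_cstar)

context cstar_algebra
begin

lemma limit_unique:
  assumes "null_diff s (\<lambda>k. x)" "null_diff s (\<lambda>k. y)"
  shows "x = y"
proof -
  have xy: "null_diff (\<lambda>k. x) (\<lambda>k. y)"
    using assms null_diff_sym null_diff_trans by blast
  then have "nrm A (x \<ominus> y) = 0"
    using null_diff_limit [OF xy] LIMSEQ_const_iff by blast
  then show ?thesis
    using nrm_definite [of "x \<ominus> y"] null_diff_closed [OF xy] minus_eq_zero_iff by auto
qed

lemma limit_exists:
  assumes "seminorm_Cauchy A (nrm A) s"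
  obtains x where "null_diff s (\<lambda>k. x)"
  using nrm_complete [OF assms] seminorm_Cauchy_closed [OF assms] that
  unfolding null_diff_def by auto

text \<open>A square root \<open>b\<close> of \<open>1 - h^2\<close> is needed. Writing
  \<open>b = 1 - w\<close>, the equation becomes \<open>w = (h^2 + w^2) / 2\<close>. The map
  \<open>f\<close> on the right sends the ball of radius \<open>t = nrm A h\<close> to itself and
  has Lipschitz constant \<open>t\<close> there, so its iterates from zero converge to such a
  \<open>w\<close>.\<close>

lemma self_adjoint_contraction_seminorm_le:
  assumes q: "cstar_seminorm A q" and h: "h \<in> carrier A" "star A h = h" and lt: "nrm A h < 1"
  shows "q h \<le> 1"
proof -
  define f where "f z = cscale A (1/2) (h \<otimes> h \<oplus> z \<otimes> z)" for z
  define z where "z k = (f ^^ k) \<zero>" for k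
  define t where "t = nrm A h"
  have t: "0 \<le> t" "t < 1"
    using lt h by (auto simp: t_def)
  have z0: "z 0 = \<zero>" and zS: "z (Suc k) = f (z k)" for k
    by (simp_all add: z_def)
  have fc: "f x \<in> carrier A" if "x \<in> carrier A" for x
    using that h by (simp add: f_def)
  have zc: "z k \<in> carrier A" for k
    by (induction k) (simp_all add: z0 zS fc)
  have zstar: "star A (z k) = z k" for k
    by (induction k) (use h zc in \<open>simp_all add: z0 zS f_def star_cscale star_add star_mult\<close>)
  \<comment> \<open>The iterates are polynomials in \<open>h\<close>. The limit \<open>w\<close>,
    and with it \<open>b\<close>, inherits commutation with \<open>h\<close>, which cancels the
    cross terms in \<open>star A v \<otimes> v\<close> below.\<close>
  have zh: "z k \<otimes> h = h \<otimes> z k" for k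
  proof (induction k)
    case (Suc k)
    have "z k \<otimes> z k \<otimes> h = h \<otimes> (z k \<otimes> z k)"
      using h zc by (metis Suc m_assoc)
    then show ?case
      using h zc by (simp add: zS f_def cscale_mult_left cscale_mult_right l_distr r_distr m_assoc)
  qed (use h in \<open>simp add: z0\<close>)
  have bnd: "nrm A (z k) \<le> t" for k
  proof (induction k)
    case (Suc k)
    have "nrm A (h \<otimes> h \<oplus> z k \<otimes> z k) \<le> nrm A (h \<otimes> h) + nrm A (z k \<otimes> z k)"
      using h zc by (intro p_triangle) auto
    also have "\<dots> \<le> t * t + t * t"
      using p_mult [of h h] p_mult [of "z k" "z k"] h zc Suc t mult_mono [OF Suc Suc]
      by (simp add: t_def add_mono order_trans)
    also have "\<dots> \<le> 2 * t"
      using t mult_left_le [of t t] by simp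
    finally show ?case
      using h zc by (simp add: zS f_def p_cscale)
  qed (use t in \<open>simp add: z0\<close>)
  have step: "nrm A (z (Suc k) \<ominus> z k) \<le> t ^ k" for k
  proof (induction k)
    case 0
    have "nrm A (z (Suc 0) \<ominus> z 0) = nrm A (z (Suc 0))"
      using zc by (simp add: z0)
    then show ?case
      using bnd [of "Suc 0"] t by simp
  next
    case (Suc k)
    define x y where "x = z (Suc k)" and "y = z k"
    have xy: "x \<in> carrier A" "y \<in> carrier A"
      by (simp_all add: x_def y_def zc)
    have "z (Suc (Suc k)) \<ominus> z (Suc k) = f x \<ominus> f y"
      by (simp only: zS x_def y_def)
    also have "\<dots> = cscale A (1/2) (x \<otimes> x \<ominus> y \<otimes> y)"
      using h xy by (simp add: f_def cscale_diff_right [symmetric] add_minus_add)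
    finally have "nrm A (z (Suc (Suc k)) \<ominus> z (Suc k)) = nrm A (x \<otimes> x \<ominus> y \<otimes> y) / 2"
      using xy by (simp add: p_cscale)
    also have "\<dots> \<le> (nrm A (x \<ominus> y) * nrm A x + nrm A y * nrm A (x \<ominus> y)) / 2"
      using p_mult_minus [of x x y y] xy by simp
    also have "\<dots> \<le> (nrm A (x \<ominus> y) * t + t * nrm A (x \<ominus> y)) / 2"
      using bnd xy unfolding x_def y_def
      by (intro divide_right_mono add_mono mult_left_mono mult_right_mono) auto
    also have "\<dots> \<le> t ^ Suc k"
      using Suc t by (simp add: x_def y_def mult_left_mono)
    finally show ?case .
  qed
  \<comment> \<open>Telescoping and summing the geometric series; the strict bound
    \<open>t < 1\<close> makes the sum finite.\<close>
  have tail: "nrm A (z (k + l) \<ominus> z k) \<le> t ^ k / (1 - t)" for k l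
  proof -
    have "nrm A (z (k + l) \<ominus> z k) \<le> (\<Sum>i<l. t ^ (k + i))"
    proof (induction l)
      case (Suc l)
      have "nrm A (z (k + Suc l) \<ominus> z k)
          \<le> nrm A (z (k + Suc l) \<ominus> z (k + l)) + nrm A (z (k + l) \<ominus> z k)"
        using zc by (intro p_minus_triangle)
      then show ?case
        using step [of "k + l"] Suc by simp
    qed (use zc in simp)
    also have "\<dots> = t ^ k * (\<Sum>i<l. t ^ i)"
      by (simp add: power_add sum_distrib_left)
    also have "\<dots> \<le> t ^ k * (1 / (1 - t))"
    proof (intro mult_left_mono)
      show "(\<Sum>i<l. t ^ i) \<le> 1 / (1 - t)"
        using t by (simp add: sum_gp_strict divide_right_mono)
    qed (use t in simp)
    finally show ?thesis
      by simp
  qed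
  have "seminorm_Cauchy A (nrm A) z"
    unfolding seminorm_Cauchy_def
  proof (intro conjI allI impI zc)
    fix e :: real
    assume e: "e > 0"
    have "(\<lambda>k. t ^ k / (1 - t)) \<longlonglongrightarrow> 0"
      using t by (intro tendsto_divide_zero LIMSEQ_power_zero) simp
    then obtain M where "\<forall>k\<ge>M. norm (t ^ k / (1 - t) - 0) < e"
      using LIMSEQ_D e by blast
    then have M: "t ^ k / (1 - t) < e" if "k \<ge> M" for k
      using that t by force
    have *: "nrm A (z l \<ominus> z k) < e" if "k \<ge> M" "k \<le> l" for k l
      using tail [of k "l - k"] M [OF that(1)] that by simp
    have "nrm A (z k \<ominus> z l) < e" if "k \<ge> M" "l \<ge> M" for k l
      using * [of k l] * [of l k] that p_minus_commute [OF zc zc, of k l] by (cases "k \<le> l") auto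
    then show "\<exists>M. \<forall>k\<ge>M. \<forall>l\<ge>M. nrm A (z k \<ominus> z l) < e"
      by blast
  qed
  note zC = this
  obtain w where w: "null_diff z (\<lambda>k. w)"
    using limit_exists [OF zC] by blast
  note wc = null_diff_closed(2) [OF w]
  have hh: "null_diff (\<lambda>k. h) (\<lambda>k. h)" "null_diff (\<lambda>k. h \<otimes> h) (\<lambda>k. h \<otimes> h)"
    using h by (simp_all add: null_diff_refl image_subset_iff)
  have hC: "seminorm_Cauchy A (nrm A) (\<lambda>k. h)"
    using h by (simp add: seminorm_Cauchy_const)
  have wstar: "star A w = w"
    using limit_unique [OF null_diff_star [OF w]] w by (simp add: zstar)
  have wh: "w \<otimes> h = h \<otimes> w"
    using limit_unique [OF null_diff_mult_Cauchy [OF w hh(1) zC hC]]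
      null_diff_mult_Cauchy [OF hh(1) w hC zC] by (simp add: zh)
  have "null_diff (\<lambda>k. f (z k)) (\<lambda>k. f w)"
    unfolding f_def
    by (intro null_diff_cscale null_diff_add hh null_diff_mult_Cauchy w zC)
  moreover have "null_diff (\<lambda>k. f (z k)) (\<lambda>k. w)"
    using w LIMSEQ_Suc [OF null_diff_limit [OF w]]
    unfolding null_diff_def zS [symmetric] by auto
  ultimately have fw: "f w = w"
    by (rule limit_unique)
  \<comment> \<open>The fixed point equation doubled, \<open>2 w = h^2 + w^2\<close>. It rearranges
    to \<open>(1 - w)^2 = 1 - h^2\<close>.\<close>
  have ww: "w \<oplus> w = h \<otimes> h \<oplus> w \<otimes> w"
  proof -
    have "cscale A 2 (f w) = h \<otimes> h \<oplus> w \<otimes> w"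
      using h wc by (simp add: f_def cscale_cscale)
    then show ?thesis
      using cscale_add_left [of w 1 1] wc by (simp add: fw)
  qed
  define b where "b = \<one> \<ominus> w"
  have b: "b \<in> carrier A" "star A b = b" "b \<otimes> h = h \<otimes> b"
    using wc h wh wstar
    by (simp_all add: b_def star_diff a_minus_def l_distr r_distr l_minus r_minus star_add star_a_inv)
  have bb: "h \<otimes> h \<oplus> b \<otimes> b = \<one>"
  proof -
    have "b \<otimes> b = \<one> \<ominus> (w \<oplus> w) \<oplus> w \<otimes> w"
      using wc by (simp add: b_def a_minus_def l_distr r_distr l_minus r_minus minus_add a_ac)
    also have "\<dots> = \<one> \<ominus> h \<otimes> h"
      unfolding ww using wc h by (simp add: a_minus_def minus_add a_ac r_neg r_neg1 r_neg2 add_cancel_right)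
    finally show ?thesis
      using h by (simp add: a_minus_def a_ac r_neg r_neg1 r_neg2 add_cancel_right)
  qed
  interpret q: cstar_seminormed A q
    by unfold_locales (rule q)
  define ib where "ib = cscale A \<i> b"
  define v where "v = h \<oplus> ib"
  have ib: "ib \<in> carrier A" "star A ib = \<ominus> ib"
    using b by (simp_all add: ib_def star_cscale cscale_minus_left)
  have v: "v \<in> carrier A" "star A v = h \<ominus> ib"
    using b h ib by (simp_all add: v_def star_add a_minus_def)
  have "h \<otimes> ib = ib \<otimes> h" "\<ominus> (ib \<otimes> ib) = b \<otimes> b"
    using b h
    by (simp_all add: ib_def cscale_mult_left cscale_mult_right cscale_cscale cscale_minus_left
        cscale_minus_one)
  then have "(h \<ominus> ib) \<otimes> (h \<oplus> ib) = h \<otimes> h \<oplus> b \<otimes> b"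
    using h(1) ib(1) b(1)
    by (simp add: a_minus_def l_distr r_distr l_minus r_minus a_ac r_neg r_neg1 r_neg2 add_cancel_right)
  then have "star A v \<otimes> v = \<one>"
    using bb by (simp only: v(2)) (simp only: v_def)
  \<comment> \<open>The C*-identity turns \<open>star A v \<otimes> v = \<one>\<close> into
    \<open>(q v)^2 = q \<one>\<close>, and \<open>q \<one>\<close> is at most 1 for every
    C*-seminorm.\<close>
  then have "(q v)\<^sup>2 \<le> 1\<^sup>2"
    using q.p_cstar [OF v(1)] q.p_one_le by simp
  then have qv: "q v \<le> 1"
    by (rule power2_le_imp_le) simp
  have "v \<oplus> star A v = h \<oplus> h"
    using h(1) ib(1) by (simp only: v(2), simp add: v_def a_minus_def a_ac r_neg r_neg1 r_neg2 add_cancel_right)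
  also have "\<dots> = cscale A 2 h"
    using cscale_add_left [of h 1 1] h by simp
  finally have "2 * q h = q (v \<oplus> star A v)"
    using h q.p_cscale [of h 2] by simp
  also have "\<dots> \<le> 2"
    using q.p_triangle [of v "star A v"] q.p_star [of v] v(1) qv by simp
  finally show ?thesis
    by simp
qed

text \<open>Automatic continuity, without spectral theory: a selfadjoint contraction \<open>h\<close> is the real part
  of the unitary \<open>h + i \<surd>(1 - h\<^sup>2)\<close>, on which a C*-seminorm is at most \<open>1\<close>.\<close>

theorem cstar_seminorm_le_nrm:
  assumes q: "cstar_seminorm A q" and x: "x \<in> carrier A"
  shows "q x \<le> nrm A x"
proof -
  interpret q: cstar_seminormed A q
    by unfold_locales (rule q)
  \<comment> \<open>Dividing by any \<open>c\<close> above \<open>nrm A h\<close> gives a strict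
    contraction, as the lemma requires; letting \<open>c\<close> decrease to \<open>nrm A h\<close>
    gives the sharp bound.\<close>
  have sa: "q h \<le> nrm A h" if h: "h \<in> carrier A" "star A h = h" for h
  proof (rule dense_ge)
    fix c
    assume c: "nrm A h < c"
    then have c0: "c > 0"
      using p_nonneg [OF h(1)] by linarith
    define g where "g = cscale A (complex_of_real (1 / c)) h"
    have g: "g \<in> carrier A" "star A g = g"
      using h by (simp_all add: g_def star_cscale)
    have cm: "cmod (complex_of_real (1 / c)) = 1 / c"
      using c0 by (simp only: norm_of_real) simp
    have "nrm A g = 1 / c * nrm A h"
      unfolding g_def p_cscale [OF h(1)] cm ..
    then have "nrm A g < 1"
      using c c0 by simp
    then have "q g \<le> 1"
      by (rule self_adjoint_contraction_seminorm_le [OF q g])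
    moreover have "q g = 1 / c * q h"
      unfolding g_def q.p_cscale [OF h(1)] cm ..
    ultimately show "q h \<le> c"
      using c0 by (simp add: field_simps)
  qed
  \<comment> \<open>The C*-identity on both sides carries the bound from the selfadjoint element
    \<open>star A x \<otimes> x\<close> to \<open>x\<close>.\<close>
  have "(q x)\<^sup>2 = q (star A x \<otimes> x)"
    by (rule q.p_cstar [OF x, symmetric])
  also have "\<dots> \<le> nrm A (star A x \<otimes> x)"
    using x by (intro sa) (simp_all add: star_mult)
  also have "\<dots> = (nrm A x)\<^sup>2"
    by (rule p_cstar [OF x])
  finally show ?thesis
    by (rule power2_le_imp_le) (simp add: x)
qed

end

section \<open>Morphisms and Hausdorff completion\<close>

lemma cstar_homD:
  assumes "f \<in> cstar_hom A B"
  shows cstar_hom_closed: "x \<in> carrier A \<Longrightarrow> f x \<in> carrier B"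
    and cstar_hom_mult: "\<lbrakk>x \<in> carrier A; y \<in> carrier A\<rbrakk> \<Longrightarrow> f (x \<otimes>\<^bsub>A\<^esub> y) = f x \<otimes>\<^bsub>B\<^esub> f y"
    and cstar_hom_add: "\<lbrakk>x \<in> carrier A; y \<in> carrier A\<rbrakk> \<Longrightarrow> f (x \<oplus>\<^bsub>A\<^esub> y) = f x \<oplus>\<^bsub>B\<^esub> f y"
    and cstar_hom_one: "f \<one>\<^bsub>A\<^esub> = \<one>\<^bsub>B\<^esub>"
    and cstar_hom_cscale: "x \<in> carrier A \<Longrightarrow> f (cscale A c x) = cscale B c (f x)"
    and cstar_hom_star: "x \<in> carrier A \<Longrightarrow> f (star A x) = star B (f x)"
  using assms by (auto simp: cstar_hom_def ring_hom_def)

lemma cstar_homI: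
  assumes "\<And>x. x \<in> carrier A \<Longrightarrow> f x \<in> carrier B"
    and "\<And>x y. \<lbrakk>x \<in> carrier A; y \<in> carrier A\<rbrakk> \<Longrightarrow> f (x \<otimes>\<^bsub>A\<^esub> y) = f x \<otimes>\<^bsub>B\<^esub> f y"
    and "\<And>x y. \<lbrakk>x \<in> carrier A; y \<in> carrier A\<rbrakk> \<Longrightarrow> f (x \<oplus>\<^bsub>A\<^esub> y) = f x \<oplus>\<^bsub>B\<^esub> f y"
    and "f \<one>\<^bsub>A\<^esub> = \<one>\<^bsub>B\<^esub>"
    and "\<And>x c. x \<in> carrier A \<Longrightarrow> f (cscale A c x) = cscale B c (f x)"
    and "\<And>x. x \<in> carrier A \<Longrightarrow> f (star A x) = star B (f x)"
  shows "f \<in> cstar_hom A B"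
  using assms by (auto simp: cstar_hom_def ring_hom_def)

lemma cstar_hom_comp:
  assumes "f \<in> cstar_hom A B" "g \<in> cstar_hom B C"
  shows "g \<circ> f \<in> cstar_hom A C"
  using assms by (intro cstar_homI) (simp_all add: cstar_homD [OF assms(1)] cstar_homD [OF assms(2)])

locale star_algebra_hom = A: star_algebra A + B: star_algebra B
  for A :: "('a, 'm) star_alg_scheme" and B :: "('b, 'l) star_alg_scheme" +
  fixes f :: "'a \<Rightarrow> 'b"
  assumes hom: "f \<in> cstar_hom A B"
begin

lemmas hom_simps = cstar_homD [OF hom]

lemma hom_zero: "f \<zero>\<^bsub>A\<^esub> = \<zero>\<^bsub>B\<^esub>"
  using hom_simps(5) [of "\<zero>\<^bsub>A\<^esub>" 0] hom_simps(1) [of "\<zero>\<^bsub>A\<^esub>"] by simp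

lemma hom_minus:
  assumes "x \<in> carrier A" "y \<in> carrier A"
  shows "f (x \<ominus>\<^bsub>A\<^esub> y) = f x \<ominus>\<^bsub>B\<^esub> f y"
  using assms hom_simps(1)
  by (simp add: a_minus_def hom_simps(3,5) flip: A.cscale_minus_one B.cscale_minus_one)

lemma hom_finsum:
  assumes "finite I" "g \<in> I \<rightarrow> carrier A"
  shows "f (finsum A g I) = (\<Oplus>\<^bsub>B\<^esub>i\<in>I. f (g i))"
  using assms
proof (induction I)
  case (insert i I)
  then have "g \<in> I \<rightarrow> carrier A" "g i \<in> carrier A" "(\<lambda>i. f (g i)) \<in> I \<rightarrow> carrier B" "f (g i) \<in> carrier B"
    using hom_simps(1) by auto
  then show ?case
    using insert by (simp add: hom_simps(3))
qed (simp add: hom_zero)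

text \<open>The point where morphisms meet norms. The pulled back norm lies below the norm of a
  C*-algebra \<open>A\<close> by automatic continuity, and below the maximal seminorm of a
  presentation when \<open>f\<close> kills the relators.\<close>

lemma seminorm_pullback:
  assumes "cstar_seminorm B q"
  shows "cstar_seminorm A (\<lambda>x. q (f x))"
  using assms hom_simps(1)
  by (simp add: cstar_seminorm_def hom_simps flip: hom_simps(6) hom_simps(2))
     (simp add: hom_simps)

end

section \<open>The Hausdorff completion is a C*-algebra and extends contractive morphisms\<close>

context cstar_seminormed
begin

lemma cauchy_class_self: "seminorm_Cauchy A p s \<Longrightarrow> s \<in> cauchy_class A p s"
  by (simp add: cauchy_class_def seminorm_Cauchy_closed)

lemma in_cauchy_class_iff:
  assumes "seminorm_Cauchy A p s"
  shows "t \<in> cauchy_class A p s \<longleftrightarrow> null_diff s t"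
proof
  assume "null_diff s t"
  then show "t \<in> cauchy_class A p s"
    using null_diff_Cauchy [OF _ assms] null_diff_limit by (simp add: cauchy_class_def)
qed (use seminorm_Cauchy_closed assms in \<open>auto simp: cauchy_class_def null_diff_def\<close>)

lemma cauchy_class_eq_iff:
  assumes "seminorm_Cauchy A p s" "seminorm_Cauchy A p t"
  shows "cauchy_class A p s = cauchy_class A p t \<longleftrightarrow> null_diff s t"
proof
  assume "cauchy_class A p s = cauchy_class A p t"
  then show "null_diff s t"
    using cauchy_class_self [OF assms(2)] in_cauchy_class_iff [OF assms(1)] by blast
next
  assume "null_diff s t"
  then show "cauchy_class A p s = cauchy_class A p t"
    using in_cauchy_class_iff assms null_diff_trans null_diff_sym by blast
qed

text \<open>The operations of the completion are computed on chosen representatives; that these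
  differ from the given ones by a null sequence makes the choice immaterial.\<close>

lemma cauchy_rep_class:
  assumes "seminorm_Cauchy A p s"
  shows "null_diff s (cauchy_rep (cauchy_class A p s))"
    and "seminorm_Cauchy A p (cauchy_rep (cauchy_class A p s))"
proof -
  have "cauchy_rep (cauchy_class A p s) \<in> cauchy_class A p s"
    unfolding cauchy_rep_def using cauchy_class_self [OF assms]
    by (rule someI [where P = "\<lambda>t. t \<in> cauchy_class A p s"])
  then show "null_diff s (cauchy_rep (cauchy_class A p s))"
    using in_cauchy_class_iff [OF assms] by blast
  then show "seminorm_Cauchy A p (cauchy_rep (cauchy_class A p s))"
    using null_diff_Cauchy assms by blast
qed

abbreviation "cls \<equiv> cauchy_class A p"
abbreviation "Cpl \<equiv> completion A p"

lemma completion_carrierE: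
  assumes "S \<in> carrier Cpl"
  obtains s where "seminorm_Cauchy A p s" "S = cls s"
  using assms by (auto simp: completion_def)

lemma cls_closed: "seminorm_Cauchy A p s \<Longrightarrow> cls s \<in> carrier Cpl"
  by (simp add: completion_def)

lemma completion_zero: "\<zero>\<^bsub>Cpl\<^esub> = cls (\<lambda>k. \<zero>)"
  and completion_one: "\<one>\<^bsub>Cpl\<^esub> = cls (\<lambda>k. \<one>)"
  by (simp_all add: completion_def)

lemma completion_add:
  assumes "seminorm_Cauchy A p s" "seminorm_Cauchy A p t"
  shows "cls s \<oplus>\<^bsub>Cpl\<^esub> cls t = cls (\<lambda>k. s k \<oplus> t k)"
proof -
  note r = cauchy_rep_class [OF assms(1)] cauchy_rep_class [OF assms(2)]
  have "cls (\<lambda>k. cauchy_rep (cls s) k \<oplus> cauchy_rep (cls t) k) = cls (\<lambda>k. s k \<oplus> t k)"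
    using r assms
    by (subst cauchy_class_eq_iff) (auto intro: seminorm_Cauchy_add null_diff_add null_diff_sym)
  then show ?thesis
    by (simp add: completion_def)
qed

lemma completion_mult:
  assumes "seminorm_Cauchy A p s" "seminorm_Cauchy A p t"
  shows "cls s \<otimes>\<^bsub>Cpl\<^esub> cls t = cls (\<lambda>k. s k \<otimes> t k)"
proof -
  note r = cauchy_rep_class [OF assms(1)] cauchy_rep_class [OF assms(2)]
  have "cls (\<lambda>k. cauchy_rep (cls s) k \<otimes> cauchy_rep (cls t) k) = cls (\<lambda>k. s k \<otimes> t k)"
    using r assms
    by (subst cauchy_class_eq_iff)
       (auto intro: seminorm_Cauchy_mult null_diff_mult_Cauchy null_diff_sym)
  then show ?thesis
    by (simp add: completion_def)
qed

lemma completion_cscale: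
  assumes "seminorm_Cauchy A p s"
  shows "cscale Cpl c (cls s) = cls (\<lambda>k. cscale A c (s k))"
proof -
  note r = cauchy_rep_class [OF assms]
  have "cls (\<lambda>k. cscale A c (cauchy_rep (cls s) k)) = cls (\<lambda>k. cscale A c (s k))"
    using r assms
    by (subst cauchy_class_eq_iff) (auto intro: seminorm_Cauchy_cscale null_diff_cscale null_diff_sym)
  then show ?thesis
    by (simp add: completion_def)
qed

lemma completion_star:
  assumes "seminorm_Cauchy A p s"
  shows "star Cpl (cls s) = cls (\<lambda>k. star A (s k))"
proof -
  note r = cauchy_rep_class [OF assms]
  have "cls (\<lambda>k. star A (cauchy_rep (cls s) k)) = cls (\<lambda>k. star A (s k))"
    using r assms
    by (subst cauchy_class_eq_iff) (auto intro: seminorm_Cauchy_star null_diff_star null_diff_sym)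
  then show ?thesis
    by (simp add: completion_def)
qed

lemma seminorm_Cauchy_tendsto:
  assumes "seminorm_Cauchy A p s"
  shows "(\<lambda>k. p (s k)) \<longlonglongrightarrow> lim (\<lambda>k. p (s k))"
  using seminorm_Cauchy_p [OF assms] convergent_LIMSEQ_iff Cauchy_convergent by blast

text \<open>\<open>nrm\<close> is a \<open>lim\<close> along the chosen representative. Since
  \<open>p s - p t\<close> is dominated by \<open>p\<close> of the difference, every representative
  has the same limit.\<close>

lemma completion_nrm:
  assumes "seminorm_Cauchy A p s"
  shows "(\<lambda>k. p (s k)) \<longlonglongrightarrow> nrm Cpl (cls s)"
proof -
  define t where "t = cauchy_rep (cls s)"
  have t: "null_diff s t" "seminorm_Cauchy A p t"
    using cauchy_rep_class [OF assms] by (auto simp: t_def)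
  have "(\<lambda>k. p (s k) - p (t k)) \<longlonglongrightarrow> 0"
  proof (rule Lim_null_comparison)
    show "\<forall>\<^sub>F k in sequentially. norm (p (s k) - p (t k)) \<le> p (s k \<ominus> t k)"
      using p_abs_diff null_diff_closed [OF t(1)] by simp
  qed (rule null_diff_limit [OF t(1)])
  from tendsto_add [OF this seminorm_Cauchy_tendsto [OF t(2)]]
  show ?thesis
    by (simp add: completion_def t_def)
qed

lemmas completion_simps = completion_add completion_mult completion_cscale completion_star
  completion_zero completion_one

lemmas seminorm_Cauchy_intros = seminorm_Cauchy_add seminorm_Cauchy_mult seminorm_Cauchy_cscale
  seminorm_Cauchy_star seminorm_Cauchy_const

lemma seminorm_Cauchy_a_inv:
  "seminorm_Cauchy A p s \<Longrightarrow> seminorm_Cauchy A p (\<lambda>k. \<ominus> s k)"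
  using seminorm_Cauchy_cscale [of s "- 1"] by (simp add: cscale_minus_one seminorm_Cauchy_closed)

lemma completion_star_algebra: "star_algebra Cpl"
proof -
  note [simp] = completion_simps seminorm_Cauchy_intros seminorm_Cauchy_closed cls_closed
  have ag: "abelian_group Cpl"
  proof (rule abelian_groupI)
    fix S T U
    assume "S \<in> carrier Cpl" "T \<in> carrier Cpl" "U \<in> carrier Cpl"
    then obtain s t u where [simp]: "seminorm_Cauchy A p s" "S = cls s" "seminorm_Cauchy A p t" "T = cls t"
      "seminorm_Cauchy A p u" "U = cls u"
      by (metis completion_carrierE)
    show "S \<oplus>\<^bsub>Cpl\<^esub> T \<oplus>\<^bsub>Cpl\<^esub> U = S \<oplus>\<^bsub>Cpl\<^esub> (T \<oplus>\<^bsub>Cpl\<^esub> U)"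
      by (simp add: a_assoc)
  next
    fix S T
    assume "S \<in> carrier Cpl" "T \<in> carrier Cpl"
    then obtain s t where [simp]: "seminorm_Cauchy A p s" "S = cls s" "seminorm_Cauchy A p t" "T = cls t"
      by (metis completion_carrierE)
    show "S \<oplus>\<^bsub>Cpl\<^esub> T \<in> carrier Cpl"
      by simp
    have "(\<lambda>k. s k \<oplus> t k) = (\<lambda>k. t k \<oplus> s k)"
      by (simp add: a_comm)
    then show "S \<oplus>\<^bsub>Cpl\<^esub> T = T \<oplus>\<^bsub>Cpl\<^esub> S"
      by simp
  next
    fix S
    assume "S \<in> carrier Cpl"
    then obtain s where [simp]: "seminorm_Cauchy A p s" "S = cls s"
      by (metis completion_carrierE)
    show "\<zero>\<^bsub>Cpl\<^esub> \<oplus>\<^bsub>Cpl\<^esub> S = S"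
      by simp
    have "cls (\<lambda>k. cscale A (- 1) (s k)) \<oplus>\<^bsub>Cpl\<^esub> S = \<zero>\<^bsub>Cpl\<^esub>"
      by (simp add: cscale_minus_one l_neg seminorm_Cauchy_a_inv)
    then show "\<exists>T\<in>carrier Cpl. T \<oplus>\<^bsub>Cpl\<^esub> S = \<zero>\<^bsub>Cpl\<^esub>"
      by (metis \<open>seminorm_Cauchy A p s\<close> cls_closed seminorm_Cauchy_cscale)
  qed simp
  have mon: "monoid Cpl"
  proof (rule monoidI)
    fix S T U
    assume "S \<in> carrier Cpl" "T \<in> carrier Cpl" "U \<in> carrier Cpl"
    then obtain s t u where [simp]: "seminorm_Cauchy A p s" "S = cls s" "seminorm_Cauchy A p t" "T = cls t"
      "seminorm_Cauchy A p u" "U = cls u"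
      by (metis completion_carrierE)
    show "S \<otimes>\<^bsub>Cpl\<^esub> T \<otimes>\<^bsub>Cpl\<^esub> U = S \<otimes>\<^bsub>Cpl\<^esub> (T \<otimes>\<^bsub>Cpl\<^esub> U)"
      by (simp add: m_assoc)
  qed (auto elim!: completion_carrierE)
  have rg: "ring Cpl"
  proof (rule ringI [OF ag mon])
    fix S T U
    assume "S \<in> carrier Cpl" "T \<in> carrier Cpl" "U \<in> carrier Cpl"
    then obtain s t u where [simp]: "seminorm_Cauchy A p s" "S = cls s" "seminorm_Cauchy A p t" "T = cls t"
      "seminorm_Cauchy A p u" "U = cls u"
      by (metis completion_carrierE)
    show "(S \<oplus>\<^bsub>Cpl\<^esub> T) \<otimes>\<^bsub>Cpl\<^esub> U = S \<otimes>\<^bsub>Cpl\<^esub> U \<oplus>\<^bsub>Cpl\<^esub> T \<otimes>\<^bsub>Cpl\<^esub> U"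
      and "U \<otimes>\<^bsub>Cpl\<^esub> (S \<oplus>\<^bsub>Cpl\<^esub> T) = U \<otimes>\<^bsub>Cpl\<^esub> S \<oplus>\<^bsub>Cpl\<^esub> U \<otimes>\<^bsub>Cpl\<^esub> T"
      by (simp_all add: l_distr r_distr)
  qed
  have "star_algebra_axioms Cpl"
  proof
    fix S T c d
    assume "S \<in> carrier Cpl" "T \<in> carrier Cpl"
    then obtain s t where [simp]: "seminorm_Cauchy A p s" "S = cls s" "seminorm_Cauchy A p t" "T = cls t"
      by (metis completion_carrierE)
    show "cscale Cpl c (S \<oplus>\<^bsub>Cpl\<^esub> T) = cscale Cpl c S \<oplus>\<^bsub>Cpl\<^esub> cscale Cpl c T"
      and "cscale Cpl c S \<otimes>\<^bsub>Cpl\<^esub> T = cscale Cpl c (S \<otimes>\<^bsub>Cpl\<^esub> T)"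
      and "S \<otimes>\<^bsub>Cpl\<^esub> cscale Cpl c T = cscale Cpl c (S \<otimes>\<^bsub>Cpl\<^esub> T)"
      and "star Cpl (S \<oplus>\<^bsub>Cpl\<^esub> T) = star Cpl S \<oplus>\<^bsub>Cpl\<^esub> star Cpl T"
      and "star Cpl (S \<otimes>\<^bsub>Cpl\<^esub> T) = star Cpl T \<otimes>\<^bsub>Cpl\<^esub> star Cpl S"
      by (simp_all add: cscale_add_right cscale_mult_left cscale_mult_right star_add star_mult)
  qed (auto elim!: completion_carrierE simp: cscale_add_left cscale_cscale star_cscale)
  then show ?thesis
    using rg by (simp add: star_algebra_def)
qed

lemma completion_minus:
  assumes "seminorm_Cauchy A p s" "seminorm_Cauchy A p t"
  shows "cls s \<ominus>\<^bsub>Cpl\<^esub> cls t = cls (\<lambda>k. s k \<ominus> t k)"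
proof -
  interpret C: star_algebra Cpl
    by (rule completion_star_algebra)
  have "\<ominus>\<^bsub>Cpl\<^esub> cls t = cscale Cpl (- 1) (cls t)"
    by (simp add: C.cscale_minus_one cls_closed assms)
  then show ?thesis
    using assms
    by (simp add: a_minus_def completion_simps seminorm_Cauchy_intros
        seminorm_Cauchy_a_inv cscale_minus_one seminorm_Cauchy_closed)
qed

lemma seminorm_Cauchy_minus:
  "\<lbrakk>seminorm_Cauchy A p s; seminorm_Cauchy A p t\<rbrakk> \<Longrightarrow> seminorm_Cauchy A p (\<lambda>k. s k \<ominus> t k)"
  using seminorm_Cauchy_add [OF _ seminorm_Cauchy_cscale, of s t "- 1"]
  by (simp add: a_minus_def cscale_minus_one seminorm_Cauchy_closed)

lemma nrm_cls_const: "x \<in> carrier A \<Longrightarrow> nrm Cpl (cls (\<lambda>k. x)) = p x"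
  using completion_nrm [OF seminorm_Cauchy_const, of x] by (simp add: LIMSEQ_const_iff)

lemma completion_cstar_seminorm: "cstar_seminorm Cpl (nrm Cpl)"
  unfolding cstar_seminorm_def
proof (intro conjI ballI allI)
  note [simp] = completion_simps seminorm_Cauchy_intros seminorm_Cauchy_closed cls_closed
  fix S
  assume "S \<in> carrier Cpl"
  then obtain s where [simp]: "seminorm_Cauchy A p s" "S = cls s"
    by (metis completion_carrierE)
  show "0 \<le> nrm Cpl S"
    using LIMSEQ_le_const [OF completion_nrm [of s]] by simp
  show "nrm Cpl (cscale Cpl c S) = cmod c * nrm Cpl S" for c
    using LIMSEQ_unique [OF completion_nrm [of "\<lambda>k. cscale A c (s k)"]]
      tendsto_mult_left [OF completion_nrm [of s], of "cmod c"] by (simp add: p_cscale)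
  show "nrm Cpl (star Cpl S \<otimes>\<^bsub>Cpl\<^esub> S) = (nrm Cpl S)\<^sup>2"
    using LIMSEQ_unique [OF completion_nrm [of "\<lambda>k. star A (s k) \<otimes> s k"]]
      tendsto_power [OF completion_nrm [of s], of 2] by (simp add: p_cstar)
  fix T
  assume "T \<in> carrier Cpl"
  then obtain t where [simp]: "seminorm_Cauchy A p t" "T = cls t"
    by (metis completion_carrierE)
  show "nrm Cpl (S \<oplus>\<^bsub>Cpl\<^esub> T) \<le> nrm Cpl S + nrm Cpl T"
    using LIMSEQ_le [OF completion_nrm [of "\<lambda>k. s k \<oplus> t k"]
        tendsto_add [OF completion_nrm [of s] completion_nrm [of t]]] p_triangle by simp
  show "nrm Cpl (S \<otimes>\<^bsub>Cpl\<^esub> T) \<le> nrm Cpl S * nrm Cpl T"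
    using LIMSEQ_le [OF completion_nrm [of "\<lambda>k. s k \<otimes> t k"]
        tendsto_mult [OF completion_nrm [of s] completion_nrm [of t]]] p_mult by simp
qed

text \<open>A Cauchy sequence converges to its own class when its terms are read as constant
  sequences. Density of \<open>A\<close> and completeness both rest on this.\<close>

lemma completion_approx:
  assumes s: "seminorm_Cauchy A p s" and e: "e > 0"
  shows "\<exists>M. \<forall>m\<ge>M. nrm Cpl (cls s \<ominus>\<^bsub>Cpl\<^esub> cls (\<lambda>k. s m)) < e"
proof -
  note c = seminorm_Cauchy_closed [OF s]
  obtain M where M: "\<And>k l. \<lbrakk>k \<ge> M; l \<ge> M\<rbrakk> \<Longrightarrow> p (s k \<ominus> s l) < e / 2"
    using seminorm_CauchyD [OF s, of "e / 2"] e by auto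
  have "nrm Cpl (cls s \<ominus>\<^bsub>Cpl\<^esub> cls (\<lambda>k. s m)) < e" if m: "m \<ge> M" for m
  proof -
    have sm: "seminorm_Cauchy A p (\<lambda>k. s m)"
      using c by (rule seminorm_Cauchy_const)
    \<comment> \<open>Passing to the limit keeps only the weak inequality, hence the margin
      \<open>e / 2\<close>.\<close>
    have "nrm Cpl (cls s \<ominus>\<^bsub>Cpl\<^esub> cls (\<lambda>k. s m)) \<le> e / 2"
      unfolding completion_minus [OF s sm]
    proof (rule LIMSEQ_le_const2 [OF completion_nrm [OF seminorm_Cauchy_minus [OF s sm]]])
      show "\<exists>N. \<forall>k\<ge>N. p (s k \<ominus> s m) \<le> e / 2"
        using M m by (meson less_imp_le)
    qed
    then show ?thesis
      using e by simp
  qed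
  then show ?thesis
    by blast
qed

lemma completion_cstar_algebra: "cstar_algebra Cpl"
proof -
  interpret C: cstar_seminormed Cpl "nrm Cpl"
    by (simp add: cstar_seminormed_def cstar_seminormed_axioms_def completion_star_algebra
        completion_cstar_seminorm)
  show ?thesis
  proof
    show "cstar_seminorm Cpl (nrm Cpl)"
      by (rule completion_cstar_seminorm)
  next
    fix S
    assume S: "S \<in> carrier Cpl" "nrm Cpl S = 0"
    then obtain s where s: "seminorm_Cauchy A p s" "S = cls s"
      by (metis completion_carrierE)
    have "null_diff s (\<lambda>k. \<zero>)"
      using completion_nrm [OF s(1)] S s seminorm_Cauchy_closed [OF s(1)]
      by (auto simp: null_diff_def)
    then show "S = \<zero>\<^bsub>Cpl\<^esub>"
      using s by (simp add: cauchy_class_eq_iff seminorm_Cauchy_const completion_zero)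
  next
    fix F
    assume F: "seminorm_Cauchy Cpl (nrm Cpl) F"
    \<comment> \<open>Diagonal argument: \<open>F m\<close> is replaced by an element
      \<open>x m\<close> of \<open>A\<close> at distance below \<open>1 / (m + 1)\<close>. The
      sequence \<open>x\<close> is then Cauchy in \<open>A\<close>, and its class is the limit of
      \<open>F\<close>.\<close>
    have "\<exists>x\<in>carrier A. nrm Cpl (F m \<ominus>\<^bsub>Cpl\<^esub> cls (\<lambda>k. x)) < inverse (real (Suc m))" for m
    proof -
      obtain s where s: "seminorm_Cauchy A p s" "F m = cls s"
        using C.seminorm_Cauchy_closed [OF F] completion_carrierE by metis
      then show ?thesis
        using completion_approx [OF s(1), of "inverse (real (Suc m))"] seminorm_Cauchy_closed [OF s(1)]
        by auto
    qed
    then obtain x where x: "\<And>m. x m \<in> carrier A"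
      "\<And>m. nrm Cpl (F m \<ominus>\<^bsub>Cpl\<^esub> cls (\<lambda>k. x m)) < inverse (real (Suc m))"
      by metis
    have xc: "cls (\<lambda>k. x m) \<in> carrier Cpl" for m
      using x by (simp add: cls_closed seminorm_Cauchy_const)
    have Fx: "C.null_diff F (\<lambda>m. cls (\<lambda>k. x m))"
    proof (rule C.null_diff_squeeze)
      show "nrm Cpl (F m \<ominus>\<^bsub>Cpl\<^esub> cls (\<lambda>k. x m)) \<le> inverse (real (Suc m))" for m
        using x less_imp_le by blast
    qed (use C.seminorm_Cauchy_closed [OF F] xc LIMSEQ_inverse_real_of_nat in auto)
    have "seminorm_Cauchy Cpl (nrm Cpl) (\<lambda>m. cls (\<lambda>k. x m))"
      using C.null_diff_Cauchy [OF Fx F] .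
    moreover have "nrm Cpl (cls (\<lambda>k. x m) \<ominus>\<^bsub>Cpl\<^esub> cls (\<lambda>k. x l)) = p (x m \<ominus> x l)" for m l
      using x by (simp add: completion_minus seminorm_Cauchy_const nrm_cls_const)
    ultimately have xC: "seminorm_Cauchy A p x"
      using x by (simp add: seminorm_Cauchy_def)
    have "C.null_diff (\<lambda>m. cls (\<lambda>k. x m)) (\<lambda>m. cls x)"
      unfolding C.null_diff_def
    proof (intro conjI LIMSEQ_I)
      fix e :: real
      assume "e > 0"
      then show "\<exists>M. \<forall>m\<ge>M. norm (nrm Cpl (cls (\<lambda>k. x m) \<ominus>\<^bsub>Cpl\<^esub> cls x) - 0) < e"
        using completion_approx [OF xC] C.p_minus_commute [OF cls_closed [OF xC] xc]
        by (simp add: xc cls_closed [OF xC])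
    qed (use xc cls_closed [OF xC] in auto)
    then have "C.null_diff F (\<lambda>m. cls x)"
      using Fx C.null_diff_trans by blast
    then show "\<exists>S\<in>carrier Cpl. (\<lambda>k. nrm Cpl (F k \<ominus>\<^bsub>Cpl\<^esub> S)) \<longlonglongrightarrow> 0"
      using C.null_diff_limit cls_closed [OF xC] by blast
  qed
qed

lemma cls_const_hom: "(\<lambda>x. cls (\<lambda>k. x)) \<in> cstar_hom A Cpl"
  by (rule cstar_homI) (simp_all add: completion_simps seminorm_Cauchy_intros cls_closed)

lemma completion_dense:
  assumes "S \<in> carrier Cpl" "e > 0"
  shows "\<exists>x\<in>carrier A. nrm Cpl (S \<ominus>\<^bsub>Cpl\<^esub> cls (\<lambda>k. x)) < e"
  using assms completion_approx seminorm_Cauchy_closed completion_carrierE by (metis order_refl)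

text \<open>By \<open>le\<close> the map is contractive, so it sends Cauchy sequences to Cauchy
  sequences, which converge in the complete algebra \<open>B\<close>. Each law for the extension
  holds because both sides are limits of one sequence.\<close>

lemma completion_extend_hom:
  assumes B: "cstar_algebra B" and f: "f \<in> cstar_hom A B"
    and le: "\<And>x. x \<in> carrier A \<Longrightarrow> nrm B (f x) \<le> p x"
  shows "\<exists>F\<in>cstar_hom Cpl B. \<forall>x\<in>carrier A. F (cls (\<lambda>k. x)) = f x"
proof -
  interpret B: cstar_algebra B
    by (rule B)
  interpret f: star_algebra_hom A B f
    by unfold_locales (rule f)
  note f.hom_simps [simp]
  have lem: "nrm B (f x \<ominus>\<^bsub>B\<^esub> f y) \<le> p (x \<ominus> y)" if "x \<in> carrier A" "y \<in> carrier A" for x y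
    using le [of "x \<ominus> y"] that by (simp add: f.hom_minus)
  have fC: "seminorm_Cauchy B (nrm B) (\<lambda>k. f (s k))" if s: "seminorm_Cauchy A p s" for s
    using s seminorm_Cauchy_closed [OF s] lem unfolding seminorm_Cauchy_def
    by (auto; meson order.strict_trans1)
  have fN: "B.null_diff (\<lambda>k. f (s k)) (\<lambda>k. f (t k))" if "null_diff s t" for s t
    using null_diff_closed [OF that] lem null_diff_limit [OF that]
    by (intro B.null_diff_squeeze) auto
  \<comment> \<open>The limit along the chosen representative; by \<open>fN\<close> the same limit
    is reached along every representative.\<close>
  define F where "F S = (SOME y. B.null_diff (\<lambda>k. f (cauchy_rep S k)) (\<lambda>k. y))" for S
  have F: "B.null_diff (\<lambda>k. f (s k)) (\<lambda>k. F (cls s))" if s: "seminorm_Cauchy A p s" for s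
  proof -
    note r = cauchy_rep_class [OF s]
    obtain y where "B.null_diff (\<lambda>k. f (cauchy_rep (cls s) k)) (\<lambda>k. y)"
      using B.limit_exists [OF fC [OF r(2)]] by blast
    then have "B.null_diff (\<lambda>k. f (cauchy_rep (cls s) k)) (\<lambda>k. F (cls s))"
      unfolding F_def
      by (rule someI [where P = "\<lambda>y. B.null_diff (\<lambda>k. f (cauchy_rep (cls s) k)) (\<lambda>k. y)"])
    then show ?thesis
      using fN [OF r(1)] B.null_diff_trans by blast
  qed
  have Fc: "F (cls s) \<in> carrier B" if "seminorm_Cauchy A p s" for s
    using B.null_diff_closed(2) [OF F [OF that]] .
  have Fconst: "F (cls (\<lambda>k. x)) = f x" if "x \<in> carrier A" for x
  proof (rule B.limit_unique [OF F])
    show "B.null_diff (\<lambda>k. f x) (\<lambda>k. f x)"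
      using that by (simp add: B.null_diff_refl image_subset_iff)
  qed (simp add: that seminorm_Cauchy_const)
  have "F \<in> cstar_hom Cpl B"
  proof (rule cstar_homI)
    show "F \<one>\<^bsub>Cpl\<^esub> = \<one>\<^bsub>B\<^esub>"
      by (simp add: completion_one Fconst)
  next
    fix S c
    assume "S \<in> carrier Cpl"
    then obtain s where s: "seminorm_Cauchy A p s" "S = cls s"
      by (metis completion_carrierE)
    note c = seminorm_Cauchy_closed [OF s(1)]
    show "F S \<in> carrier B"
      using Fc s by simp
    show "F (cscale Cpl c S) = cscale B c (F S)"
      using B.limit_unique [OF F [OF seminorm_Cauchy_cscale [OF s(1)]], of c] B.null_diff_cscale [OF F [OF s(1)], of c]
      by (simp add: s completion_cscale c)
    show "F (star Cpl S) = star B (F S)"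
      using B.limit_unique [OF F [OF seminorm_Cauchy_star [OF s(1)]]] B.null_diff_star [OF F [OF s(1)]]
      by (simp add: s completion_star c)
    fix T
    assume "T \<in> carrier Cpl"
    then obtain t where t: "seminorm_Cauchy A p t" "T = cls t"
      by (metis completion_carrierE)
    note d = seminorm_Cauchy_closed [OF t(1)]
    show "F (S \<oplus>\<^bsub>Cpl\<^esub> T) = F S \<oplus>\<^bsub>B\<^esub> F T"
      using B.limit_unique [OF F [OF seminorm_Cauchy_add [OF s(1) t(1)]]]
        B.null_diff_add [OF F [OF s(1)] F [OF t(1)]]
      by (simp add: s t completion_add c d)
    show "F (S \<otimes>\<^bsub>Cpl\<^esub> T) = F S \<otimes>\<^bsub>B\<^esub> F T"
      using B.limit_unique [OF F [OF seminorm_Cauchy_mult [OF s(1) t(1)]]]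
        B.null_diff_mult_Cauchy [OF F [OF s(1)] F [OF t(1)] fC [OF s(1)] fC [OF t(1)]]
      by (simp add: s(2) t(2) completion_mult s(1) t(1) c d)
  qed
  then show ?thesis
    using Fconst by blast
qed

end

section \<open>Enveloping C*-algebras and monoid algebras\<close>

text \<open>The hypothesis \<open>bounded\<close> gives the supremum its meaning, since a real
  \<open>SUP\<close> over an unbounded set carries no information. It is established once for tensor
  products and once for the magic relators.\<close>

locale enveloping = star_algebra A for A :: "('a, 'm) star_alg_scheme" (structure) +
  fixes R :: "'a set"
  assumes bounded: "x \<in> carrier A \<Longrightarrow>
    \<exists>K. \<forall>p. cstar_seminorm A p \<longrightarrow> (\<forall>r\<in>R. p r = 0) \<longrightarrow> p x \<le> K"
begin

abbreviation "\<mu> \<equiv> max_cstar_seminorm A R"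

lemma max_cstar_seminorm_upper:
  assumes "cstar_seminorm A p" "\<And>r. r \<in> R \<Longrightarrow> p r = 0" "x \<in> carrier A"
  shows "p x \<le> \<mu> x"
  unfolding max_cstar_seminorm_def
proof (rule cSUP_upper)
  obtain K where "\<forall>p. cstar_seminorm A p \<longrightarrow> (\<forall>r\<in>R. p r = 0) \<longrightarrow> p x \<le> K"
    using bounded [OF assms(3)] by blast
  then show "bdd_above ((\<lambda>p. p x) ` {p. cstar_seminorm A p \<and> (\<forall>r\<in>R. p r = 0)})"
    by (intro bdd_aboveI [of _ K]) auto
qed (use assms in auto)

lemma max_cstar_seminorm_least:
  assumes "\<And>p. \<lbrakk>cstar_seminorm A p; \<And>r. r \<in> R \<Longrightarrow> p r = 0\<rbrakk> \<Longrightarrow> p x \<le> K"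
  shows "\<mu> x \<le> K"
  unfolding max_cstar_seminorm_def
proof (rule cSUP_least)
  \<comment> \<open>The zero seminorm vanishes on all relators, so the supremum ranges over a
    nonempty set.\<close>
  have "cstar_seminorm A (\<lambda>x. 0)"
    by (simp add: cstar_seminorm_def)
  then show "{p. cstar_seminorm A p \<and> (\<forall>r\<in>R. p r = 0)} \<noteq> {}"
    by auto
qed (use assms in auto)

lemma max_cstar_seminorm_nonneg: "x \<in> carrier A \<Longrightarrow> 0 \<le> \<mu> x"
  using max_cstar_seminorm_upper [of "\<lambda>x. 0" x] by (simp add: cstar_seminorm_def)

text \<open>One half of homogeneity. Used with \<open>inverse c\<close> on
  \<open>cscale A c x\<close>, it yields the other half.\<close>

lemma max_cstar_seminorm_cscale_le:
  assumes x: "x \<in> carrier A"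
  shows "\<mu> (cscale A c x) \<le> cmod c * \<mu> x"
proof (rule max_cstar_seminorm_least)
  fix p
  assume p: "cstar_seminorm A p" "\<And>r. r \<in> R \<Longrightarrow> p r = 0"
  show "p (cscale A c x) \<le> cmod c * \<mu> x"
    using p(1) x max_cstar_seminorm_upper [OF p x]
    by (simp add: cstar_seminorm_def mult_left_mono)
qed

lemma max_cstar_seminorm: "cstar_seminorm A \<mu>"
  unfolding cstar_seminorm_def
proof (intro conjI ballI allI max_cstar_seminorm_nonneg)
  fix x c
  assume x: "x \<in> carrier A"
  show "\<mu> (cscale A c x) = cmod c * \<mu> x"
  proof (cases "c = 0")
    case True
    then show ?thesis
      using max_cstar_seminorm_cscale_le [OF x, of 0] max_cstar_seminorm_nonneg [of \<zero>] x by simp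
  next
    case False
    have "cscale A (inverse c) (cscale A c x) = x"
      using False x by (simp add: cscale_cscale)
    then have "\<mu> x \<le> cmod (inverse c) * \<mu> (cscale A c x)"
      using max_cstar_seminorm_cscale_le [of "cscale A c x" "inverse c"] x by simp
    then have "cmod c * \<mu> x \<le> cmod c * (cmod (inverse c) * \<mu> (cscale A c x))"
      by (intro mult_left_mono) auto
    also have "\<dots> = \<mu> (cscale A c x)"
      using False by (simp add: norm_inverse)
    finally show ?thesis
      using max_cstar_seminorm_cscale_le [OF x, of c] by simp
  qed
  show "\<mu> (star A x \<otimes> x) = (\<mu> x)\<^sup>2"
  proof (rule antisym)
    show "\<mu> (star A x \<otimes> x) \<le> (\<mu> x)\<^sup>2"
    proof (rule max_cstar_seminorm_least)
      fix p
      assume p: "cstar_seminorm A p" "\<And>r. r \<in> R \<Longrightarrow> p r = 0"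
      show "p (star A x \<otimes> x) \<le> (\<mu> x)\<^sup>2"
        using p(1) x max_cstar_seminorm_upper [OF p x] by (simp add: cstar_seminorm_def power_mono)
    qed
    \<comment> \<open>The inequality is taken under the root: for each single seminorm
      \<open>p x\<close> is the root of \<open>p (star A x \<otimes> x)\<close>, and monotonicity of
      \<open>sqrt\<close> carries this to the supremum.\<close>
    have "\<mu> x \<le> sqrt (\<mu> (star A x \<otimes> x))"
    proof (rule max_cstar_seminorm_least)
      fix p
      assume p: "cstar_seminorm A p" "\<And>r. r \<in> R \<Longrightarrow> p r = 0"
      have "p (star A x \<otimes> x) = (p x)\<^sup>2"
        using p(1) x by (simp add: cstar_seminorm_def)
      then show "p x \<le> sqrt (\<mu> (star A x \<otimes> x))"
        using max_cstar_seminorm_upper [OF p, of "star A x \<otimes> x"] x by (simp add: real_le_rsqrt)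
    qed
    then have "(\<mu> x)\<^sup>2 \<le> (sqrt (\<mu> (star A x \<otimes> x)))\<^sup>2"
      using x by (intro power_mono max_cstar_seminorm_nonneg)
    then show "(\<mu> x)\<^sup>2 \<le> \<mu> (star A x \<otimes> x)"
      using x by (simp add: max_cstar_seminorm_nonneg)
  qed
  fix y
  assume y: "y \<in> carrier A"
  show "\<mu> (x \<oplus> y) \<le> \<mu> x + \<mu> y"
  proof (rule max_cstar_seminorm_least)
    fix p
    assume p: "cstar_seminorm A p" "\<And>r. r \<in> R \<Longrightarrow> p r = 0"
    have "p (x \<oplus> y) \<le> p x + p y"
      using p(1) x y by (simp add: cstar_seminorm_def)
    then show "p (x \<oplus> y) \<le> \<mu> x + \<mu> y"
      using max_cstar_seminorm_upper [OF p x] max_cstar_seminorm_upper [OF p y] by simp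
  qed
  show "\<mu> (x \<otimes> y) \<le> \<mu> x * \<mu> y"
  proof (rule max_cstar_seminorm_least)
    fix p
    assume p: "cstar_seminorm A p" "\<And>r. r \<in> R \<Longrightarrow> p r = 0"
    have "p (x \<otimes> y) \<le> p x * p y"
      using p(1) x y by (simp add: cstar_seminorm_def)
    also have "\<dots> \<le> \<mu> x * \<mu> y"
      using p(1) x y max_cstar_seminorm_upper [OF p x] max_cstar_seminorm_upper [OF p y]
      by (intro mult_mono) (auto simp: cstar_seminorm_def max_cstar_seminorm_nonneg)
    finally show "p (x \<otimes> y) \<le> \<mu> x * \<mu> y" .
  qed
qed

sublocale cstar_seminormed A \<mu>
  by unfold_locales (rule max_cstar_seminorm)

lemma max_cstar_seminorm_relator: "\<lbrakk>r \<in> R; r \<in> carrier A\<rbrakk> \<Longrightarrow> \<mu> r = 0"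
  by (intro antisym max_cstar_seminorm_least max_cstar_seminorm_nonneg) auto

lemma enveloping_cstar_algebra: "cstar_algebra (enveloping_cstar A R)"
  unfolding enveloping_cstar_def by (rule completion_cstar_algebra)

lemma enveloping_class_hom: "enveloping_class A R \<in> cstar_hom A (enveloping_cstar A R)"
  using cls_const_hom by (simp add: enveloping_cstar_def enveloping_class_def [abs_def])

lemma nrm_enveloping_class: "x \<in> carrier A \<Longrightarrow> nrm (enveloping_cstar A R) (enveloping_class A R x) = \<mu> x"
  by (simp add: enveloping_cstar_def enveloping_class_def nrm_cls_const)

lemma enveloping_class_relator:
  assumes "r \<in> R" "r \<in> carrier A"
  shows "enveloping_class A R r = \<zero>\<^bsub>enveloping_cstar A R\<^esub>"
proof -
  interpret C: cstar_algebra "enveloping_cstar A R"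
    by (rule enveloping_cstar_algebra)
  show ?thesis
    using assms cstar_hom_closed [OF enveloping_class_hom assms(2)]
    by (intro C.nrm_definite) (simp_all add: nrm_enveloping_class max_cstar_seminorm_relator)
qed

lemma enveloping_dense:
  assumes "x \<in> carrier (enveloping_cstar A R)" "e > 0"
  shows "\<exists>y\<in>carrier A. nrm (enveloping_cstar A R)
    (x \<ominus>\<^bsub>enveloping_cstar A R\<^esub> enveloping_class A R y) < e"
  using completion_dense [of x e] assms by (simp add: enveloping_cstar_def enveloping_class_def)

text \<open>The universal property: the norm of \<open>B\<close> pulled back along \<open>f\<close>
  vanishes on \<open>R\<close>, so it is one of the seminorms whose supremum is
  \<open>\<mu>\<close>.\<close>

lemma enveloping_extend_hom:
  assumes B: "cstar_algebra B" and f: "f \<in> cstar_hom A B" and R: "\<And>r. r \<in> R \<Longrightarrow> f r = \<zero>\<^bsub>B\<^esub>"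
  shows "\<exists>F\<in>cstar_hom (enveloping_cstar A R) B. \<forall>x\<in>carrier A. F (enveloping_class A R x) = f x"
proof -
  interpret B: cstar_algebra B
    by (rule B)
  interpret f: star_algebra_hom A B f
    by unfold_locales (rule f)
  have "nrm B (f x) \<le> \<mu> x" if "x \<in> carrier A" for x
    using max_cstar_seminorm_upper [OF f.seminorm_pullback [OF B.nrm_cstar] _ that] R by simp
  then show ?thesis
    unfolding enveloping_cstar_def enveloping_class_def by (rule completion_extend_hom [OF B f])
qed

end

\<comment> \<open>The *-algebra of a monoid with involution\<close>
alias mon = Poly_Mapping.single
alias coef = Poly_Mapping.lookup
alias supp = Poly_Mapping.keys

lemma sum_mon_coef: "(\<Sum>v\<in>supp f. mon v (coef f v)) = f"
  by (rule poly_mapping_eqI) (auto simp: lookup_sum lookup_single when_def in_keys_iff)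

lemma supp_Un:
  "finite (supp f \<union> supp g)" "supp (f + g) \<subseteq> supp f \<union> supp g" "supp f \<subseteq> supp f \<union> supp g"
  "supp g \<subseteq> supp f \<union> supp g"
  using Poly_Mapping.keys_add [of f g] by auto

text \<open>Instantiated twice: by the words in the letters of a magic matrix, which gives the free
  *-algebra, and by the pairs over two C*-algebras, which gives the algebra underlying the tensor
  product.\<close>

locale star_monoid = monoid M for M :: "('m, 'k) monoid_scheme" (structure) +
  fixes adj :: "'m \<Rightarrow> 'm"
  assumes adj_closed [simp]: "v \<in> carrier M \<Longrightarrow> adj v \<in> carrier M"
    and adj_adj [simp]: "v \<in> carrier M \<Longrightarrow> adj (adj v) = v"
    and adj_mult: "\<lbrakk>v \<in> carrier M; w \<in> carrier M\<rbrakk> \<Longrightarrow> adj (v \<otimes> w) = adj w \<otimes> adj v"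
begin

abbreviation "MA \<equiv> monoid_star_algebra M adj"

lemma MA_carrier_iff: "f \<in> carrier MA \<longleftrightarrow> supp f \<subseteq> carrier M"
  and MA_add [simp]: "f \<oplus>\<^bsub>MA\<^esub> g = f + g"
  and MA_zero [simp]: "\<zero>\<^bsub>MA\<^esub> = 0"
  and MA_one [simp]: "\<one>\<^bsub>MA\<^esub> = mon \<one> 1"
  by (simp_all add: monoid_star_algebra_def)

lemma lookup_MA_cscale: "coef (cscale MA c f) v = c * coef f v"
  by (simp add: monoid_star_algebra_def Poly_Mapping.map.rep_eq when_def)

lemma MA_single_closed [simp]: "v \<in> carrier M \<Longrightarrow> mon v c \<in> carrier MA"
  by (simp add: MA_carrier_iff)

lemma MA_zero_closed [simp]: "0 \<in> carrier MA"
  by (simp add: MA_carrier_iff)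

lemma MA_add_closed [simp]: "\<lbrakk>f \<in> carrier MA; g \<in> carrier MA\<rbrakk> \<Longrightarrow> f + g \<in> carrier MA"
  using Poly_Mapping.keys_add [of f g] by (auto simp: MA_carrier_iff)

lemma MA_uminus_closed [simp]: "f \<in> carrier MA \<Longrightarrow> - f \<in> carrier MA"
  by (auto simp: MA_carrier_iff in_keys_iff subset_iff)

lemma MA_diff_closed [simp]: "\<lbrakk>f \<in> carrier MA; g \<in> carrier MA\<rbrakk> \<Longrightarrow> f - g \<in> carrier MA"
  using MA_add_closed [of f "- g"] by simp

lemma MA_sum_closed [simp]: "(\<And>i. i \<in> I \<Longrightarrow> f i \<in> carrier MA) \<Longrightarrow> sum f I \<in> carrier MA"
  by (induction I rule: infinite_finite_induct) auto

lemma MA_cscale_closed [simp]: "f \<in> carrier MA \<Longrightarrow> cscale MA c f \<in> carrier MA"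
  by (auto simp: MA_carrier_iff in_keys_iff subset_iff lookup_MA_cscale)

lemma MA_cscale_single [simp]: "cscale MA c (mon v d) = mon v (c * d)"
  by (rule poly_mapping_eqI) (simp add: lookup_MA_cscale lookup_single when_def)

lemma MA_cscale_add [simp]: "cscale MA c (f + g) = cscale MA c f + cscale MA c g"
  by (rule poly_mapping_eqI) (simp add: lookup_MA_cscale lookup_add algebra_simps)

text \<open>The supports of \<open>f\<close>, \<open>g\<close> and \<open>f + g\<close> differ.
  Summing over a common larger index set makes distributivity a termwise statement.\<close>

lemma MA_mult_eq:
  assumes "finite V" "supp f \<subseteq> V" "finite W" "supp g \<subseteq> W"
  shows "f \<otimes>\<^bsub>MA\<^esub> g = (\<Sum>v\<in>V. \<Sum>w\<in>W.
    mon (v \<otimes> w) (coef f v * coef g w))"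
proof -
  have "f \<otimes>\<^bsub>MA\<^esub> g = (\<Sum>v\<in>supp f. \<Sum>w\<in>supp g.
      mon (v \<otimes> w) (coef f v * coef g w))"
    by (simp add: monoid_star_algebra_def)
  also have "\<dots> = (\<Sum>v\<in>supp f. \<Sum>w\<in>W.
      mon (v \<otimes> w) (coef f v * coef g w))"
    using assms by (intro sum.cong refl sum.mono_neutral_left) (auto simp: in_keys_iff)
  also have "\<dots> = (\<Sum>v\<in>V. \<Sum>w\<in>W.
      mon (v \<otimes> w) (coef f v * coef g w))"
    using assms by (intro sum.mono_neutral_left) (auto simp: in_keys_iff)
  finally show ?thesis .
qed

lemma MA_mult_add_left: "(f + g) \<otimes>\<^bsub>MA\<^esub> h = f \<otimes>\<^bsub>MA\<^esub> h + g \<otimes>\<^bsub>MA\<^esub> h"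
proof -
  note V = supp_Un [where f = f and g = g]
  note eq = MA_mult_eq [OF V(1) _ finite_keys [of h] subset_refl]
  show ?thesis
    unfolding eq [OF V(2)] eq [OF V(3)] eq [OF V(4)]
    by (simp add: lookup_add distrib_right single_add sum.distrib)
qed

lemma MA_mult_add_right: "h \<otimes>\<^bsub>MA\<^esub> (f + g) = h \<otimes>\<^bsub>MA\<^esub> f + h \<otimes>\<^bsub>MA\<^esub> g"
proof -
  note V = supp_Un [where f = f and g = g]
  note eq = MA_mult_eq [OF finite_keys [of h] subset_refl V(1)]
  show ?thesis
    unfolding eq [OF V(2)] eq [OF V(3)] eq [OF V(4)]
    by (simp add: lookup_add distrib_left single_add sum.distrib)
qed

lemma MA_mult_single [simp]:
  "mon v c \<otimes>\<^bsub>MA\<^esub> mon w d = mon (v \<otimes> w) (c * d)"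
  using MA_mult_eq [of "{v}" "mon v c" "{w}" "mon w d"] by simp

lemma MA_star_eq:
  assumes "finite V" "supp f \<subseteq> V"
  shows "star MA f = (\<Sum>v\<in>V. mon (adj v) (cnj (coef f v)))"
proof -
  have "star MA f = (\<Sum>v\<in>supp f. mon (adj v) (cnj (coef f v)))"
    by (simp add: monoid_star_algebra_def)
  also have "\<dots> = (\<Sum>v\<in>V. mon (adj v) (cnj (coef f v)))"
    using assms by (intro sum.mono_neutral_left) (auto simp: in_keys_iff)
  finally show ?thesis .
qed

lemma MA_star_add [simp]: "star MA (f + g) = star MA f + star MA g"
proof -
  note V = supp_Un [where f = f and g = g]
  show ?thesis
    unfolding MA_star_eq [OF V(1,2)] MA_star_eq [OF V(1,3)] MA_star_eq [OF V(1,4)]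
    by (simp add: lookup_add single_add sum.distrib)
qed

lemma MA_star_single [simp]: "star MA (mon v c) = mon (adj v) (cnj c)"
  using MA_star_eq [of "{v}" "mon v c"] by simp

text \<open>Reduces additive and multilinear identities to monomials, that is, to identities in the
  monoid \<open>M\<close> and among the coefficients.\<close>

lemma MA_induct [consumes 1, case_names single add]:
  assumes "f \<in> carrier MA"
    and single: "\<And>v c. v \<in> carrier M \<Longrightarrow> P (mon v c)"
    and add: "\<And>f g. \<lbrakk>f \<in> carrier MA; g \<in> carrier MA; P f; P g\<rbrakk> \<Longrightarrow> P (f + g)"
  shows "P f"
proof -
  have "P (\<Sum>v\<in>V. mon v (coef f v)) \<and>
      (\<Sum>v\<in>V. mon v (coef f v)) \<in> carrier MA"
    if "finite V" "V \<subseteq> carrier M" for V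
    using that
  proof (induction V)
    case empty
    then show ?case
      using single [OF one_closed, of 0] by simp
  next
    case (insert v V)
    then show ?case
      using single [of v] add by simp
  qed
  then show ?thesis
    using assms(1) by (metis MA_carrier_iff finite_keys sum_mon_coef)
qed

lemma MA_mult_closed [simp]: "\<lbrakk>f \<in> carrier MA; g \<in> carrier MA\<rbrakk> \<Longrightarrow> f \<otimes>\<^bsub>MA\<^esub> g \<in> carrier MA"
  unfolding MA_mult_eq [OF finite_keys subset_refl finite_keys subset_refl]
  by (intro MA_sum_closed MA_single_closed m_closed) (auto simp: MA_carrier_iff)

lemma MA_star_closed [simp]: "f \<in> carrier MA \<Longrightarrow> star MA f \<in> carrier MA"
  unfolding MA_star_eq [OF finite_keys subset_refl]
  by (intro MA_sum_closed MA_single_closed adj_closed) (auto simp: MA_carrier_iff)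

lemma MA_assoc:
  assumes "f \<in> carrier MA" "g \<in> carrier MA" "h \<in> carrier MA"
  shows "f \<otimes>\<^bsub>MA\<^esub> g \<otimes>\<^bsub>MA\<^esub> h = f \<otimes>\<^bsub>MA\<^esub> (g \<otimes>\<^bsub>MA\<^esub> h)"
  using assms
proof (induction f rule: MA_induct)
  case (single u a)
  from single(2,3) show ?case
  proof (induction g rule: MA_induct)
    case (single v b)
    from single(2) show ?case
    proof (induction h rule: MA_induct)
      case (single w c)
      then show ?case
        using \<open>u \<in> carrier M\<close> \<open>v \<in> carrier M\<close> by (simp add: m_assoc mult.assoc)
    qed (simp add: MA_mult_add_right)
  qed (simp add: MA_mult_add_right MA_mult_add_left)
qed (simp add: MA_mult_add_left)

lemma MA_star_mult:
  assumes "f \<in> carrier MA" "g \<in> carrier MA"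
  shows "star MA (f \<otimes>\<^bsub>MA\<^esub> g) = star MA g \<otimes>\<^bsub>MA\<^esub> star MA f"
  using assms
proof (induction f rule: MA_induct)
  case (single u a)
  from single(2) show ?case
  proof (induction g rule: MA_induct)
    case (single v b)
    then show ?case
      using \<open>u \<in> carrier M\<close> by (simp add: adj_mult mult.commute)
  qed (simp add: MA_mult_add_right MA_mult_add_left)
qed (simp add: MA_mult_add_right MA_mult_add_left)

lemma MA_cscale_mult:
  assumes "f \<in> carrier MA" "g \<in> carrier MA"
  shows "cscale MA c f \<otimes>\<^bsub>MA\<^esub> g = cscale MA c (f \<otimes>\<^bsub>MA\<^esub> g)"
    and "f \<otimes>\<^bsub>MA\<^esub> cscale MA c g = cscale MA c (f \<otimes>\<^bsub>MA\<^esub> g)"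
proof -
  have "cscale MA c f \<otimes>\<^bsub>MA\<^esub> g = cscale MA c (f \<otimes>\<^bsub>MA\<^esub> g)
    \<and> f \<otimes>\<^bsub>MA\<^esub> cscale MA c g = cscale MA c (f \<otimes>\<^bsub>MA\<^esub> g)"
    using assms
  proof (induction f rule: MA_induct)
    case (single u a)
    from single(2) show ?case
      by (induction g rule: MA_induct) (simp_all add: MA_mult_add_right ac_simps)
  qed (simp add: MA_mult_add_left)
  then show "cscale MA c f \<otimes>\<^bsub>MA\<^esub> g = cscale MA c (f \<otimes>\<^bsub>MA\<^esub> g)"
    and "f \<otimes>\<^bsub>MA\<^esub> cscale MA c g = cscale MA c (f \<otimes>\<^bsub>MA\<^esub> g)"
    by auto
qed

lemma MA_unit:
  assumes "f \<in> carrier MA"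
  shows "\<one>\<^bsub>MA\<^esub> \<otimes>\<^bsub>MA\<^esub> f = f" "f \<otimes>\<^bsub>MA\<^esub> \<one>\<^bsub>MA\<^esub> = f"
  using assms by (induction f rule: MA_induct) (simp_all add: MA_mult_add_left MA_mult_add_right)

lemma MA_star_star:
  assumes "f \<in> carrier MA"
  shows "star MA (star MA f) = f"
  using assms by (induction f rule: MA_induct) simp_all

lemma MA_star_cscale:
  assumes "f \<in> carrier MA"
  shows "star MA (cscale MA c f) = cscale MA (cnj c) (star MA f)"
  using assms by (induction f rule: MA_induct) simp_all

lemma MA_abelian_group: "abelian_group MA"
proof (rule abelian_groupI)
  fix f
  assume "f \<in> carrier MA"
  then show "\<exists>g\<in>carrier MA. g \<oplus>\<^bsub>MA\<^esub> f = \<zero>\<^bsub>MA\<^esub>"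
    by (intro bexI [of _ "- f"]) simp_all
qed (simp_all add: ac_simps)

lemma MA_star_algebra: "star_algebra MA"
proof -
  have "monoid MA"
    by (rule monoidI) (simp_all add: MA_assoc MA_unit del: MA_one, simp)
  then have "ring MA"
    by (rule ringI [OF MA_abelian_group]) (simp_all add: MA_mult_add_left MA_mult_add_right)
  moreover have "star_algebra_axioms MA"
  proof
    fix f c d
    assume "f \<in> carrier MA"
    show "cscale MA (c + d) f = cscale MA c f \<oplus>\<^bsub>MA\<^esub> cscale MA d f"
      and "cscale MA c (cscale MA d f) = cscale MA (c * d) f"
      and "cscale MA 1 f = f"
      by (auto intro!: poly_mapping_eqI simp: lookup_MA_cscale lookup_add distrib_right)
  qed (simp_all add: MA_cscale_mult MA_star_mult MA_star_star MA_star_cscale)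
  ultimately show ?thesis
    by (simp add: star_algebra_def)
qed

sublocale MA: star_algebra MA
  by (rule MA_star_algebra)

lemma MA_minus: "\<lbrakk>f \<in> carrier MA; g \<in> carrier MA\<rbrakk> \<Longrightarrow> f \<ominus>\<^bsub>MA\<^esub> g = f - g"
  using MA.minus_equality [of "- g" g] by (simp add: a_minus_def)

text \<open>The right-hand side is free of \<open>p\<close>: a bound on monomials common to a family
  of seminorms bounds the family at every element. This is how \<open>bounded\<close> in the locale
  \<open>enveloping\<close> is verified.\<close>

lemma MA_seminorm_le:
  assumes p: "cstar_seminorm MA p" and f: "f \<in> carrier MA"
    and B: "\<And>v. v \<in> carrier M \<Longrightarrow> p (mon v 1) \<le> B v"
  shows "p f \<le> (\<Sum>v\<in>supp f. cmod (coef f v) * B v)"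
proof -
  interpret p: cstar_seminormed MA p
    by unfold_locales (rule p)
  have "p (\<Sum>v\<in>V. mon v (coef f v))
      \<le> (\<Sum>v\<in>V. cmod (coef f v) * B v)"
    if "finite V" "V \<subseteq> carrier M" for V
    using that
  proof (induction V)
    case empty
    then show ?case
      using p.p_zero by simp
  next
    case (insert v V)
    let ?g = "\<Sum>v\<in>V. mon v (coef f v)"
    have g: "?g \<in> carrier MA"
      using insert.prems by (intro MA_sum_closed MA_single_closed) auto
    have "p (mon v (coef f v))
        = p (cscale MA (coef f v) (mon v 1))"
      by simp
    also have "\<dots> = cmod (coef f v) * p (mon v 1)"
      using insert.prems by (intro p.p_cscale) simp
    also have "\<dots> \<le> cmod (coef f v) * B v"
      using B insert.prems by (intro mult_left_mono) auto
    finally have "p (mon v (coef f v) + ?g)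
        \<le> cmod (coef f v) * B v + (\<Sum>v\<in>V. cmod (coef f v) * B v)"
      using p.p_triangle [of "mon v (coef f v)" ?g] g insert by auto
    then show ?case
      using insert by simp
  qed
  then show ?thesis
    using f by (metis MA_carrier_iff finite_keys sum_mon_coef)
qed

text \<open>Monomials form a linear basis, so \<open>h\<close> extends linearly, and the extension
  respects products and adjoints because it does so on monomials.\<close>

lemma MA_extend_hom:
  assumes C: "star_algebra C"
    and h: "\<And>v. v \<in> carrier M \<Longrightarrow> h v \<in> carrier C" "h \<one> = \<one>\<^bsub>C\<^esub>"
      "\<And>v w. \<lbrakk>v \<in> carrier M; w \<in> carrier M\<rbrakk> \<Longrightarrow> h (v \<otimes> w) = h v \<otimes>\<^bsub>C\<^esub> h w"
      "\<And>v. v \<in> carrier M \<Longrightarrow> h (adj v) = star C (h v)"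
  shows "\<exists>f\<in>cstar_hom MA C. \<forall>v\<in>carrier M. f (mon v 1) = h v"
proof -
  interpret C: star_algebra C
    by (rule C)
  define ev where "ev f = (\<Oplus>\<^bsub>C\<^esub>v\<in>supp f. cscale C (coef f v) (h v))" for f
  have ev_eq: "ev f = (\<Oplus>\<^bsub>C\<^esub>v\<in>V. cscale C (coef f v) (h v))"
    if "finite V" "supp f \<subseteq> V" "V \<subseteq> carrier M" for f V
    unfolding ev_def using that h
    by (intro C.add.finprod_mono_neutral_cong_left) (auto simp: in_keys_iff)
  have ev_closed: "ev f \<in> carrier C" if "f \<in> carrier MA" for f
    using that h unfolding ev_def by (intro C.finsum_closed) (auto simp: MA_carrier_iff)
  have ev_single: "ev (mon v c) = cscale C c (h v)" if "v \<in> carrier M" for v c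
    using that h ev_eq [of "{v}" "mon v c"] by simp
  have ev_add: "ev (f + g) = ev f \<oplus>\<^bsub>C\<^esub> ev g" if "f \<in> carrier MA" "g \<in> carrier MA" for f g
  proof -
    define V where "V = supp f \<union> supp g"
    have V: "finite V" "supp (f + g) \<subseteq> V" "supp f \<subseteq> V"
      "supp g \<subseteq> V" "V \<subseteq> carrier M"
      using Poly_Mapping.keys_add [of f g] that by (auto simp: V_def MA_carrier_iff)
    have hV: "h v \<in> carrier C" if "v \<in> V" for v
      using that V h by blast
    have "(\<Oplus>\<^bsub>C\<^esub>v\<in>V. cscale C (coef (f + g) v) (h v))
        = (\<Oplus>\<^bsub>C\<^esub>v\<in>V. cscale C (coef f v) (h v) \<oplus>\<^bsub>C\<^esub> cscale C (coef g v) (h v))"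
      using hV by (intro C.finsum_cong') (auto simp: lookup_add C.cscale_add_left)
    also have "\<dots> = (\<Oplus>\<^bsub>C\<^esub>v\<in>V. cscale C (coef f v) (h v))
        \<oplus>\<^bsub>C\<^esub> (\<Oplus>\<^bsub>C\<^esub>v\<in>V. cscale C (coef g v) (h v))"
      using hV by (intro C.finsum_addf) auto
    finally show ?thesis
      using V by (simp add: ev_eq [of V])
  qed
  have "ev \<in> cstar_hom MA C"
  proof (rule cstar_homI)
    show "ev \<one>\<^bsub>MA\<^esub> = \<one>\<^bsub>C\<^esub>"
      by (simp add: ev_single h)
  next
    fix f g
    assume fg: "f \<in> carrier MA" "g \<in> carrier MA"
    then show "ev (f \<oplus>\<^bsub>MA\<^esub> g) = ev f \<oplus>\<^bsub>C\<^esub> ev g"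
      by (simp add: ev_add)
    from fg show "ev (f \<otimes>\<^bsub>MA\<^esub> g) = ev f \<otimes>\<^bsub>C\<^esub> ev g"
    proof (induction f rule: MA_induct)
      case (single u a)
      from single(2) show ?case
      proof (induction g rule: MA_induct)
        case (single v b)
        then show ?case
          using \<open>u \<in> carrier M\<close> h
          by (simp add: ev_single C.cscale_mult_left C.cscale_mult_right C.cscale_cscale
              mult.commute)
      qed (use \<open>u \<in> carrier M\<close> in \<open>simp add: MA_mult_add_right ev_add ev_closed C.r_distr\<close>)
    qed (simp add: MA_mult_add_left ev_add ev_closed C.l_distr)
  next
    fix f c
    assume f: "f \<in> carrier MA"
    then show "ev f \<in> carrier C"
      by (rule ev_closed)
    from f show "ev (cscale MA c f) = cscale C c (ev f)"
      by (induction f rule: MA_induct)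
         (simp_all add: ev_single ev_add ev_closed h C.cscale_cscale C.cscale_add_right)
    from f show "ev (star MA f) = star C (ev f)"
      by (induction f rule: MA_induct)
         (simp_all add: ev_single ev_add ev_closed h C.star_cscale C.star_add)
  qed
  moreover have "ev (mon v 1) = h v" if "v \<in> carrier M" for v
    using that h by (simp add: ev_single)
  ultimately show ?thesis
    by blast
qed

end

section \<open>The Riesz representation and bounded operators\<close>

subclass (in complex_hilbert_space) banach ..

lemma scaleC_minus_left: "(- c) *\<^sub>C (x :: 'h::complex_hilbert_space) = - (c *\<^sub>C x)"
  and scaleC_zero_left [simp]: "0 *\<^sub>C x = 0"
proof -
  show 0: "0 *\<^sub>C x = 0"
    using scaleC_add_left [of 0 0 x] by simp
  have "(- c) *\<^sub>C x + c *\<^sub>C x = 0"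
    using scaleC_add_left [of "- c" c x] 0 by simp
  then show "(- c) *\<^sub>C x = - (c *\<^sub>C x)"
    using add_eq_0_iff2 by blast
qed

lemma scaleC_one [simp]: "1 *\<^sub>C (x :: 'h::complex_hilbert_space) = x"
  using scaleR_scaleC [of 1 x] by simp

lemma scaleC_scaleR: "c *\<^sub>C r *\<^sub>R (x :: 'h::complex_hilbert_space) = r *\<^sub>R c *\<^sub>C x"
  by (simp add: scaleR_scaleC scaleC_scaleC mult.commute)

lemma scaleC_zero_right [simp]: "c *\<^sub>C (0 :: 'h::complex_hilbert_space) = 0"
  using scaleC_scaleR [of c 0 0] by simp

lemma scaleC_minus_right: "c *\<^sub>C (- (x :: 'h::complex_hilbert_space)) = - (c *\<^sub>C x)"
  using scaleC_scaleR [of c "- 1" x] by simp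

lemma cinner_zero_left [simp]: "cinner 0 (y :: 'h::complex_hilbert_space) = 0"
  using cinner_scaleC_left [of 0 0 y] by simp

lemma cinner_add_right: "cinner (x :: 'h::complex_hilbert_space) (y + z) = cinner x y + cinner x z"
  using cinner_commute [of x "y + z"] cinner_commute [of x y] cinner_commute [of x z]
  by (simp add: cinner_add_left)

lemma cinner_scaleC_right: "cinner (x :: 'h::complex_hilbert_space) (c *\<^sub>C y) = cnj c * cinner x y"
  using cinner_commute [of x "c *\<^sub>C y"] cinner_commute [of x y] by (simp add: cinner_scaleC_left)

lemma cinner_minus_left: "cinner (- (x :: 'h::complex_hilbert_space)) y = - cinner x y"
  using cinner_scaleC_left [of "- 1" x y] by (simp add: scaleC_minus_left)

lemma cinner_minus_right: "cinner (x :: 'h::complex_hilbert_space) (- y) = - cinner x y"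
  using cinner_scaleC_right [of x "- 1" y] by (simp add: scaleC_minus_left)

lemma cinner_diff_left: "cinner (x - y :: 'h::complex_hilbert_space) z = cinner x z - cinner y z"
  using cinner_add_left [of x "- y" z] by (simp add: cinner_minus_left)

lemma cinner_diff_right: "cinner (x :: 'h::complex_hilbert_space) (y - z) = cinner x y - cinner x z"
  using cinner_add_right [of x y "- z"] by (simp add: cinner_minus_right)

lemma cinner_sum_left: "cinner (\<Sum>i\<in>I. f i :: 'h::complex_hilbert_space) y = (\<Sum>i\<in>I. cinner (f i) y)"
  by (induction I rule: infinite_finite_induct) (simp_all add: cinner_add_left)

lemma cinner_eq_0_commute: "cinner (x :: 'h::complex_hilbert_space) y = 0 \<longleftrightarrow> cinner y x = 0"
  by (metis cinner_commute complex_cnj_zero)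

lemma cinner_self_eq_0_iff [simp]: "cinner (x :: 'h::complex_hilbert_space) x = 0 \<longleftrightarrow> x = 0"
  using inner_eq_Re_cinner [of x x] by auto

lemma cinner_eqI:
  assumes "\<And>x. cinner x (y :: 'h::complex_hilbert_space) = cinner x z"
  shows "y = z"
  using assms [of "y - z"] cinner_diff_right [of "y - z" y z] by simp

lemma norm_scaleC: "norm (c *\<^sub>C (x :: 'h::complex_hilbert_space)) = cmod c * norm x"
proof -
  have "cinner (c *\<^sub>C x) (c *\<^sub>C x) = of_real ((cmod c)\<^sup>2) * cinner x x"
    by (simp add: cinner_scaleC_left cinner_scaleC_right complex_norm_square mult.assoc del: of_real_power)
  then have "inner (c *\<^sub>C x) (c *\<^sub>C x) = (cmod c)\<^sup>2 * inner x x"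
    by (simp only: inner_eq_Re_cinner) (simp del: of_real_power)
  then have "(norm (c *\<^sub>C x))\<^sup>2 = (cmod c * norm x)\<^sup>2"
    by (simp add: power2_norm_eq_inner power_mult_distrib)
  then show ?thesis
    by (simp add: power2_eq_iff_nonneg)
qed

lemma bounded_linear_scaleC: "bounded_linear (\<lambda>x :: 'h::complex_hilbert_space. c *\<^sub>C x)"
  by (rule bounded_linear_intro [of _ "cmod c"])
     (simp_all add: scaleC_add_right scaleC_scaleR norm_scaleC mult.commute)

text \<open>Riesz representation is available for the real inner product only. An identity of
  complex inner products is obtained by testing the real one at \<open>x\<close> and at
  \<open>(- \<i>) *\<^sub>C x\<close>.\<close>

lemma Im_cinner: "Im (cinner (x :: 'h::complex_hilbert_space) y) = inner ((- \<i>) *\<^sub>C x) y"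
  by (simp add: inner_eq_Re_cinner cinner_scaleC_left)

text \<open>The Riesz vector of \<open>f\<close> is the minimizer of \<open>\<parallel>x\<parallel>\<^sup>2 - 2 f x\<close>; minimizing sequences are Cauchy by
  the parallelogram law.\<close>

lemma riesz_representation:
  fixes f :: "'a::{real_inner, complete_space} \<Rightarrow> real"
  assumes "bounded_linear f"
  obtains a where "\<And>x. f x = inner x a"
proof -
  interpret f: bounded_linear f
    by (rule assms)
  obtain K where K: "\<And>x. norm (f x) \<le> norm x * K"
    using f.bounded by blast
  define J where "J x = (norm x)\<^sup>2 - 2 * f x" for x
  define m where "m = Inf (range J)"
  have "- K\<^sup>2 \<le> J x" for x
  proof -
    have "2 * f x \<le> 2 * (norm x * K)"
      using K [of x] by simp
    also have "\<dots> \<le> (norm x)\<^sup>2 + K\<^sup>2"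
      using sum_squares_bound [of "norm x" K] by simp
    finally show ?thesis
      by (simp add: J_def)
  qed
  then have "bdd_below (range J)"
    by (intro bdd_belowI [of _ "- K\<^sup>2"]) auto
  then have m_le: "m \<le> J x" for x
    by (simp add: m_def cInf_lower)
  have "\<exists>x. J x < m + inverse (real (Suc k))" for k
    using cInf_lessD [of "range J" "m + inverse (real (Suc k))"] by (auto simp: m_def)
  then obtain s where s: "\<And>k. J (s k) < m + inverse (real (Suc k))"
    by metis
  have par: "(norm (x - y))\<^sup>2 \<le> 2 * (J x - m) + 2 * (J y - m)" for x y
  proof -
    have n: "norm ((1/2) *\<^sub>R (x + y)) = norm (x + y) / 2"
      by (simp only: norm_scaleR)
    have h: "f ((1/2) *\<^sub>R (x + y)) = (f x + f y) / 2"
      by (simp only: f.scale f.add) simp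
    have "4 * J ((1/2) *\<^sub>R (x + y)) = (norm (x + y))\<^sup>2 - 4 * (f x + f y)"
      unfolding J_def n h by (simp add: power_divide field_simps)
    moreover have "(norm (x + y))\<^sup>2 + (norm (x - y))\<^sup>2 = 2 * (norm x)\<^sup>2 + 2 * (norm y)\<^sup>2"
      by (simp add: power2_norm_eq_inner inner_add_left inner_add_right inner_diff_left inner_diff_right)
    ultimately show ?thesis
      using m_le [of "(1/2) *\<^sub>R (x + y)"] by (simp add: J_def)
  qed
  have "Cauchy s"
  proof (rule metric_CauchyI)
    fix e :: real
    assume e: "e > 0"
    then obtain M where M: "inverse (real (Suc M)) < e\<^sup>2 / 4"
      using reals_Archimedean [of "e\<^sup>2 / 4"] by auto
    have J: "J (s k) - m < e\<^sup>2 / 4" if "k \<ge> M" for k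
    proof -
      have "inverse (real (Suc k)) \<le> inverse (real (Suc M))"
        using that by (intro le_imp_inverse_le) auto
      then show ?thesis
        using s [of k] M by linarith
    qed
    have "dist (s k) (s l) < e" if "k \<ge> M" "l \<ge> M" for k l
    proof -
      have "(norm (s k - s l))\<^sup>2 < e\<^sup>2"
        using par [of "s k" "s l"] J [OF that(1)] J [OF that(2)] by simp
      then show ?thesis
        using e by (simp add: dist_norm power2_less_imp_less)
    qed
    then show "\<exists>M. \<forall>k\<ge>M. \<forall>l\<ge>M. dist (s k) (s l) < e"
      by blast
  qed
  then obtain a where a: "s \<longlonglongrightarrow> a"
    using Cauchy_convergent convergent_def by blast
  have Ja: "J a \<le> m"
  proof (rule LIMSEQ_le)
    show "(\<lambda>k. J (s k)) \<longlonglongrightarrow> J a"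
      unfolding J_def by (intro tendsto_intros a f.tendsto)
    show "(\<lambda>k. m + inverse (real (Suc k))) \<longlonglongrightarrow> m"
      using tendsto_add [OF tendsto_const LIMSEQ_inverse_real_of_nat, of m] by simp
  qed (use s less_imp_le in blast)
  have "f x = inner x a" for x
  proof (cases "x = 0")
    case False
    define d where "d = inner x a - f x"
    \<comment> \<open>The minimizer of the quadratic \<open>t^2 (norm x)^2 + 2 t d\<close>, by which
      \<open>J\<close> changes along the line \<open>a + t x\<close>. Its minimum is negative unless
      \<open>d = 0\<close>.\<close>
    define t where "t = - d / (norm x)\<^sup>2"
    have "(norm (a + t *\<^sub>R x))\<^sup>2 = (norm a)\<^sup>2 + t * (t * (norm x)\<^sup>2 + 2 * inner x a)"
      unfolding power2_norm_eq_inner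
      by (simp add: inner_add_left inner_add_right inner_commute [of a x] algebra_simps)
    then have "J (a + t *\<^sub>R x) = J a + t * (t * (norm x)\<^sup>2 + 2 * d)"
      by (simp add: J_def d_def f.add f.scale algebra_simps)
    also have "t * (t * (norm x)\<^sup>2 + 2 * d) = - d\<^sup>2 / (norm x)\<^sup>2"
      using False by (simp add: t_def power2_eq_square)
    finally have "d\<^sup>2 / (norm x)\<^sup>2 \<le> 0"
      using m_le [of "a + t *\<^sub>R x"] Ja by simp
    then have "d = 0"
      using False by (simp add: divide_le_0_iff)
    then show ?thesis
      by (simp add: d_def)
  qed (simp add: f.zero)
  then show ?thesis
    using that by blast
qed

section \<open>Adjoints and the C*-algebra of bounded operators\<close>

abbreviation BO :: "('h::complex_hilbert_space \<Rightarrow>\<^sub>L 'h) cstar" where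
  "BO \<equiv> bounded_operators"

lemma BO_carrier_iff: "T \<in> carrier BO \<longleftrightarrow> (\<forall>c x. blinfun_apply T (c *\<^sub>C x) = c *\<^sub>C blinfun_apply T x)"
  and BO_simps [simp]: "S \<otimes>\<^bsub>BO\<^esub> T = S o\<^sub>L T" "\<one>\<^bsub>BO\<^esub> = id_blinfun" "\<zero>\<^bsub>BO\<^esub> = 0" "S \<oplus>\<^bsub>BO\<^esub> T = S + T"
    "star BO = adjoint_op" "nrm BO = norm"
  by (simp_all add: bounded_operators_def)

lemma BO_cscale_apply [simp]: "blinfun_apply (cscale BO c T) x = c *\<^sub>C blinfun_apply T x"
proof -
  have "bounded_linear (\<lambda>x. c *\<^sub>C blinfun_apply T x)"
    by (rule bounded_linear_compose [OF bounded_linear_scaleC blinfun.bounded_linear_right])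
  then show ?thesis
    by (simp add: bounded_operators_def bounded_linear_Blinfun_apply)
qed

lemma adjoint_op_eqI:
  assumes "\<And>x y. cinner (blinfun_apply T x) y = cinner x (blinfun_apply S y)"
  shows "adjoint_op T = S"
  unfolding adjoint_op_def
proof (rule the_equality)
  fix S'
  assume S': "\<forall>x y. cinner (blinfun_apply T x) y = cinner x (blinfun_apply S' y)"
  have "cinner x (blinfun_apply S' y) = cinner x (blinfun_apply S y)" for x y
    using S' assms [of x y] by simp
  then show "S' = S"
    by (rule blinfun_eqI [OF cinner_eqI])
qed (use assms in simp)

text \<open>Riesz representation of the real functionals \<open>inner (T x) y\<close> of
  \<open>x\<close> gives a real adjoint; complex linearity of \<open>T\<close> upgrades the identity
  to \<open>cinner\<close>. The norm bound is one half of the C*-identity.\<close>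

lemma adjoint_exists:
  fixes T :: "'h::complex_hilbert_space \<Rightarrow>\<^sub>L 'h"
  assumes T: "T \<in> carrier BO"
  obtains S where "\<And>x y. cinner (blinfun_apply T x) y = cinner x (blinfun_apply S y)" "norm S \<le> norm T"
proof -
  have "\<exists>z. \<forall>x. inner (blinfun_apply T x) y = inner x z" for y
  proof -
    have "bounded_linear (\<lambda>x. inner (blinfun_apply T x) y)"
      by (rule bounded_linear_compose [OF bounded_linear_inner_left blinfun.bounded_linear_right])
    from riesz_representation [OF this] show ?thesis
      by metis
  qed
  then obtain g where g: "\<And>x y. inner (blinfun_apply T x) y = inner x (g y)"
    by metis
  have eqI: "u = v" if "\<And>x. inner x u = inner x v" for u v :: 'h
    using that [of "u - v"] by (metis inner_diff_right inner_eq_zero_iff eq_iff_diff_eq_0)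
  have le: "norm (g y) \<le> norm T * norm y" for y
  proof (cases "g y = 0")
    case False
    have "norm (g y) * norm (g y) = inner (blinfun_apply T (g y)) y"
      by (simp add: g power2_norm_eq_inner flip: power2_eq_square)
    also have "\<dots> \<le> norm (blinfun_apply T (g y)) * norm y"
      by (rule norm_cauchy_schwarz)
    also have "\<dots> \<le> (norm T * norm (g y)) * norm y"
      by (intro mult_right_mono norm_blinfun) simp
    finally show ?thesis
      using False by (simp add: mult.commute mult.left_commute)
  qed simp
  have bl: "bounded_linear g"
  proof (rule bounded_linear_intro)
    show "g (x + y) = g x + g y" for x y
      by (rule eqI) (simp add: inner_add_right flip: g)
    show "g (r *\<^sub>R x) = r *\<^sub>R g x" for r x
      by (rule eqI) (simp flip: g)
    show "norm (g x) \<le> norm x * norm T" for x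
      using le [of x] by (simp add: mult.commute)
  qed
  note ap = bounded_linear_Blinfun_apply [OF bl]
  show thesis
  proof
    show "cinner (blinfun_apply T x) y = cinner x (blinfun_apply (Blinfun g) y)" for x y
    proof (rule complex_eqI)
      show "Re (cinner (blinfun_apply T x) y) = Re (cinner x (blinfun_apply (Blinfun g) y))"
        using g [of x y] by (simp add: ap flip: inner_eq_Re_cinner)
      show "Im (cinner (blinfun_apply T x) y) = Im (cinner x (blinfun_apply (Blinfun g) y))"
        using g [of "(- \<i>) *\<^sub>C x" y] T by (simp add: ap Im_cinner BO_carrier_iff)
    qed
    show "norm (Blinfun g) \<le> norm T"
      using le by (intro norm_blinfun_bound) (simp_all add: ap)
  qed
qed

lemma
  assumes T: "T \<in> carrier BO"
  shows cinner_adjoint_op: "cinner (blinfun_apply T x) y = cinner x (blinfun_apply (adjoint_op T) y)"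
    and norm_adjoint_op_le: "norm (adjoint_op T) \<le> norm T"
    and adjoint_op_closed: "adjoint_op T \<in> carrier BO"
proof -
  obtain S where S: "\<And>x y. cinner (blinfun_apply T x) y = cinner x (blinfun_apply S y)" "norm S \<le> norm T"
    using adjoint_exists [OF T] by blast
  have ST: "adjoint_op T = S"
    by (rule adjoint_op_eqI) (rule S)
  show "cinner (blinfun_apply T x) y = cinner x (blinfun_apply (adjoint_op T) y)"
    and "norm (adjoint_op T) \<le> norm T"
    using S by (simp_all add: ST)
  show "adjoint_op T \<in> carrier BO"
    unfolding ST BO_carrier_iff
  proof (intro allI)
    show "blinfun_apply S (c *\<^sub>C y) = c *\<^sub>C blinfun_apply S y" for c y
      by (rule cinner_eqI) (simp add: cinner_scaleC_right flip: S(1))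
  qed
qed

lemma BO_closed [simp]:
  "id_blinfun \<in> carrier BO" "0 \<in> carrier BO"
  "\<lbrakk>S \<in> carrier BO; T \<in> carrier BO\<rbrakk> \<Longrightarrow> S + T \<in> carrier BO"
  "\<lbrakk>S \<in> carrier BO; T \<in> carrier BO\<rbrakk> \<Longrightarrow> S o\<^sub>L T \<in> carrier BO"
  "T \<in> carrier BO \<Longrightarrow> - T \<in> carrier BO"
  "T \<in> carrier BO \<Longrightarrow> cscale BO c T \<in> carrier BO"
  by (simp_all add: BO_carrier_iff blinfun.add_left blinfun.minus_left scaleC_add_right scaleC_minus_right
      scaleC_scaleC mult.commute)

lemma adjoint_op_right:
  "T \<in> carrier BO \<Longrightarrow> cinner x (blinfun_apply T y) = cinner (blinfun_apply (adjoint_op T) x) y"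
  using cinner_adjoint_op [of T y x] by (metis cinner_commute)

lemma BO_abelian_group: "abelian_group (BO :: ('h::complex_hilbert_space \<Rightarrow>\<^sub>L 'h) cstar)"
proof (rule abelian_groupI)
  fix T :: "'h \<Rightarrow>\<^sub>L 'h"
  assume "T \<in> carrier BO"
  then show "\<exists>S\<in>carrier BO. S \<oplus>\<^bsub>BO\<^esub> T = \<zero>\<^bsub>BO\<^esub>"
    by (intro bexI [of _ "- T"]) simp_all
qed (simp_all add: ac_simps)

lemma BO_star_algebra: "star_algebra (BO :: ('h::complex_hilbert_space \<Rightarrow>\<^sub>L 'h) cstar)"
proof -
  have "monoid (BO :: ('h \<Rightarrow>\<^sub>L 'h) cstar)"
    by (rule monoidI) (auto intro!: blinfun_eqI)
  then have "ring (BO :: ('h \<Rightarrow>\<^sub>L 'h) cstar)"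
    by (rule ringI [OF BO_abelian_group]) (auto intro!: blinfun_eqI simp: blinfun.add_left blinfun.add_right)
  moreover have "star_algebra_axioms (BO :: ('h \<Rightarrow>\<^sub>L 'h) cstar)"
  proof
    fix S T :: "'h \<Rightarrow>\<^sub>L 'h" and c d :: complex
    assume T: "T \<in> carrier BO"
    show "cscale BO (c + d) T = cscale BO c T \<oplus>\<^bsub>BO\<^esub> cscale BO d T"
      and "cscale BO c (cscale BO d T) = cscale BO (c * d) T"
      and "cscale BO 1 T = T"
      by (auto intro!: blinfun_eqI simp: blinfun.add_left scaleC_add_left scaleC_scaleC)
    show "star BO T \<in> carrier BO"
      using T by (simp add: adjoint_op_closed)
    show "star BO (star BO T) = T"
      using T by (simp add: adjoint_op_eqI adjoint_op_right)
    show "star BO (cscale BO c T) = cscale BO (cnj c) (star BO T)"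
      using T
      by (simp, intro adjoint_op_eqI) (simp add: cinner_scaleC_left cinner_scaleC_right cinner_adjoint_op)
    assume S: "S \<in> carrier BO"
    show "cscale BO c (S \<oplus>\<^bsub>BO\<^esub> T) = cscale BO c S \<oplus>\<^bsub>BO\<^esub> cscale BO c T"
      and "cscale BO c S \<otimes>\<^bsub>BO\<^esub> T = cscale BO c (S \<otimes>\<^bsub>BO\<^esub> T)"
      and "S \<otimes>\<^bsub>BO\<^esub> cscale BO c T = cscale BO c (S \<otimes>\<^bsub>BO\<^esub> T)"
      using S by (auto intro!: blinfun_eqI simp: blinfun.add_left scaleC_add_right BO_carrier_iff)
    show "star BO (S \<oplus>\<^bsub>BO\<^esub> T) = star BO S \<oplus>\<^bsub>BO\<^esub> star BO T"
      using S T by (simp, intro adjoint_op_eqI)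
        (simp add: cinner_add_left cinner_add_right cinner_adjoint_op blinfun.add_left)
    show "star BO (S \<otimes>\<^bsub>BO\<^esub> T) = star BO T \<otimes>\<^bsub>BO\<^esub> star BO S"
      using S T by (simp, intro adjoint_op_eqI) (simp add: cinner_adjoint_op)
  qed simp
  ultimately show ?thesis
    by (simp add: star_algebra_def)
qed

text \<open>One inequality is submultiplicativity with the bound on the adjoint. For the other, the
  square of the norm of \<open>T x\<close> is \<open>inner x (adjoint_op T (T x))\<close>, to which
  Cauchy-Schwarz applies.\<close>

lemma norm_adjoint_op_compose:
  assumes T: "T \<in> carrier BO"
  shows "norm (adjoint_op T o\<^sub>L T) = (norm T)\<^sup>2"
proof (rule antisym)
  have "norm (adjoint_op T o\<^sub>L T) \<le> norm (adjoint_op T) * norm T"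
    by (rule norm_blinfun_compose)
  also have "\<dots> \<le> norm T * norm T"
    by (intro mult_right_mono norm_adjoint_op_le T) simp
  finally show "norm (adjoint_op T o\<^sub>L T) \<le> (norm T)\<^sup>2"
    by (simp add: power2_eq_square)
  have "norm T \<le> sqrt (norm (adjoint_op T o\<^sub>L T))"
  proof (rule norm_blinfun_bound)
    fix x
    have "(norm (blinfun_apply T x))\<^sup>2 = inner x (blinfun_apply (adjoint_op T o\<^sub>L T) x)"
      by (simp add: power2_norm_eq_inner inner_eq_Re_cinner cinner_adjoint_op T)
    also have "\<dots> \<le> norm x * norm (blinfun_apply (adjoint_op T o\<^sub>L T) x)"
      by (rule norm_cauchy_schwarz)
    also have "\<dots> \<le> norm x * (norm (adjoint_op T o\<^sub>L T) * norm x)"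
      by (intro mult_left_mono norm_blinfun) simp
    also have "\<dots> = (sqrt (norm (adjoint_op T o\<^sub>L T)) * norm x)\<^sup>2"
      by (simp add: power_mult_distrib) (simp add: power2_eq_square)
    finally show "norm (blinfun_apply T x) \<le> sqrt (norm (adjoint_op T o\<^sub>L T)) * norm x"
      by (rule power2_le_imp_le) simp
  qed simp
  then have "(norm T)\<^sup>2 \<le> (sqrt (norm (adjoint_op T o\<^sub>L T)))\<^sup>2"
    by (intro power_mono) simp_all
  then show "(norm T)\<^sup>2 \<le> norm (adjoint_op T o\<^sub>L T)"
    by simp
qed

lemma BO_cstar_algebra: "cstar_algebra (BO :: ('h::complex_hilbert_space \<Rightarrow>\<^sub>L 'h) cstar)"
proof -
  interpret star_algebra "BO :: ('h \<Rightarrow>\<^sub>L 'h) cstar"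
    by (rule BO_star_algebra)
  have minus: "S \<ominus>\<^bsub>BO\<^esub> T = S - T" if "T \<in> carrier BO" for S T :: "'h \<Rightarrow>\<^sub>L 'h"
    using minus_equality [of "- T" T] that by (simp add: a_minus_def)
  show ?thesis
  proof
    show "cstar_seminorm BO (nrm (BO :: ('h \<Rightarrow>\<^sub>L 'h) cstar))"
      unfolding cstar_seminorm_def
    proof (intro conjI ballI allI)
      fix T :: "'h \<Rightarrow>\<^sub>L 'h" and c
      show "nrm BO (cscale BO c T) = cmod c * nrm BO T"
      proof -
        have le: "norm (cscale BO c T) \<le> cmod c * norm T" for c and T :: "'h \<Rightarrow>\<^sub>L 'h"
          using mult_left_mono [OF norm_blinfun, of "cmod c" T]
          by (intro norm_blinfun_bound) (simp_all add: norm_scaleC mult.assoc)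
        show ?thesis
        proof (cases "c = 0")
          case True
          then show ?thesis
            using le [of 0 T] by simp
        next
          case False
          have "cscale BO (inverse c) (cscale BO c T) = T"
            using False by (intro blinfun_eqI) (simp add: scaleC_scaleC)
          then have "cmod c * norm T \<le> cmod c * (cmod (inverse c) * norm (cscale BO c T))"
            using le [of "inverse c" "cscale BO c T"] by (intro mult_left_mono) simp_all
          also have "\<dots> = norm (cscale BO c T)"
            using False by (simp add: norm_inverse)
          finally show ?thesis
            using le [of c T] by simp
        qed
      qed
    qed (simp_all add: norm_triangle_ineq norm_blinfun_compose norm_adjoint_op_compose)
  next
    fix s :: "nat \<Rightarrow> 'h \<Rightarrow>\<^sub>L 'h"
    assume s: "seminorm_Cauchy BO (nrm BO) s"
    have sc: "s k \<in> carrier BO" for k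
      using s by (simp add: seminorm_Cauchy_def)
    then have "Cauchy s"
      using s by (simp add: seminorm_Cauchy_def Cauchy_iff minus)
    then obtain T where T: "s \<longlonglongrightarrow> T"
      using Cauchy_convergent convergent_def by blast
    \<comment> \<open>The norm limit is found among the real bounded operators; complex linearity
      passes to it pointwise.\<close>
    have lim: "(\<lambda>k. blinfun_apply (s k) x) \<longlonglongrightarrow> blinfun_apply T x" for x
      by (intro tendsto_intros T)
    have "blinfun_apply T (c *\<^sub>C x) = c *\<^sub>C blinfun_apply T x" for c x
      using LIMSEQ_unique [OF lim [of "c *\<^sub>C x"]] bounded_linear.tendsto [OF bounded_linear_scaleC lim [of x], of c] sc
      by (simp add: BO_carrier_iff)
    then have Tc: "T \<in> carrier BO"
      by (simp add: BO_carrier_iff)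
    have "(\<lambda>k. nrm BO (s k \<ominus>\<^bsub>BO\<^esub> T)) \<longlonglongrightarrow> 0"
      using T by (simp add: minus Tc LIM_zero_iff tendsto_norm_zero_iff)
    then show "\<exists>T\<in>carrier BO. (\<lambda>k. nrm BO (s k \<ominus>\<^bsub>BO\<^esub> T)) \<longlonglongrightarrow> 0"
      using Tc by blast
  qed simp
qed

section \<open>The complex numbers and the opposite algebra, as targets of counit and
  antipode\<close>

lemma complex_cstar_simps [simp]:
  "carrier complex_cstar = UNIV" "x \<otimes>\<^bsub>complex_cstar\<^esub> y = x * y" "\<one>\<^bsub>complex_cstar\<^esub> = 1"
  "\<zero>\<^bsub>complex_cstar\<^esub> = 0" "x \<oplus>\<^bsub>complex_cstar\<^esub> y = x + y" "cscale complex_cstar c x = c * x"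
  "star complex_cstar x = cnj x" "nrm complex_cstar x = cmod x"
  by (simp_all add: complex_cstar_def)

lemma complex_cstar_algebra: "cstar_algebra complex_cstar"
proof -
  have ag: "abelian_group complex_cstar"
    by (rule abelian_groupI) (auto simp: ac_simps intro: exI [of _ "- _"])
  have "monoid complex_cstar"
    by (rule monoidI) simp_all
  then have rg: "ring complex_cstar"
    by (rule ringI [OF ag]) (simp_all add: algebra_simps)
  interpret star_algebra complex_cstar
    by (intro star_algebra.intro rg) (unfold_locales, simp_all add: algebra_simps)
  have minus: "x \<ominus>\<^bsub>complex_cstar\<^esub> y = x - y" for x y
    using minus_equality [of "- y" y] by (simp add: a_minus_def)
  show ?thesis
  proof
    show "cstar_seminorm complex_cstar (nrm complex_cstar)"
      by (simp add: cstar_seminorm_def norm_mult norm_triangle_ineq power2_eq_square)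
  next
    fix s
    assume "seminorm_Cauchy complex_cstar (nrm complex_cstar) s"
    then have "Cauchy s"
      by (simp add: seminorm_Cauchy_def Cauchy_iff minus)
    then obtain x where "s \<longlonglongrightarrow> x"
      using Cauchy_convergent convergent_def by blast
    then show "\<exists>x\<in>carrier complex_cstar. (\<lambda>k. nrm complex_cstar (s k \<ominus>\<^bsub>complex_cstar\<^esub> x)) \<longlonglongrightarrow> 0"
      by (intro bexI [of _ x]) (simp_all add: minus LIM_zero_iff tendsto_norm_zero_iff)
  qed simp
qed

lemma opposite_simps [simp]:
  "carrier (opposite A) = carrier A" "x \<otimes>\<^bsub>opposite A\<^esub> y = y \<otimes>\<^bsub>A\<^esub> x" "\<one>\<^bsub>opposite A\<^esub> = \<one>\<^bsub>A\<^esub>"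
  "\<zero>\<^bsub>opposite A\<^esub> = \<zero>\<^bsub>A\<^esub>" "x \<oplus>\<^bsub>opposite A\<^esub> y = x \<oplus>\<^bsub>A\<^esub> y" "cscale (opposite A) = cscale A"
  "star (opposite A) = star A"
  by (simp_all add: opposite_def)

lemma opposite_nrm [simp]: "nrm (opposite A) = nrm A"
  by (simp add: opposite_def)

lemma opposite_minus [simp]: "x \<ominus>\<^bsub>opposite A\<^esub> y = x \<ominus>\<^bsub>A\<^esub> y"
  by (simp add: opposite_def a_minus_def a_inv_def)

lemma opposite_finsum [simp]: "finsum (opposite A) = finsum A"
  by (simp add: opposite_def finsum_def)

lemma (in cstar_algebra) opposite_cstar_algebra: "cstar_algebra (opposite A)"
proof -
  have ag: "abelian_group (opposite A)"
    by (rule abelian_groupI) (auto simp: a_ac intro: l_neg)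
  have "monoid (opposite A)"
    by (rule monoidI) (simp_all add: m_assoc)
  then have rg: "ring (opposite A)"
    by (rule ringI [OF ag]) (simp_all add: l_distr r_distr)
  interpret op: star_algebra "opposite A"
    by (intro star_algebra.intro rg)
       (unfold_locales, simp_all add: cscale_add_right cscale_add_left cscale_cscale cscale_mult_left
         cscale_mult_right star_add star_cscale star_mult)
  show ?thesis
  proof
    \<comment> \<open>The C*-identity of the opposite algebra has the factors in the other order,
      hence the identity of \<open>A\<close> at \<open>star A x\<close> and the isometry of the
      involution.\<close>
    have "nrm A (x \<otimes> star A x) = (nrm A x)\<^sup>2" if "x \<in> carrier A" for x
      using p_cstar [of "star A x"] that by simp
    moreover have "nrm A (y \<otimes> x) \<le> nrm A x * nrm A y" if "x \<in> carrier A" "y \<in> carrier A" for x y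
      using p_mult [OF that(2,1)] by (simp add: mult.commute)
    ultimately show "cstar_seminorm (opposite A) (nrm (opposite A))"
      by (simp add: cstar_seminorm_def p_triangle p_cscale)
  next
    fix s
    assume "seminorm_Cauchy (opposite A) (nrm (opposite A)) s"
    then have "seminorm_Cauchy A (nrm A) s"
      by (simp add: seminorm_Cauchy_def)
    from nrm_complete [OF this]
    show "\<exists>x\<in>carrier (opposite A). (\<lambda>k. nrm (opposite A) (s k \<ominus>\<^bsub>opposite A\<^esub> x)) \<longlonglongrightarrow> 0"
      by simp
  qed (simp add: nrm_definite)
qed

section \<open>Tensor products and magic unitaries\<close>

lemma (in abelian_monoid) finsum_swap:
  assumes "finite I" "finite J" "\<And>i j. \<lbrakk>i \<in> I; j \<in> J\<rbrakk> \<Longrightarrow> f i j \<in> carrier G"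
  shows "(\<Oplus>i\<in>I. \<Oplus>j\<in>J. f i j) = (\<Oplus>j\<in>J. \<Oplus>i\<in>I. f i j)"
  using assms(1,3)
proof (induction I)
  case empty
  then show ?case
    using assms(2) by simp
next
  case (insert i I)
  have "(\<Oplus>j\<in>J. \<Oplus>i'\<in>insert i I. f i' j) = (\<Oplus>j\<in>J. f i j \<oplus> (\<Oplus>i\<in>I. f i j))"
    using insert by (intro finsum_cong') auto
  also have "\<dots> = (\<Oplus>j\<in>J. f i j) \<oplus> (\<Oplus>j\<in>J. \<Oplus>i\<in>I. f i j)"
    using insert by (intro finsum_addf) auto
  finally show ?case
    using insert by (auto simp: Pi_def)
qed

locale cstar_algebra_pair = A: cstar_algebra A + B: cstar_algebra B
  for A :: "('a, 'm) cstar_scheme" and B :: "('b, 'l) cstar_scheme"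
begin

sublocale P: star_monoid "A \<times>\<times> B" "map_prod (star A) (star B)"
proof -
  interpret monoid "A \<times>\<times> B"
    by (intro DirProd_monoid A.is_monoid B.is_monoid)
  show "star_monoid (A \<times>\<times> B) (map_prod (star A) (star B))"
    by unfold_locales (auto simp: DirProd_def A.star_mult B.star_mult)
qed

abbreviation "PA \<equiv> pair_star_algebra A B"
abbreviation "BR \<equiv> bilinearity_relators A B"
abbreviation "pr a b \<equiv> mon (a, b) (1 :: complex)"

lemma DirProd_simps:
  "carrier (A \<times>\<times> B) = carrier A \<times> carrier B"
  "(a, b) \<otimes>\<^bsub>A \<times>\<times> B\<^esub> (a', b') = (a \<otimes>\<^bsub>A\<^esub> a', b \<otimes>\<^bsub>B\<^esub> b')"
  "\<one>\<^bsub>A \<times>\<times> B\<^esub> = (\<one>\<^bsub>A\<^esub>, \<one>\<^bsub>B\<^esub>)"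
  by (simp_all add: DirProd_def)

lemma PA_MA: "PA = P.MA"
  by (simp add: pair_star_algebra_def)

lemma single_PA: "\<lbrakk>a \<in> carrier A; b \<in> carrier B\<rbrakk> \<Longrightarrow> mon (a, b) c \<in> carrier PA"
  by (simp add: PA_MA DirProd_simps)

lemma pr_mult: "pr a b \<otimes>\<^bsub>PA\<^esub> pr a' b' = pr (a \<otimes>\<^bsub>A\<^esub> a') (b \<otimes>\<^bsub>B\<^esub> b')"
  by (simp add: PA_MA DirProd_simps)

lemma pr_star: "star PA (pr a b) = pr (star A a) (star B b)"
  by (simp add: PA_MA)

lemma bilinearity_relators_closed: "r \<in> BR \<Longrightarrow> r \<in> carrier PA"
  unfolding bilinearity_relators_def Let_def
  by (elim UnE; clarsimp simp: PA_MA; intro P.MA_diff_closed P.MA_single_closed; simp add: DirProd_simps)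

lemma seminorm_relator_eq:
  assumes p: "cstar_seminorm PA p" "\<And>r. r \<in> BR \<Longrightarrow> p r = 0"
    and xy: "x - y \<in> BR" "x \<in> carrier PA" "y \<in> carrier PA"
  shows "p x = p y"
proof -
  interpret p: cstar_seminormed PA p
    unfolding PA_MA by unfold_locales (use p in \<open>simp add: PA_MA\<close>)
  have "x \<ominus>\<^bsub>PA\<^esub> y = x - y"
    using xy by (simp add: PA_MA P.MA_minus)
  then show ?thesis
    using p.p_abs_diff [OF xy(2,3)] p(2) [OF xy(1)] by simp
qed

lemma
  assumes "a \<in> carrier A" "b \<in> carrier B"
  shows relator_add_left: "a' \<in> carrier A \<Longrightarrow> pr (a \<oplus>\<^bsub>A\<^esub> a') b - (pr a b + pr a' b) \<in> BR"
    and relator_add_right: "b' \<in> carrier B \<Longrightarrow> pr a (b \<oplus>\<^bsub>B\<^esub> b') - (pr a b + pr a b') \<in> BR"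
    and relator_cscale_left: "pr (cscale A c a) b - mon (a, b) c \<in> BR"
    and relator_cscale_right: "pr a (cscale B c b) - mon (a, b) c \<in> BR"
  using assms unfolding bilinearity_relators_def Let_def diff_diff_eq [symmetric] by blast+

text \<open>Vanishing on the relators makes \<open>p\<close> additive and homogeneous enough along
  each leg that \<open>p (pr a \<one>)\<close> and \<open>p (pr \<one> b)\<close> are C*-seminorms
  in \<open>a\<close> and in \<open>b\<close>, so automatic continuity bounds them by the norms. The
  pair \<open>(a, b)\<close> is the product of \<open>(a, \<one>)\<close> and
  \<open>(\<one>, b)\<close>.\<close>

lemma pair_seminorm_le:
  assumes p: "cstar_seminorm PA p" "\<And>r. r \<in> BR \<Longrightarrow> p r = 0"
    and ab: "a \<in> carrier A" "b \<in> carrier B"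
  shows "p (pr a b) \<le> nrm A a * nrm B b"
proof -
  interpret p: cstar_seminormed PA p
    unfolding PA_MA by unfold_locales (use p in \<open>simp add: PA_MA\<close>)
  have eq: "p x = p y" if "x - y \<in> BR" "x \<in> carrier PA" "y \<in> carrier PA" for x y
    using p that by (rule seminorm_relator_eq)
  have add: "p (x + y) \<le> p x + p y" if "x \<in> carrier PA" "y \<in> carrier PA" for x y
    using p.p_triangle [OF that] by (simp add: PA_MA)
  have sum_closed: "x + y \<in> carrier PA" if "x \<in> carrier PA" "y \<in> carrier PA" for x y
    using that by (simp add: PA_MA)
  have scale: "p (mon (a, b) c) = cmod c * p (pr a b)"
    if "a \<in> carrier A" "b \<in> carrier B" for a b c
    using p.p_cscale [OF single_PA [OF that], of c 1] by (simp add: PA_MA)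
  have "cstar_seminorm A (\<lambda>a. p (pr a \<one>\<^bsub>B\<^esub>))"
    unfolding cstar_seminorm_def
  proof (intro conjI ballI allI)
    fix x c
    assume x: "x \<in> carrier A"
    then show "0 \<le> p (pr x \<one>\<^bsub>B\<^esub>)"
      by (simp add: single_PA)
    show "p (pr (cscale A c x) \<one>\<^bsub>B\<^esub>) = cmod c * p (pr x \<one>\<^bsub>B\<^esub>)"
      using eq [OF relator_cscale_left, of x "\<one>\<^bsub>B\<^esub>" c] scale [of x "\<one>\<^bsub>B\<^esub>" c] x
      by (simp add: single_PA)
    show "p (pr (star A x \<otimes>\<^bsub>A\<^esub> x) \<one>\<^bsub>B\<^esub>) = (p (pr x \<one>\<^bsub>B\<^esub>))\<^sup>2"
      using p.p_cstar [of "pr x \<one>\<^bsub>B\<^esub>"] x by (simp add: single_PA pr_mult pr_star)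
    fix y
    assume y: "y \<in> carrier A"
    show "p (pr (x \<oplus>\<^bsub>A\<^esub> y) \<one>\<^bsub>B\<^esub>) \<le> p (pr x \<one>\<^bsub>B\<^esub>) + p (pr y \<one>\<^bsub>B\<^esub>)"
      using eq [OF relator_add_left, of x "\<one>\<^bsub>B\<^esub>" y] add [of "pr x \<one>\<^bsub>B\<^esub>" "pr y \<one>\<^bsub>B\<^esub>"] x y
      by (simp add: single_PA sum_closed)
    show "p (pr (x \<otimes>\<^bsub>A\<^esub> y) \<one>\<^bsub>B\<^esub>) \<le> p (pr x \<one>\<^bsub>B\<^esub>) * p (pr y \<one>\<^bsub>B\<^esub>)"
      using p.p_mult [of "pr x \<one>\<^bsub>B\<^esub>" "pr y \<one>\<^bsub>B\<^esub>"] x y by (simp add: single_PA pr_mult)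
  qed
  then have a: "p (pr a \<one>\<^bsub>B\<^esub>) \<le> nrm A a"
    using ab(1) by (rule A.cstar_seminorm_le_nrm)
  have "cstar_seminorm B (\<lambda>b. p (pr \<one>\<^bsub>A\<^esub> b))"
    unfolding cstar_seminorm_def
  proof (intro conjI ballI allI)
    fix x c
    assume x: "x \<in> carrier B"
    then show "0 \<le> p (pr \<one>\<^bsub>A\<^esub> x)"
      by (simp add: single_PA)
    show "p (pr \<one>\<^bsub>A\<^esub> (cscale B c x)) = cmod c * p (pr \<one>\<^bsub>A\<^esub> x)"
      using eq [OF relator_cscale_right, of "\<one>\<^bsub>A\<^esub>" x c] scale [of "\<one>\<^bsub>A\<^esub>" x c] x
      by (simp add: single_PA)
    show "p (pr \<one>\<^bsub>A\<^esub> (star B x \<otimes>\<^bsub>B\<^esub> x)) = (p (pr \<one>\<^bsub>A\<^esub> x))\<^sup>2"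
      using p.p_cstar [of "pr \<one>\<^bsub>A\<^esub> x"] x by (simp add: single_PA pr_mult pr_star)
    fix y
    assume y: "y \<in> carrier B"
    show "p (pr \<one>\<^bsub>A\<^esub> (x \<oplus>\<^bsub>B\<^esub> y)) \<le> p (pr \<one>\<^bsub>A\<^esub> x) + p (pr \<one>\<^bsub>A\<^esub> y)"
      using eq [OF relator_add_right, of "\<one>\<^bsub>A\<^esub>" x y] add [of "pr \<one>\<^bsub>A\<^esub> x" "pr \<one>\<^bsub>A\<^esub> y"] x y
      by (simp add: single_PA sum_closed)
    show "p (pr \<one>\<^bsub>A\<^esub> (x \<otimes>\<^bsub>B\<^esub> y)) \<le> p (pr \<one>\<^bsub>A\<^esub> x) * p (pr \<one>\<^bsub>A\<^esub> y)"
      using p.p_mult [of "pr \<one>\<^bsub>A\<^esub> x" "pr \<one>\<^bsub>A\<^esub> y"] x y by (simp add: single_PA pr_mult)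
  qed
  then have b: "p (pr \<one>\<^bsub>A\<^esub> b) \<le> nrm B b"
    using ab(2) by (rule B.cstar_seminorm_le_nrm)
  have "p (pr a b) \<le> p (pr a \<one>\<^bsub>B\<^esub>) * p (pr \<one>\<^bsub>A\<^esub> b)"
    using p.p_mult [of "pr a \<one>\<^bsub>B\<^esub>" "pr \<one>\<^bsub>A\<^esub> b"] ab by (simp add: single_PA pr_mult)
  also have "\<dots> \<le> nrm A a * nrm B b"
    using a b ab by (intro mult_mono) (simp_all add: single_PA)
  finally show ?thesis .
qed

sublocale enveloping PA BR
proof -
  have "star_algebra PA"
    unfolding PA_MA by (rule P.MA_star_algebra)
  moreover have "enveloping_axioms PA BR"
  proof
    fix x
    assume x: "x \<in> carrier PA"
    have "p x \<le> (\<Sum>v\<in>supp x. cmod (coef x v) * (nrm A (fst v) * nrm B (snd v)))"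
      if p: "cstar_seminorm PA p" "\<forall>r\<in>BR. p r = 0" for p
    proof (rule P.MA_seminorm_le)
      show "cstar_seminorm P.MA p" "x \<in> carrier P.MA"
        using p x by (simp_all add: PA_MA)
      fix v
      assume "v \<in> carrier (A \<times>\<times> B)"
      then show "p (mon v 1) \<le> nrm A (fst v) * nrm B (snd v)"
        using pair_seminorm_le [OF p(1), of "fst v" "snd v"] p(2) by (auto simp: DirProd_simps)
    qed
    then show "\<exists>K. \<forall>p. cstar_seminorm PA p \<longrightarrow> (\<forall>r\<in>BR. p r = 0) \<longrightarrow> p x \<le> K"
      by blast
  qed
  ultimately show "enveloping PA BR"
    by (rule enveloping.intro)
qed

abbreviation "T \<equiv> cstar_tensor A B"
abbreviation "tn \<equiv> elem_tensor A B"

lemma tensor_cstar_algebra: "cstar_algebra T"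
  unfolding cstar_tensor_def by (rule enveloping_cstar_algebra)

sublocale T: cstar_algebra T
  by (rule tensor_cstar_algebra)

lemma elem_tensor_hom: "enveloping_class PA BR \<in> cstar_hom PA T"
  unfolding cstar_tensor_def by (rule enveloping_class_hom)

sublocale tn: star_algebra_hom PA T "enveloping_class PA BR"
  by unfold_locales (rule elem_tensor_hom)

lemma tn_eq: "tn a b = enveloping_class PA BR (pr a b)"
  by (simp add: elem_tensor_def)

lemma tn_closed [simp]: "\<lbrakk>a \<in> carrier A; b \<in> carrier B\<rbrakk> \<Longrightarrow> tn a b \<in> carrier T"
  by (simp add: tn_eq single_PA tn.hom_simps(1))

lemma tn_mult:
  "\<lbrakk>a \<in> carrier A; b \<in> carrier B; a' \<in> carrier A; b' \<in> carrier B\<rbrakk>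
    \<Longrightarrow> tn a b \<otimes>\<^bsub>T\<^esub> tn a' b' = tn (a \<otimes>\<^bsub>A\<^esub> a') (b \<otimes>\<^bsub>B\<^esub> b')"
  by (simp add: tn_eq single_PA pr_mult flip: tn.hom_simps(2))

lemma tn_one: "\<one>\<^bsub>T\<^esub> = tn \<one>\<^bsub>A\<^esub> \<one>\<^bsub>B\<^esub>"
  unfolding tn_eq tn.hom_simps(4) [symmetric] by (simp add: PA_MA DirProd_simps)

lemma tn_star: "\<lbrakk>a \<in> carrier A; b \<in> carrier B\<rbrakk> \<Longrightarrow> star T (tn a b) = tn (star A a) (star B b)"
  by (simp add: tn_eq single_PA pr_star flip: tn.hom_simps(6))

lemma enveloping_class_relator_eq:
  assumes "x - y \<in> BR" "x \<in> carrier PA" "y \<in> carrier PA"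
  shows "enveloping_class PA BR x = enveloping_class PA BR y"
proof -
  have "x \<ominus>\<^bsub>PA\<^esub> y = x - y"
    using assms by (simp add: PA_MA P.MA_minus)
  moreover have "enveloping_class PA BR (x - y) = \<zero>\<^bsub>T\<^esub>"
    unfolding cstar_tensor_def
    using assms(1) bilinearity_relators_closed [OF assms(1)] by (rule enveloping_class_relator)
  ultimately have "enveloping_class PA BR x \<ominus>\<^bsub>T\<^esub> enveloping_class PA BR y = \<zero>\<^bsub>T\<^esub>"
    using tn.hom_minus [OF assms(2,3)] by simp
  then show ?thesis
    using assms by (simp add: T.minus_eq_zero_iff tn.hom_simps(1))
qed

lemma PA_simps: "x \<oplus>\<^bsub>PA\<^esub> y = x + y" "cscale PA c (mon v d) = mon v (c * d)"
  by (simp_all add: PA_MA)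

lemma tn_add_left:
  assumes "a \<in> carrier A" "a' \<in> carrier A" "b \<in> carrier B"
  shows "tn (a \<oplus>\<^bsub>A\<^esub> a') b = tn a b \<oplus>\<^bsub>T\<^esub> tn a' b"
  using enveloping_class_relator_eq [OF relator_add_left, of a b a'] assms
    tn.hom_simps(3) [of "pr a b" "pr a' b"] add.m_closed [of "pr a b" "pr a' b"]
  by (simp add: tn_eq single_PA PA_simps)

lemma tn_add_right:
  assumes "a \<in> carrier A" "b \<in> carrier B" "b' \<in> carrier B"
  shows "tn a (b \<oplus>\<^bsub>B\<^esub> b') = tn a b \<oplus>\<^bsub>T\<^esub> tn a b'"
  using enveloping_class_relator_eq [OF relator_add_right, of a b b'] assms
    tn.hom_simps(3) [of "pr a b" "pr a b'"] add.m_closed [of "pr a b" "pr a b'"]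
  by (simp add: tn_eq single_PA PA_simps)

lemma tn_cscale_left:
  assumes "a \<in> carrier A" "b \<in> carrier B"
  shows "tn (cscale A c a) b = cscale T c (tn a b)"
  using enveloping_class_relator_eq [OF relator_cscale_left, of a b c] assms
    tn.hom_simps(5) [of "pr a b" c]
  by (simp add: tn_eq single_PA PA_simps)

lemma tn_cscale_right:
  assumes "a \<in> carrier A" "b \<in> carrier B"
  shows "tn a (cscale B c b) = cscale T c (tn a b)"
  using enveloping_class_relator_eq [OF relator_cscale_right, of a b c] assms
    tn.hom_simps(5) [of "pr a b" c]
  by (simp add: tn_eq single_PA PA_simps)

text \<open>The two legs carry magic unitaries over \<open>A\<close> and over \<open>B\<close> to
  magic unitaries over \<open>T\<close> that commute with each other, which is the input of the
  convolution below.\<close>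

lemma tn_left_hom: "(\<lambda>a. tn a \<one>\<^bsub>B\<^esub>) \<in> cstar_hom A T"
  by (rule cstar_homI) (simp_all add: tn_mult tn_one tn_star tn_add_left tn_cscale_left)

lemma tn_right_hom: "(\<lambda>b. tn \<one>\<^bsub>A\<^esub> b) \<in> cstar_hom B T"
  by (rule cstar_homI) (simp_all add: tn_mult tn_one tn_star tn_add_right tn_cscale_right)

end

section \<open>Magic unitaries: images, transposes and convolution\<close>

lemma magic_unitaryD:
  assumes "magic_unitary A n u" "i \<in> {1..n}" "j \<in> {1..n}"
  shows "u i j \<in> carrier A" "star A (u i j) = u i j" "u i j \<otimes>\<^bsub>A\<^esub> u i j = u i j"
    and "\<lbrakk>k \<in> {1..n}; j \<noteq> k\<rbrakk> \<Longrightarrow> u i j \<otimes>\<^bsub>A\<^esub> u i k = \<zero>\<^bsub>A\<^esub>"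
    and "\<lbrakk>k \<in> {1..n}; i \<noteq> k\<rbrakk> \<Longrightarrow> u i j \<otimes>\<^bsub>A\<^esub> u k j = \<zero>\<^bsub>A\<^esub>"
    and "(\<Oplus>\<^bsub>A\<^esub>l\<in>{1..n}. u i l) = \<one>\<^bsub>A\<^esub>" "(\<Oplus>\<^bsub>A\<^esub>l\<in>{1..n}. u l j) = \<one>\<^bsub>A\<^esub>"
  using assms unfolding magic_unitary_def by blast+

lemma (in star_algebra_hom) magic_unitary_hom:
  assumes u: "magic_unitary A n u"
  shows "magic_unitary B n (\<lambda>i j. f (u i j))"
proof -
  note m = magic_unitaryD [OF u]
  have fs: "(\<Oplus>\<^bsub>B\<^esub>j\<in>{1..n}. f (u i j)) = \<one>\<^bsub>B\<^esub>" "(\<Oplus>\<^bsub>B\<^esub>j\<in>{1..n}. f (u j i)) = \<one>\<^bsub>B\<^esub>"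
    if "i \<in> {1..n}" for i
    using that m hom_finsum [of "{1..n}" "\<lambda>j. u i j"] hom_finsum [of "{1..n}" "\<lambda>j. u j i"] hom_simps(4)
    by (auto simp: Pi_def)
  show ?thesis
    unfolding magic_unitary_def
    using m fs by (auto simp: hom_zero hom_simps(1) simp flip: hom_simps(2) hom_simps(6))
qed

text \<open>Prepares the antipode. Transposition exchanges rows and columns, and reversing a product
  only exchanges the two indices of an orthogonality relation.\<close>

lemma magic_unitary_opposite:
  assumes "magic_unitary A n u"
  shows "magic_unitary (opposite A) n (\<lambda>i j. u j i)"
  using magic_unitaryD [OF assms] unfolding magic_unitary_def by auto

text \<open>The comultiplication in abstract form. All relations concern two entries in a common row
  or column, and for those the double sum in a product collapses to its diagonal
  (\<open>prod_v\<close>).\<close>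

lemma (in star_algebra) magic_unitary_convolution:
  assumes e: "magic_unitary A n e" and f: "magic_unitary A n f"
    and comm: "\<And>i j k l. \<lbrakk>i \<in> {1..n}; j \<in> {1..n}; k \<in> {1..n}; l \<in> {1..n}\<rbrakk>
      \<Longrightarrow> e i j \<otimes> f k l = f k l \<otimes> e i j"
  shows "magic_unitary A n (\<lambda>i j. \<Oplus>k\<in>{1..n}. e i k \<otimes> f k j)"
proof -
  note E = magic_unitaryD [OF e] and F = magic_unitaryD [OF f]
  define v where "v i j = (\<Oplus>k\<in>{1..n}. e i k \<otimes> f k j)" for i j
  have vc: "v i j \<in> carrier A" if "i \<in> {1..n}" "j \<in> {1..n}" for i j
    using that E(1) F(1) unfolding v_def by (intro finsum_closed) auto
  have star_v: "star A (v i j) = v i j" if ij: "i \<in> {1..n}" "j \<in> {1..n}" for i j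
  proof -
    have "star A (v i j) = (\<Oplus>k\<in>{1..n}. star A (e i k \<otimes> f k j))"
      unfolding v_def using ij E(1) F(1) by (intro star_finsum) auto
    also have "\<dots> = v i j"
      unfolding v_def using ij E(1,2) F(1,2) comm by (intro finsum_cong') (auto simp: star_mult)
    finally show ?thesis .
  qed
  have prod_v: "v i j \<otimes> v i' j' = (\<Oplus>k\<in>{1..n}. (e i k \<otimes> e i' k) \<otimes> (f k j \<otimes> f k j'))"
    if ij: "i \<in> {1..n}" "j \<in> {1..n}" "i' \<in> {1..n}" "j' \<in> {1..n}" and eq: "i = i' \<or> j = j'" for i j i' j'
  proof -
    have "v i j \<otimes> v i' j' = (\<Oplus>k\<in>{1..n}. e i k \<otimes> f k j \<otimes> v i' j')"
      unfolding v_def [of i j] using ij E(1) F(1) vc by (intro finsum_ldistr) auto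
    also have "\<dots> = (\<Oplus>k\<in>{1..n}. (e i k \<otimes> e i' k) \<otimes> (f k j \<otimes> f k j'))"
    proof (intro finsum_cong' refl)
      show "(\<lambda>k. (e i k \<otimes> e i' k) \<otimes> (f k j \<otimes> f k j')) \<in> {1..n} \<rightarrow> carrier A"
        using ij E(1) F(1) by auto
      fix k
      assume k: "k \<in> {1..n}"
      have "e i k \<otimes> f k j \<otimes> v i' j' = (\<Oplus>l\<in>{1..n}. e i k \<otimes> f k j \<otimes> (e i' l \<otimes> f l j'))"
        unfolding v_def using ij k E(1) F(1) by (intro finsum_rdistr) auto
      also have "\<dots> = (\<Oplus>l\<in>{1..n}. if k = l then (e i l \<otimes> e i' l) \<otimes> (f l j \<otimes> f l j') else \<zero>)"
      proof (intro finsum_cong' refl)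
        show "(\<lambda>l. if k = l then (e i l \<otimes> e i' l) \<otimes> (f l j \<otimes> f l j') else \<zero>) \<in> {1..n} \<rightarrow> carrier A"
          using ij E(1) F(1) by auto
        fix l
        assume l: "l \<in> {1..n}"
        have c: "e i k \<in> carrier A" "f k j \<in> carrier A" "e i' l \<in> carrier A" "f l j' \<in> carrier A"
          using ij k l E(1) F(1) by auto
        have "e i k \<otimes> f k j \<otimes> (e i' l \<otimes> f l j') = e i k \<otimes> (f k j \<otimes> e i' l) \<otimes> f l j'"
          using c by (simp add: m_assoc)
        also have "f k j \<otimes> e i' l = e i' l \<otimes> f k j"
          using comm ij k l by simp
        finally have *: "e i k \<otimes> f k j \<otimes> (e i' l \<otimes> f l j') = (e i k \<otimes> e i' l) \<otimes> (f k j \<otimes> f l j')"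
          using c by (simp add: m_assoc)
        \<comment> \<open>For \<open>k \<noteq> l\<close>: if \<open>i = i'\<close>, two entries of
          row \<open>i\<close> of \<open>e\<close> meet; if \<open>j = j'\<close>, two entries of
          column \<open>j\<close> of \<open>f\<close> meet.\<close>
        have "e i k \<otimes> e i' l = \<zero> \<or> f k j \<otimes> f l j' = \<zero>" if "k \<noteq> l"
          using eq E(4) [of i k l] F(5) [of k j l] ij k l that by auto
        then show "e i k \<otimes> f k j \<otimes> (e i' l \<otimes> f l j')
            = (if k = l then (e i l \<otimes> e i' l) \<otimes> (f l j \<otimes> f l j') else \<zero>)"
          using * c by auto
      qed
      also have "\<dots> = (e i k \<otimes> e i' k) \<otimes> (f k j \<otimes> f k j')"
        using k ij E(1) F(1)
        by (intro finsum_singleton [where f = "\<lambda>l. (e i l \<otimes> e i' l) \<otimes> (f l j \<otimes> f l j')"]) auto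
      finally show "e i k \<otimes> f k j \<otimes> v i' j' = (e i k \<otimes> e i' k) \<otimes> (f k j \<otimes> f k j')" .
    qed
    finally show ?thesis .
  qed
  have idem: "v i j \<otimes> v i j = v i j" if ij: "i \<in> {1..n}" "j \<in> {1..n}" for i j
  proof -
    have "v i j \<otimes> v i j = (\<Oplus>k\<in>{1..n}. (e i k \<otimes> e i k) \<otimes> (f k j \<otimes> f k j))"
      using ij by (simp add: prod_v)
    also have "\<dots> = v i j"
      unfolding v_def using ij E(1,3) F(1,3) by (intro finsum_cong') auto
    finally show ?thesis .
  qed
  have zero: "v i j \<otimes> v i' j' = \<zero>"
    if ij: "i \<in> {1..n}" "j \<in> {1..n}" "i' \<in> {1..n}" "j' \<in> {1..n}"
      and eq: "i = i' \<and> j \<noteq> j' \<or> i \<noteq> i' \<and> j = j'" for i j i' j'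
  proof -
    have "v i j \<otimes> v i' j' = (\<Oplus>k\<in>{1..n}. (e i k \<otimes> e i' k) \<otimes> (f k j \<otimes> f k j'))"
      using ij eq by (intro prod_v) auto
    also have "\<dots> = (\<Oplus>k\<in>{1..n}. \<zero>)"
    proof (intro finsum_cong' refl)
      fix k
      assume k: "k \<in> {1..n}"
      \<comment> \<open>On the diagonal the roles are exchanged: \<open>i \<noteq> i'\<close> is
        killed by column \<open>k\<close> of \<open>e\<close>, and \<open>j \<noteq> j'\<close> by
        row \<open>k\<close> of \<open>f\<close>.\<close>
      have "e i k \<otimes> e i' k = \<zero> \<or> f k j \<otimes> f k j' = \<zero>"
        using eq E(5) [of i k i'] F(4) [of k j j'] ij k by auto
      then show "(e i k \<otimes> e i' k) \<otimes> (f k j \<otimes> f k j') = \<zero>"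
        using ij k E(1) F(1) by auto
    qed auto
    finally show ?thesis
      by simp
  qed
  have row: "(\<Oplus>j\<in>{1..n}. v i j) = \<one>" if i: "i \<in> {1..n}" for i
  proof -
    have "(\<Oplus>j\<in>{1..n}. v i j) = (\<Oplus>k\<in>{1..n}. \<Oplus>j\<in>{1..n}. e i k \<otimes> f k j)"
      unfolding v_def using i E(1) F(1) by (intro finsum_swap) auto
    also have "\<dots> = (\<Oplus>k\<in>{1..n}. e i k)"
    proof (intro finsum_cong' refl)
      fix k
      assume k: "k \<in> {1..n}"
      have "(\<Oplus>j\<in>{1..n}. e i k \<otimes> f k j) = e i k \<otimes> (\<Oplus>j\<in>{1..n}. f k j)"
        using i k E(1) F(1) by (intro finsum_rdistr [symmetric]) auto
      then show "(\<Oplus>j\<in>{1..n}. e i k \<otimes> f k j) = e i k"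
        using i k E(1) F(6) [of k k] by simp
    qed (use i E(1) in auto)
    finally show ?thesis
      using E(6) [OF i i] by simp
  qed
  have col: "(\<Oplus>i\<in>{1..n}. v i j) = \<one>" if j: "j \<in> {1..n}" for j
  proof -
    have "(\<Oplus>i\<in>{1..n}. v i j) = (\<Oplus>k\<in>{1..n}. \<Oplus>i\<in>{1..n}. e i k \<otimes> f k j)"
      unfolding v_def using j E(1) F(1) by (intro finsum_swap) auto
    also have "\<dots> = (\<Oplus>k\<in>{1..n}. f k j)"
    proof (intro finsum_cong' refl)
      fix k
      assume k: "k \<in> {1..n}"
      have "(\<Oplus>i\<in>{1..n}. e i k \<otimes> f k j) = (\<Oplus>i\<in>{1..n}. e i k) \<otimes> f k j"
        using j k E(1) F(1) by (intro finsum_ldistr [symmetric]) auto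
      then show "(\<Oplus>i\<in>{1..n}. e i k \<otimes> f k j) = f k j"
        using j k F(1) E(7) [of k k] by simp
    qed (use j F(1) in auto)
    finally show ?thesis
      using F(7) [OF j j] by simp
  qed
  show ?thesis
    unfolding v_def [symmetric] magic_unitary_def
    using vc star_v idem zero row col by auto
qed

lemma (in semiring) finsum_commute:
  assumes "finite I" "f \<in> I \<rightarrow> carrier R" "x \<in> carrier R" "\<And>i. i \<in> I \<Longrightarrow> f i \<otimes> x = x \<otimes> f i"
  shows "finsum R f I \<otimes> x = x \<otimes> finsum R f I"
proof -
  have "finsum R f I \<otimes> x = (\<Oplus>i\<in>I. f i \<otimes> x)"
    using assms by (intro finsum_ldistr) auto
  also have "\<dots> = (\<Oplus>i\<in>I. x \<otimes> f i)"
    using assms by (intro finsum_cong') auto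
  also have "\<dots> = x \<otimes> finsum R f I"
    using assms by (intro finsum_rdistr [symmetric]) auto
  finally show ?thesis .
qed

section \<open>The free algebra on a magic matrix\<close>

text \<open>Names the monoid that occurs as an anonymous record inside
  \<open>free_star_algebra\<close>, so that \<open>star_monoid\<close> can be interpreted for
  it.\<close>

definition words :: "nat \<Rightarrow> ((nat \<times> nat) \<times> bool) list monoid" where
  "words n = \<lparr>carrier = lists (({1..n} \<times> {1..n}) \<times> UNIV), monoid.mult = (@), one = []\<rparr>"

definition word_adj :: "((nat \<times> nat) \<times> bool) list \<Rightarrow> ((nat \<times> nat) \<times> bool) list" where
  "word_adj w = rev (map (\<lambda>(g, b). (g, \<not> b)) w)"

lemma words_simps [simp]:
  "v \<otimes>\<^bsub>words n\<^esub> w = v @ w" "\<one>\<^bsub>words n\<^esub> = []"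
  "[] \<in> carrier (words n)"
  "(((i, j), b) # w) \<in> carrier (words n) \<longleftrightarrow> i \<in> {1..n} \<and> j \<in> {1..n} \<and> w \<in> carrier (words n)"
  "v @ w \<in> carrier (words n) \<longleftrightarrow> v \<in> carrier (words n) \<and> w \<in> carrier (words n)"
  "word_adj [] = []" "word_adj (((i, j), b) # w) = word_adj w @ [((i, j), \<not> b)]"
  "word_adj (v @ w) = word_adj w @ word_adj v"
  by (auto simp: words_def word_adj_def)

lemma words_induct [consumes 1, case_names Nil Cons]:
  assumes "w \<in> carrier (words n)" "P []"
    and "\<And>i j b w. \<lbrakk>i \<in> {1..n}; j \<in> {1..n}; w \<in> carrier (words n); P w\<rbrakk> \<Longrightarrow> P (((i, j), b) # w)"
  shows "P w"
  using assms(1)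
proof (induction w)
  case (Cons x w)
  obtain i j b where "x = ((i, j), b)"
    by (metis prod.exhaust)
  then show ?case
    using Cons assms(3) by simp
qed (rule assms(2))

lemma star_monoid_words: "star_monoid (words n) word_adj"
proof -
  interpret monoid "words n"
    by (rule monoidI) simp_all
  show ?thesis
  proof
    fix w
    assume w: "w \<in> carrier (words n)"
    from w show "word_adj w \<in> carrier (words n)"
      by (induction w rule: words_induct) simp_all
    from w show "word_adj (word_adj w) = w"
      by (induction w rule: words_induct) simp_all
  qed simp
qed

context
  fixes n :: nat
begin

interpretation W: star_monoid "words n" word_adj
  by (rule star_monoid_words)

abbreviation "MF \<equiv> magic_free n"

lemma magic_free_eq: "MF = W.MA"
  by (simp add: magic_free_def free_star_algebra_def words_def word_adj_def [abs_def])

lemma magic_free_star_algebra: "star_algebra MF"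
  unfolding magic_free_eq by (rule W.MA_star_algebra)

lemma magic_free_simps:
  "f \<oplus>\<^bsub>MF\<^esub> g = f + g" "\<zero>\<^bsub>MF\<^esub> = 0" "\<one>\<^bsub>MF\<^esub> = mon [] 1"
  "mon v c \<otimes>\<^bsub>MF\<^esub> mon w d = mon (v @ w) (c * d)"
  "cscale MF c (mon v d) = mon v (c * d)"
  "star MF (mon v c) = mon (word_adj v) (cnj c)"
  by (simp_all add: magic_free_eq)

lemma magic_free_minus: "\<lbrakk>f \<in> carrier MF; g \<in> carrier MF\<rbrakk> \<Longrightarrow> f \<ominus>\<^bsub>MF\<^esub> g = f - g"
  by (simp add: magic_free_eq W.MA_minus)

lemma magic_free_sum_closed: "(\<And>i. i \<in> I \<Longrightarrow> f i \<in> carrier MF) \<Longrightarrow> sum f I \<in> carrier MF"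
  by (simp add: magic_free_eq)

lemma single_magic_free:
  "w \<in> carrier (words n) \<Longrightarrow> mon w c \<in> carrier MF"
  by (simp add: magic_free_eq)

lemma magic_var_closed: "\<lbrakk>i \<in> {1..n}; j \<in> {1..n}\<rbrakk> \<Longrightarrow> magic_var i j \<in> carrier MF"
  unfolding magic_var_def by (intro single_magic_free) auto

text \<open>Generation by the variables, with the clauses of \<open>generated_star_algebra\<close>.
  Letters flagged \<open>True\<close> enter as adjoints of variables.\<close>

lemma magic_free_induct [consumes 1, case_names one var star mult cscale add]:
  assumes f: "f \<in> carrier MF"
    and one: "P \<one>\<^bsub>MF\<^esub>"
    and var: "\<And>i j. \<lbrakk>i \<in> {1..n}; j \<in> {1..n}\<rbrakk> \<Longrightarrow> P (magic_var i j)"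
    and star: "\<And>f. \<lbrakk>f \<in> carrier MF; P f\<rbrakk> \<Longrightarrow> P (star MF f)"
    and mult: "\<And>f g. \<lbrakk>f \<in> carrier MF; g \<in> carrier MF; P f; P g\<rbrakk> \<Longrightarrow> P (f \<otimes>\<^bsub>MF\<^esub> g)"
    and cscale: "\<And>f c. \<lbrakk>f \<in> carrier MF; P f\<rbrakk> \<Longrightarrow> P (cscale MF c f)"
    and add: "\<And>f g. \<lbrakk>f \<in> carrier MF; g \<in> carrier MF; P f; P g\<rbrakk> \<Longrightarrow> P (f \<oplus>\<^bsub>MF\<^esub> g)"
  shows "P f"
  using f unfolding magic_free_eq
proof (induction f rule: W.MA_induct)
  case (single w c)
  from single have "P (mon w 1)"
  proof (induction w rule: words_induct)
    case Nil
    then show ?case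
      using one by (simp add: magic_free_simps)
  next
    case (Cons i j b w)
    note ij = Cons(1,2)
    define x where x: "x = ((i, j), b)"
    have "P (mon [x] 1)"
    proof (cases b)
      case True
      then have "mon [x] 1 = star MF (magic_var i j)"
        by (simp add: x magic_var_def magic_free_simps)
      then show ?thesis
        using star [OF magic_var_closed [OF ij] var [OF ij]] by simp
    next
      case False
      then show ?thesis
        using var [OF ij] by (simp add: x magic_var_def)
    qed
    then have "P (mon [x] 1 \<otimes>\<^bsub>MF\<^esub> mon w 1)"
      using Cons by (intro mult single_magic_free) (simp_all add: x)
    then show ?case
      by (simp add: magic_free_simps x)
  qed
  then have "P (cscale MF c (mon w 1))"
    using single by (intro cscale single_magic_free) simp_all
  then show ?case
    by (simp add: magic_free_simps)
next
  case (add f g)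
  then show ?case
    using assms(7) [of f g] by (simp add: magic_free_eq)
qed

lemma magic_free_hom_eq:
  assumes "f \<in> cstar_hom MF C" "g \<in> cstar_hom MF C"
    and "\<And>i j. \<lbrakk>i \<in> {1..n}; j \<in> {1..n}\<rbrakk> \<Longrightarrow> f (magic_var i j) = g (magic_var i j)"
    and "x \<in> carrier MF"
  shows "f x = g x"
  using assms(4)
  by (induction x rule: magic_free_induct)
     (simp_all add: assms(3) cstar_homD [OF assms(1)] cstar_homD [OF assms(2)])

lemma magic_free_extend:
  assumes C: "star_algebra C"
    and v: "\<And>i j. \<lbrakk>i \<in> {1..n}; j \<in> {1..n}\<rbrakk> \<Longrightarrow> v i j \<in> carrier C \<and> star C (v i j) = v i j"
  shows "\<exists>f\<in>cstar_hom MF C. \<forall>i\<in>{1..n}. \<forall>j\<in>{1..n}. f (magic_var i j) = v i j"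
proof -
  interpret C: star_algebra C
    by (rule C)
  \<comment> \<open>The flag of a letter is ignored. This is compatible with the involution because
    each \<open>v i j\<close> is selfadjoint.\<close>
  define h where "h w = foldr (\<lambda>((i, j), b :: bool) y. v i j \<otimes>\<^bsub>C\<^esub> y) w \<one>\<^bsub>C\<^esub>" for w
  let ?L = "carrier (words n)"
  have closed: "h w \<in> carrier C" if "w \<in> ?L" for w
    using that by (induction w rule: words_induct) (simp_all add: h_def v del: atLeastAtMost_iff)
  have app: "h (w @ w') = h w \<otimes>\<^bsub>C\<^esub> h w'" if "w \<in> ?L" "w' \<in> ?L" for w w'
    using that(1)
  proof (induction w rule: words_induct)
    case Nil
    then show ?case
      using closed [OF that(2)] by (simp add: h_def)
  next
    case (Cons i j b w)
    then show ?case
      using closed [OF Cons(3)] closed [OF that(2)] v [OF Cons(1,2)] by (simp add: h_def C.m_assoc)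
  qed
  have adj: "h (word_adj w) = star C (h w)" if "w \<in> ?L" for w
    using that
  proof (induction w rule: words_induct)
    case Nil
    then show ?case
      by (simp add: h_def)
  next
    case (Cons i j b w)
    note ij = v [OF Cons(1,2)]
    have "h (word_adj (((i, j), b) # w)) = star C (h w) \<otimes>\<^bsub>C\<^esub> v i j"
      using app [of "word_adj w" "[((i, j), \<not> b)]"] Cons ij by (simp add: h_def)
    also have "\<dots> = star C (v i j \<otimes>\<^bsub>C\<^esub> h w)"
      using closed [OF Cons(3)] ij by (simp add: C.star_mult)
    finally show ?case
      by (simp add: h_def)
  qed
  have "\<exists>f\<in>cstar_hom MF C. \<forall>w\<in>?L. f (mon w 1) = h w"
    using W.MA_extend_hom [OF C, of h] closed app adj unfolding magic_free_eq
    by (simp add: h_def)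
  then obtain f where f: "f \<in> cstar_hom MF C" "\<And>w. w \<in> ?L \<Longrightarrow> f (mon w 1) = h w"
    by blast
  have "f (magic_var i j) = v i j" if "i \<in> {1..n}" "j \<in> {1..n}" for i j
    using that f(2) [of "[((i, j), False)]"] v by (simp add: magic_var_def h_def)
  then show ?thesis
    using f(1) by blast
qed

lemma magic_relators_closed: "r \<in> magic_relators n \<Longrightarrow> r \<in> carrier MF"
proof -
  interpret MF: star_algebra MF
    by (rule magic_free_star_algebra)
  have d: "f - g \<in> carrier MF" if "f \<in> carrier MF" "g \<in> carrier MF" for f g
    using MF.minus_closed [OF that] magic_free_minus [OF that] by simp
  show "r \<in> magic_relators n \<Longrightarrow> r \<in> carrier MF"
    unfolding magic_relators_def Let_def
    by (elim UnE; clarify; intro d MF.m_closed MF.star_closed MF.one_closed magic_var_closed magic_free_sum_closed; simp)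
qed

lemma hom_sum_magic_var:
  assumes C: "star_algebra C" and f: "f \<in> cstar_hom MF C"
    and "finite I" "\<And>i. i \<in> I \<Longrightarrow> g i \<in> carrier MF"
  shows "f (sum g I) = (\<Oplus>\<^bsub>C\<^esub>i\<in>I. f (g i))"
proof -
  interpret star_algebra_hom MF C f
    by (simp add: star_algebra_hom_def star_algebra_hom_axioms_def magic_free_star_algebra C f)
  show ?thesis
    using assms(3,4)
  proof (induction I)
    case empty
    then show ?case
      using hom_zero by (simp add: magic_free_simps)
  next
    case (insert i I)
    then have "f (g i + sum g I) = f (g i) \<oplus>\<^bsub>C\<^esub> f (sum g I)"
      using hom_simps(3) [of "g i" "sum g I"] magic_free_sum_closed [of I g] by (simp add: magic_free_simps)
    then show ?case
      using insert hom_simps(1) by (auto simp: Pi_def)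
  qed
qed

text \<open>Dictionary between relators and the clauses of \<open>magic_unitary\<close>. From left
  to right it shows that the generators of a presented algebra form a magic unitary, from right to
  left that a map given by a magic unitary kills the relators.\<close>

lemma magic_relators_iff:
  assumes C: "star_algebra C" and f: "f \<in> cstar_hom MF C"
  shows "(\<forall>r\<in>magic_relators n. f r = \<zero>\<^bsub>C\<^esub>) \<longleftrightarrow> magic_unitary C n (\<lambda>i j. f (magic_var i j))"
proof -
  interpret star_algebra_hom MF C f
    by (simp add: star_algebra_hom_def star_algebra_hom_axioms_def magic_free_star_algebra C f)
  let ?I = "{1..n}" and ?x = magic_var
  note x = magic_var_closed
  have d: "f (a - b) = \<zero>\<^bsub>C\<^esub> \<longleftrightarrow> f a = f b" if "a \<in> carrier MF" "b \<in> carrier MF" for a b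
    using hom_minus [OF that] magic_free_minus [OF that] that
    by (simp add: B.minus_eq_zero_iff hom_simps(1))
  have 1: "f (?x i j - star MF (?x i j)) = \<zero>\<^bsub>C\<^esub> \<longleftrightarrow> star C (f (?x i j)) = f (?x i j)"
    and 2: "f (?x i j \<otimes>\<^bsub>MF\<^esub> ?x i j - ?x i j) = \<zero>\<^bsub>C\<^esub> \<longleftrightarrow> f (?x i j) \<otimes>\<^bsub>C\<^esub> f (?x i j) = f (?x i j)"
    if "i \<in> ?I" "j \<in> ?I" for i j
    using d x [OF that] hom_simps by (auto; metis)+
  have 3: "f (?x i j \<otimes>\<^bsub>MF\<^esub> ?x k l) = f (?x i j) \<otimes>\<^bsub>C\<^esub> f (?x k l)"
    if "i \<in> ?I" "j \<in> ?I" "k \<in> ?I" "l \<in> ?I" for i j k l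
    using x that by (simp add: hom_simps(2))
  have 4: "f ((\<Sum>j\<in>?I. ?x i j) - \<one>\<^bsub>MF\<^esub>) = \<zero>\<^bsub>C\<^esub> \<longleftrightarrow> (\<Oplus>\<^bsub>C\<^esub>j\<in>?I. f (?x i j)) = \<one>\<^bsub>C\<^esub>"
    and 5: "f ((\<Sum>j\<in>?I. ?x j i) - \<one>\<^bsub>MF\<^esub>) = \<zero>\<^bsub>C\<^esub> \<longleftrightarrow> (\<Oplus>\<^bsub>C\<^esub>j\<in>?I. f (?x j i)) = \<one>\<^bsub>C\<^esub>"
    if "i \<in> ?I" for i
  proof -
    have one: "\<one>\<^bsub>MF\<^esub> \<in> carrier MF"
      by (rule A.one_closed)
    have c: "(\<Sum>j\<in>?I. ?x i j) \<in> carrier MF" "(\<Sum>j\<in>?I. ?x j i) \<in> carrier MF"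
      by (intro magic_free_sum_closed x that; assumption)+
    have s: "f (\<Sum>j\<in>?I. ?x i j) = (\<Oplus>\<^bsub>C\<^esub>j\<in>?I. f (?x i j))"
      "f (\<Sum>j\<in>?I. ?x j i) = (\<Oplus>\<^bsub>C\<^esub>j\<in>?I. f (?x j i))"
      by (rule hom_sum_magic_var [OF C f finite_atLeastAtMost]; intro x that; assumption)+
    show "f ((\<Sum>j\<in>?I. ?x i j) - \<one>\<^bsub>MF\<^esub>) = \<zero>\<^bsub>C\<^esub> \<longleftrightarrow> (\<Oplus>\<^bsub>C\<^esub>j\<in>?I. f (?x i j)) = \<one>\<^bsub>C\<^esub>"
      and "f ((\<Sum>j\<in>?I. ?x j i) - \<one>\<^bsub>MF\<^esub>) = \<zero>\<^bsub>C\<^esub> \<longleftrightarrow> (\<Oplus>\<^bsub>C\<^esub>j\<in>?I. f (?x j i)) = \<one>\<^bsub>C\<^esub>"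
      unfolding d [OF c(1) one] d [OF c(2) one] s hom_simps(4) by (rule refl)+
  qed
  have "(\<forall>r\<in>magic_relators n. f r = \<zero>\<^bsub>C\<^esub>) \<longleftrightarrow>
      (\<forall>i\<in>?I. \<forall>j\<in>?I. f (?x i j - star MF (?x i j)) = \<zero>\<^bsub>C\<^esub>) \<and>
      (\<forall>i\<in>?I. \<forall>j\<in>?I. f (?x i j \<otimes>\<^bsub>MF\<^esub> ?x i j - ?x i j) = \<zero>\<^bsub>C\<^esub>) \<and>
      (\<forall>i\<in>?I. \<forall>j\<in>?I. \<forall>k\<in>?I. j \<noteq> k \<longrightarrow> f (?x i j \<otimes>\<^bsub>MF\<^esub> ?x i k) = \<zero>\<^bsub>C\<^esub>) \<and>
      (\<forall>i\<in>?I. \<forall>j\<in>?I. \<forall>k\<in>?I. j \<noteq> k \<longrightarrow> f (?x j i \<otimes>\<^bsub>MF\<^esub> ?x k i) = \<zero>\<^bsub>C\<^esub>) \<and>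
      (\<forall>i\<in>?I. f ((\<Sum>j\<in>?I. ?x i j) - \<one>\<^bsub>MF\<^esub>) = \<zero>\<^bsub>C\<^esub>) \<and>
      (\<forall>i\<in>?I. f ((\<Sum>j\<in>?I. ?x j i) - \<one>\<^bsub>MF\<^esub>) = \<zero>\<^bsub>C\<^esub>)"
  proof -
    have b1: "(\<forall>r\<in>{g i | i. i \<in> I}. Q r) \<longleftrightarrow> (\<forall>i\<in>I. Q (g i))" for g Q and I :: "nat set"
      by blast
    have b2: "(\<forall>r\<in>{g i j | i j. i \<in> I \<and> j \<in> I}. Q r) \<longleftrightarrow> (\<forall>i\<in>I. \<forall>j\<in>I. Q (g i j))" for g Q and I :: "nat set"
      by blast
    have b3: "(\<forall>r\<in>{g i j k | i j k. i \<in> I \<and> j \<in> I \<and> k \<in> I \<and> j \<noteq> k}. Q r)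
        \<longleftrightarrow> (\<forall>i\<in>I. \<forall>j\<in>I. \<forall>k\<in>I. j \<noteq> k \<longrightarrow> Q (g i j k))" for g Q and I :: "nat set"
      by blast
    show ?thesis
      unfolding magic_relators_def Let_def ball_Un b1 b2 b3 conj_assoc by (rule refl)
  qed
  also have "\<dots> \<longleftrightarrow> magic_unitary C n (\<lambda>i j. f (?x i j))"
    unfolding magic_unitary_def
    by (simp only: 1 2 3 4 5 x hom_simps(1) ball_conj_distrib all_conj_distrib imp_conjR conj_assoc
        simp_thms cong: ball_cong)
  finally show ?thesis .
qed

text \<open>Up to seminorm zero a variable \<open>y\<close> is a projection, so
  \<open>p y * p y = p (star y y) \<le> p (y y) = p y\<close> and \<open>p y \<le> 1\<close>. Words
  follow by submultiplicativity.\<close>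

lemma magic_word_seminorm_le:
  assumes p: "cstar_seminorm MF p" "\<And>r. r \<in> magic_relators n \<Longrightarrow> p r = 0"
    and w: "w \<in> carrier (words n)"
  shows "p (mon w 1) \<le> 1"
proof -
  interpret MF: star_algebra MF
    by (rule magic_free_star_algebra)
  interpret p: cstar_seminormed MF p
    by unfold_locales (rule p(1))
  have eq: "p a = p b" if "a - b \<in> magic_relators n" "a \<in> carrier MF" "b \<in> carrier MF" for a b
    using p.p_abs_diff [OF that(2,3)] p(2) [OF that(1)] magic_free_minus [OF that(2,3)] by simp
  show ?thesis
    using w
  proof (induction w rule: words_induct)
    case Nil
    then show ?case
      using p.p_one_le by (simp add: magic_free_simps)
  next
    case (Cons i j b w)
    note ij = Cons(1,2)
    define x where x: "x = ((i, j), b)"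
    let ?y = "magic_var i j"
    have y: "?y \<in> carrier MF"
      using ij by (rule magic_var_closed)
    have "?y - star MF ?y \<in> magic_relators n" "?y \<otimes>\<^bsub>MF\<^esub> ?y - ?y \<in> magic_relators n"
      using ij unfolding magic_relators_def Let_def by blast+
    then have yy: "p (?y \<otimes>\<^bsub>MF\<^esub> ?y) = p ?y" and z: "p (?y - star MF ?y) = 0"
      using eq [of "?y \<otimes>\<^bsub>MF\<^esub> ?y" ?y] y p(2) by auto
    have "p (star MF ?y \<otimes>\<^bsub>MF\<^esub> ?y \<ominus>\<^bsub>MF\<^esub> ?y \<otimes>\<^bsub>MF\<^esub> ?y) \<le> p (star MF ?y \<ominus>\<^bsub>MF\<^esub> ?y) * p ?y + p ?y * p (?y \<ominus>\<^bsub>MF\<^esub> ?y)"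
      using y by (intro p.p_mult_minus) auto
    also have "\<dots> = 0"
      using z y p.p_minus_commute [of "star MF ?y" ?y] by (simp add: magic_free_minus)
    finally have "p (star MF ?y \<otimes>\<^bsub>MF\<^esub> ?y) \<le> p (?y \<otimes>\<^bsub>MF\<^esub> ?y)"
      using p.p_abs_diff [of "star MF ?y \<otimes>\<^bsub>MF\<^esub> ?y" "?y \<otimes>\<^bsub>MF\<^esub> ?y"] y by simp
    then have le: "p ?y * p ?y \<le> p ?y"
      using y yy by (simp add: p.p_cstar power2_eq_square)
    have py: "p ?y \<le> 1"
    proof (rule ccontr)
      assume "\<not> p ?y \<le> 1"
      then have "p ?y * 1 < p ?y * p ?y"
        by (intro mult_strict_left_mono) auto
      then show False
        using le by simp
    qed
    have "mon [x] 1 = (if b then star MF ?y else ?y)"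
      by (simp add: x magic_var_def magic_free_simps)
    then have px: "p (mon [x] 1) \<le> 1"
      using py y by simp
    have sx: "mon [x] 1 \<in> carrier MF" "mon w 1 \<in> carrier MF"
      using Cons by (auto intro!: single_magic_free simp: x)
    have "p (mon (((i, j), b) # w) 1) = p (mon [x] 1 \<otimes>\<^bsub>MF\<^esub> mon w 1)"
      by (simp add: magic_free_simps x)
    also have "\<dots> \<le> p (mon [x] 1) * p (mon w 1)"
      by (rule p.p_mult [OF sx])
    also have "\<dots> \<le> 1"
      using px Cons sx by (intro mult_le_one) auto
    finally show ?case .
  qed
qed

text \<open>More relators leave fewer seminorms, so the bound for the magic relators serves every
  larger set, in particular the one with commutators.\<close>

lemma magic_enveloping:
  assumes R: "magic_relators n \<subseteq> R"
  shows "enveloping MF R"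
proof -
  have "enveloping_axioms MF R"
  proof
    fix x
    assume x: "x \<in> carrier MF"
    have "p x \<le> (\<Sum>v\<in>supp x. cmod (coef x v) * 1)"
      if p: "cstar_seminorm MF p" "\<forall>r\<in>R. p r = 0" for p
    proof (rule W.MA_seminorm_le)
      show "cstar_seminorm W.MA p" "x \<in> carrier W.MA"
        using p x by (simp_all add: magic_free_eq)
      show "p (mon v 1) \<le> 1"
        if "v \<in> carrier (words n)" for v
        using magic_word_seminorm_le [OF p(1) _ that] p(2) R by blast
    qed
    then show "\<exists>K. \<forall>p. cstar_seminorm MF p \<longrightarrow> (\<forall>r\<in>R. p r = 0) \<longrightarrow> p x \<le> K"
      by blast
  qed
  then show ?thesis
    by (intro enveloping.intro magic_free_star_algebra)
qed

end

section \<open>Algebras presented by magic relations\<close>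

text \<open>Contractivity, which carries the equality from \<open>D\<close> to its closure, comes
  from automatic continuity applied to the pulled back norms.\<close>

lemma cstar_hom_eq_if_eq_on_dense:
  assumes A: "cstar_algebra A" and C: "cstar_algebra C"
    and f: "f \<in> cstar_hom A C" and g: "g \<in> cstar_hom A C"
    and D: "dense_in A D" "D \<subseteq> carrier A" and eq: "\<And>x. x \<in> D \<Longrightarrow> f x = g x" and x: "x \<in> carrier A"
  shows "f x = g x"
proof -
  interpret A: cstar_algebra A by (rule A)
  interpret C: cstar_algebra C by (rule C)
  interpret f: star_algebra_hom A C f by unfold_locales (rule f)
  interpret g: star_algebra_hom A C g by unfold_locales (rule g)
  note c = f.hom_simps(1) g.hom_simps(1)
  have f_le: "nrm C (f y) \<le> nrm A y" and g_le: "nrm C (g y) \<le> nrm A y" if "y \<in> carrier A" for y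
    using A.cstar_seminorm_le_nrm [OF f.seminorm_pullback [OF C.nrm_cstar] that]
      A.cstar_seminorm_le_nrm [OF g.seminorm_pullback [OF C.nrm_cstar] that] by simp_all
  have "nrm C (f x \<ominus>\<^bsub>C\<^esub> g x) \<le> 0 + e" if e: "e > 0" for e
  proof -
    obtain y where y: "y \<in> D" "nrm A (x \<ominus>\<^bsub>A\<^esub> y) < e / 2"
      using D(1) x e unfolding dense_in_def by (metis half_gt_zero)
    have yc: "y \<in> carrier A"
      using y D(2) by blast
    have "nrm C (f x \<ominus>\<^bsub>C\<^esub> g x) \<le> nrm C (f x \<ominus>\<^bsub>C\<^esub> f y) + nrm C (g y \<ominus>\<^bsub>C\<^esub> g x)"
      using C.p_minus_triangle [of "f x" "f y" "g x"] c x yc eq [OF y(1)] by simp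
    also have "\<dots> \<le> nrm A (x \<ominus>\<^bsub>A\<^esub> y) + nrm A (y \<ominus>\<^bsub>A\<^esub> x)"
      using f_le [of "x \<ominus>\<^bsub>A\<^esub> y"] g_le [of "y \<ominus>\<^bsub>A\<^esub> x"] x yc by (simp add: f.hom_minus g.hom_minus)
    also have "\<dots> \<le> 0 + e"
      using y(2) A.p_minus_commute [OF x yc] by simp
    finally show ?thesis .
  qed
  then have "nrm C (f x \<ominus>\<^bsub>C\<^esub> g x) \<le> 0"
    by (rule field_le_epsilon)
  then have "nrm C (f x \<ominus>\<^bsub>C\<^esub> g x) = 0"
    by (intro antisym C.p_nonneg C.minus_closed c x)
  then have "f x \<ominus>\<^bsub>C\<^esub> g x = \<zero>\<^bsub>C\<^esub>"
    using c x by (intro C.nrm_definite) auto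
  then show ?thesis
    using c x C.minus_eq_zero_iff by simp
qed

lemma (in cstar_algebra) dense_commute:
  assumes D: "dense_in A D" "D \<subseteq> carrier A" and comm: "\<And>x y. \<lbrakk>x \<in> D; y \<in> D\<rbrakk> \<Longrightarrow> x \<otimes> y = y \<otimes> x"
    and x: "x \<in> carrier A" and y: "y \<in> carrier A"
  shows "x \<otimes> y = y \<otimes> x"
proof -
  have appr: "\<exists>s. range s \<subseteq> D \<and> null_diff s (\<lambda>k. z)" if z: "z \<in> carrier A" for z
  proof -
    have "\<exists>y\<in>D. nrm A (z \<ominus> y) < inverse (real (Suc k))" for k
      using D(1) z unfolding dense_in_def by simp
    then obtain s where s: "\<And>k. s k \<in> D" "\<And>k. nrm A (z \<ominus> s k) < inverse (real (Suc k))"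
      by metis
    have "null_diff s (\<lambda>k. z)"
    proof (rule null_diff_squeeze)
      show "nrm A (s k \<ominus> z) \<le> inverse (real (Suc k))" for k
        using s [of k] D(2) z p_minus_commute [of z "s k"] by (auto intro: less_imp_le)
    qed (use s D(2) z LIMSEQ_inverse_real_of_nat in auto)
    then show ?thesis
      using s(1) by blast
  qed
  obtain s where s: "range s \<subseteq> D" "null_diff s (\<lambda>k. x)"
    using appr [OF x] by blast
  obtain t where t: "range t \<subseteq> D" "null_diff t (\<lambda>k. y)"
    using appr [OF y] by blast
  note sC = null_diff_const_Cauchy [OF s(2)] and tC = null_diff_const_Cauchy [OF t(2)]
  have "(\<lambda>k. s k \<otimes> t k) = (\<lambda>k. t k \<otimes> s k)"
    using comm s(1) t(1) by (intro ext comm) auto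
  then show ?thesis
    using limit_unique [OF null_diff_mult_Cauchy [OF s(2) t(2) sC tC]]
      null_diff_mult_Cauchy [OF t(2) s(2) tC sC] by simp
qed

lemma (in star_algebra) generated_star_algebra_closed:
  assumes "G \<subseteq> carrier A" "x \<in> generated_star_algebra A G"
  shows "x \<in> carrier A"
  using assms(2) by induction (use assms(1) in auto)

text \<open>The commutant of selfadjoint elements is a *-subalgebra; selfadjointness is what closes
  it under \<open>star\<close>. The argument is made against one generator at first, and then
  against an arbitrary element.\<close>

lemma (in star_algebra) generated_star_algebra_commute:
  assumes G: "G \<subseteq> carrier A" "\<And>g. g \<in> G \<Longrightarrow> star A g = g"
    and comm: "\<And>g h. \<lbrakk>g \<in> G; h \<in> G\<rbrakk> \<Longrightarrow> g \<otimes> h = h \<otimes> g"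
    and x: "x \<in> generated_star_algebra A G" and y: "y \<in> generated_star_algebra A G"
  shows "x \<otimes> y = y \<otimes> x"
proof -
  note cl = generated_star_algebra_closed [OF G(1)]
  have 1: "x \<otimes> g = g \<otimes> x" if "x \<in> generated_star_algebra A G" "g \<in> G" for x g
    using that(1)
  proof induction
    case (mult x y)
    have c: "x \<in> carrier A" "y \<in> carrier A" "g \<in> carrier A"
      using mult cl G that by auto
    have "x \<otimes> y \<otimes> g = x \<otimes> (g \<otimes> y)"
      using mult c by (simp add: m_assoc)
    also have "\<dots> = g \<otimes> (x \<otimes> y)"
      using mult c by (simp flip: m_assoc)
    finally show ?case .
  next
    case (star x)
    have c: "x \<in> carrier A" "g \<in> carrier A" "star A g = g"
      using star cl G that by auto
    have "star A x \<otimes> g = star A (g \<otimes> x)"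
      using c by (simp add: star_mult)
    also have "\<dots> = g \<otimes> star A x"
      using star c by (simp add: star_mult flip: star.IH)
    finally show ?case .
  qed (use comm that G cl in \<open>auto simp: l_distr r_distr cscale_mult_left cscale_mult_right subset_iff\<close>)
  \<comment> \<open>Quantified over all \<open>x\<close> since the \<open>star\<close> case uses its
    hypothesis at \<open>star A x\<close>.\<close>
  have "\<forall>x\<in>generated_star_algebra A G. x \<otimes> y = y \<otimes> x"
    using y
  proof induction
    case (gen g)
    then show ?case
      using 1 by blast
  next
    case (mult y z)
    show ?case
    proof
      fix x
      assume x: "x \<in> generated_star_algebra A G"
      have c: "x \<in> carrier A" "y \<in> carrier A" "z \<in> carrier A" "x \<otimes> y = y \<otimes> x" "x \<otimes> z = z \<otimes> x"
        using mult cl x by auto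
      have "x \<otimes> (y \<otimes> z) = y \<otimes> (x \<otimes> z)"
        using c(1-4) by (simp flip: m_assoc)
      also have "\<dots> = y \<otimes> z \<otimes> x"
        using c by (simp add: m_assoc)
      finally show "x \<otimes> (y \<otimes> z) = y \<otimes> z \<otimes> x" .
    qed
  next
    case (star y)
    show ?case
    proof
      fix x
      assume x: "x \<in> generated_star_algebra A G"
      have "star A (y \<otimes> star A x) = star A (star A x \<otimes> y)"
        using star.IH generated_star_algebra.star [OF x] by simp
      then show "x \<otimes> star A y = star A y \<otimes> x"
        using star x cl by (simp add: star_mult)
    qed
  qed (use cl in \<open>auto simp: l_distr r_distr cscale_mult_left cscale_mult_right\<close>)
  then show ?thesis
    using x by blast
qed

text \<open>Covers \<open>A\<^sub>s n\<close>, where \<open>R\<close> is the set of magic relators,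
  and its commutative counterpart, where commutators are added.\<close>

locale magic_presentation =
  fixes n :: nat and R :: "magic_poly set"
  assumes relators: "magic_relators n \<subseteq> R" and relators_closed: "R \<subseteq> carrier (MF n)"
begin

sublocale enveloping "MF n" R
  by (rule magic_enveloping [OF relators])

abbreviation "E \<equiv> enveloping_cstar (MF n) R"
abbreviation "gen i j \<equiv> enveloping_class (MF n) R (magic_var i j)"
abbreviation "D \<equiv> generated_star_algebra E {gen i j | i j. i \<in> {1..n} \<and> j \<in> {1..n}}"

sublocale E: cstar_algebra E
  by (rule enveloping_cstar_algebra)

sublocale cl: star_algebra_hom "MF n" E "enveloping_class (MF n) R"
  by unfold_locales (rule enveloping_class_hom)

lemma class_relator: "r \<in> R \<Longrightarrow> enveloping_class (MF n) R r = \<zero>\<^bsub>E\<^esub>"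
  using relators_closed by (intro enveloping_class_relator) auto

lemma gen_magic_unitary: "magic_unitary E n gen"
  using magic_relators_iff [OF E.star_algebra_axioms enveloping_class_hom, THEN iffD1] class_relator relators
  by blast

text \<open>Gives every element of \<open>D\<close> a preimage in the free algebra, the form in
  which density and maximality of the norm can be read off.\<close>

lemma generated_eq: "D = enveloping_class (MF n) R ` carrier (MF n)"
proof
  show "D \<subseteq> enveloping_class (MF n) R ` carrier (MF n)"
  proof
    fix x
    assume "x \<in> D"
    then show "x \<in> enveloping_class (MF n) R ` carrier (MF n)"
    proof induction
      case (gen x)
      then show ?case
        using magic_var_closed by blast
    next
      case one
      then show ?case
        by (metis cl.hom_simps(4) one_closed image_eqI)
    next
      case (add x y)
      then show ?case
        by (auto simp flip: cl.hom_simps(3))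
    next
      case (mult x y)
      then show ?case
        by (auto simp flip: cl.hom_simps(2))
    next
      case (cscale x c)
      then show ?case
        by (auto simp flip: cl.hom_simps(5))
    next
      case (star x)
      then show ?case
        by (auto simp flip: cl.hom_simps(6))
    qed
  qed
  show "enveloping_class (MF n) R ` carrier (MF n) \<subseteq> D"
  proof
    fix y
    assume "y \<in> enveloping_class (MF n) R ` carrier (MF n)"
    then obtain x where x: "x \<in> carrier (MF n)" "y = enveloping_class (MF n) R x"
      by blast
    from x(1) have "enveloping_class (MF n) R x \<in> D"
    proof (induction x rule: magic_free_induct)
      case one
      then show ?case
        unfolding cl.hom_simps(4) by (rule generated_star_algebra.one)
    next
      case (var i j)
      then show ?case
        by (intro generated_star_algebra.gen) blast
    next
      case (star f)
      then show ?case
        by (simp only: cl.hom_simps(6)) (rule generated_star_algebra.star)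
    next
      case (mult f g)
      then show ?case
        by (simp only: cl.hom_simps(2)) (rule generated_star_algebra.mult)
    next
      case (cscale f c)
      then show ?case
        by (simp only: cl.hom_simps(5)) (rule generated_star_algebra.cscale)
    next
      case (add f g)
      then show ?case
        by (simp only: cl.hom_simps(3)) (rule generated_star_algebra.add)
    qed
    then show "y \<in> D"
      using x by simp
  qed
qed

lemma generated_dense: "dense_in E D"
  unfolding dense_in_def generated_eq using enveloping_dense by blast

lemma generated_closed: "D \<subseteq> carrier E"
  unfolding generated_eq using cl.hom_simps(1) by blast

text \<open>A presented algebra is automatically full: a C*-seminorm on \<open>D\<close> pulls back
  along the class map to one that kills \<open>R\<close>, and so lies below \<open>\<mu>\<close>,
  which is the norm of \<open>E\<close> on classes.\<close>

lemma is_enveloping_generated: "is_enveloping_of E D"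
  unfolding is_enveloping_of_def
proof (intro conjI allI impI ballI generated_dense generated_closed)
  fix p x
  assume p: "cstar_seminorm (E\<lparr>carrier := D\<rparr>) p" and x: "x \<in> D"
  then obtain f where f: "f \<in> carrier (MF n)" "x = enveloping_class (MF n) R f"
    unfolding generated_eq by blast
  define q where "q f = p (enveloping_class (MF n) R f)" for f
  have c: "enveloping_class (MF n) R g \<in> D" if "g \<in> carrier (MF n)" for g
    unfolding generated_eq using that by blast
  have "cstar_seminorm (MF n) q \<and> p \<zero>\<^bsub>E\<^esub> = 0"
    if S: "cstar_seminorm (E\<lparr>carrier := S\<rparr>) p"
      "\<And>g. g \<in> carrier (MF n) \<Longrightarrow> enveloping_class (MF n) R g \<in> S" for S
  proof
    show "cstar_seminorm (MF n) q"
      using S unfolding cstar_seminorm_def q_def by (simp add: cl.hom_simps(2-6))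
    \<comment> \<open>Relators have class zero, so \<open>q\<close> kills them once \<open>p\<close>
      vanishes at zero; homogeneity with the scalar 0 gives this.\<close>
    have "\<zero>\<^bsub>E\<^esub> \<in> S" "\<forall>c. \<forall>x\<in>S. p (cscale E c x) = cmod c * p x"
      using S(1) S(2) [of "\<zero>\<^bsub>MF n\<^esub>"] unfolding cstar_seminorm_def by (simp_all add: cl.hom_zero)
    then have "p (cscale E 0 \<zero>\<^bsub>E\<^esub>) = cmod 0 * p \<zero>\<^bsub>E\<^esub>"
      by blast
    then show "p \<zero>\<^bsub>E\<^esub> = 0"
      by simp
  qed
  from this [OF p c] have q: "cstar_seminorm (MF n) q" and "p \<zero>\<^bsub>E\<^esub> = 0"
    by blast+
  then have "q r = 0" if "r \<in> R" for r
    using class_relator [OF that] by (simp add: q_def)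
  then have "q f \<le> max_cstar_seminorm (MF n) R f"
    by (rule max_cstar_seminorm_upper [OF q _ f(1)])
  then show "p x \<le> nrm E x"
    using f by (simp add: q_def nrm_enveloping_class)
qed

text \<open>The relators of a magic matrix are killed because \<open>v\<close> is magic, so the
  hypothesis \<open>R\<close> asks only about the additional ones.\<close>

lemma extend_magic_unitary:
  assumes C: "cstar_algebra C" and v: "magic_unitary C n v"
    and R: "\<And>f r. \<lbrakk>f \<in> cstar_hom (MF n) C; \<And>i j. \<lbrakk>i \<in> {1..n}; j \<in> {1..n}\<rbrakk> \<Longrightarrow> f (magic_var i j) = v i j;
      r \<in> R; r \<notin> magic_relators n\<rbrakk> \<Longrightarrow> f r = \<zero>\<^bsub>C\<^esub>"
  shows "\<exists>f\<in>cstar_hom E C. \<forall>i\<in>{1..n}. \<forall>j\<in>{1..n}. f (gen i j) = v i j"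
proof -
  interpret C: cstar_algebra C
    by (rule C)
  obtain f where f: "f \<in> cstar_hom (MF n) C" "\<And>i j. \<lbrakk>i \<in> {1..n}; j \<in> {1..n}\<rbrakk> \<Longrightarrow> f (magic_var i j) = v i j"
  proof -
    have "v i j \<in> carrier C \<and> star C (v i j) = v i j" if "i \<in> {1..n}" "j \<in> {1..n}" for i j
      using magic_unitaryD(1,2) [OF v that] by simp
    from magic_free_extend [where n = n and v = v, OF C.star_algebra_axioms this] show ?thesis
      using that by blast
  qed
  have "magic_unitary C n (\<lambda>i j. f (magic_var i j))"
  proof -
    have "(\<Oplus>\<^bsub>C\<^esub>j\<in>{1..n}. f (magic_var i j)) = (\<Oplus>\<^bsub>C\<^esub>j\<in>{1..n}. v i j)"
      and "(\<Oplus>\<^bsub>C\<^esub>j\<in>{1..n}. f (magic_var j i)) = (\<Oplus>\<^bsub>C\<^esub>j\<in>{1..n}. v j i)" if "i \<in> {1..n}" for i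
      using that f(2) magic_unitaryD(1) [OF v] by (auto intro!: C.finsum_cong' simp del: atLeastAtMost_iff)
    then show ?thesis
      using v unfolding magic_unitary_def by (simp add: f(2) del: One_nat_def)
  qed
  then have "f r = \<zero>\<^bsub>C\<^esub>" if "r \<in> magic_relators n" for r
    using magic_relators_iff [OF C.star_algebra_axioms f(1)] that by blast
  then have "f r = \<zero>\<^bsub>C\<^esub>" if "r \<in> R" for r
    using R [OF f that] by blast
  from enveloping_extend_hom [OF C f(1) this] show ?thesis
    using f(2) magic_var_closed by (metis (no_types, lifting))
qed

lemma hom_unique:
  assumes C: "cstar_algebra C" and f: "f \<in> cstar_hom E C" and g: "g \<in> cstar_hom E C"
    and eq: "\<And>i j. \<lbrakk>i \<in> {1..n}; j \<in> {1..n}\<rbrakk> \<Longrightarrow> f (gen i j) = g (gen i j)" and x: "x \<in> carrier E"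
  shows "f x = g x"
proof (rule cstar_hom_eq_if_eq_on_dense [OF E.cstar_algebra_axioms C f g generated_dense generated_closed _ x])
  fix y
  assume "y \<in> D"
  then obtain h where h: "h \<in> carrier (MF n)" "y = enveloping_class (MF n) R h"
    unfolding generated_eq by blast
  have "(f \<circ> enveloping_class (MF n) R) h = (g \<circ> enveloping_class (MF n) R) h"
    by (rule magic_free_hom_eq [OF cstar_hom_comp [OF enveloping_class_hom f]
          cstar_hom_comp [OF enveloping_class_hom g] _ h(1)]) (simp add: eq del: atLeastAtMost_iff)
  then show "f y = g y"
    by (simp add: h)
qed

end

section \<open>The universal magic unitary with commuting entries is a quantum permutation
  algebra\<close>

definition commutators :: "nat \<Rightarrow> magic_poly set" where
  "commutators n = {magic_var i j \<otimes>\<^bsub>MF n\<^esub> magic_var k l - magic_var k l \<otimes>\<^bsub>MF n\<^esub> magic_var i j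
    | i j k l. i \<in> {1..n} \<and> j \<in> {1..n} \<and> k \<in> {1..n} \<and> l \<in> {1..n}}"

lemma commutators_closed:
  assumes "r \<in> commutators n"
  shows "r \<in> carrier (MF n)"
proof -
  interpret MF: star_algebra "MF n"
    by (rule magic_free_star_algebra)
  obtain i j k l where r: "r = magic_var i j \<otimes>\<^bsub>MF n\<^esub> magic_var k l - magic_var k l \<otimes>\<^bsub>MF n\<^esub> magic_var i j"
    and ij: "i \<in> {1..n}" "j \<in> {1..n}" "k \<in> {1..n}" "l \<in> {1..n}"
    using assms unfolding commutators_def by blast
  note x = magic_var_closed [OF ij(1,2)] magic_var_closed [OF ij(3,4)]
  show ?thesis
    using MF.minus_closed [OF MF.m_closed [OF x] MF.m_closed [OF x(2,1)]] x
    by (simp add: r magic_free_minus MF.m_closed)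
qed

interpretation As: magic_presentation n "magic_relators n"
  by unfold_locales (auto intro: magic_relators_closed)

lemma As_eq: "A\<^sub>s n = enveloping_cstar (MF n) (magic_relators n)"
  and As_gen_eq: "A\<^sub>s_gen n i j = enveloping_class (MF n) (magic_relators n) (magic_var i j)"
  by (simp_all add: A\<^sub>s_def A\<^sub>s_gen_def)

lemmas As_gen_magic_unitary = As.gen_magic_unitary [folded As_eq As_gen_eq]
lemmas As_hom_unique = As.hom_unique [folded As_eq As_gen_eq]
lemmas As_star_algebra = As.E.star_algebra_axioms [folded As_eq]

lemma As_extend:
  assumes "cstar_algebra C" "magic_unitary C n v"
  shows "\<exists>f\<in>cstar_hom (A\<^sub>s n) C. \<forall>i\<in>{1..n}. \<forall>j\<in>{1..n}. f (A\<^sub>s_gen n i j) = v i j"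
  unfolding As_eq As_gen_eq using assms by (rule As.extend_magic_unitary) auto

text \<open>The enveloping C*-algebra for these relators is the algebra of functions on the symmetric group.\<close>

interpretation Comm: magic_presentation n "magic_relators n \<union> commutators n"
  by unfold_locales (auto intro: magic_relators_closed commutators_closed)

lemma hom_commutator:
  assumes C: "star_algebra C" and f: "f \<in> cstar_hom (MF n) C"
    and ij: "i \<in> {1..n}" "j \<in> {1..n}" "k \<in> {1..n}" "l \<in> {1..n}"
  shows "f (magic_var i j \<otimes>\<^bsub>MF n\<^esub> magic_var k l - magic_var k l \<otimes>\<^bsub>MF n\<^esub> magic_var i j) = \<zero>\<^bsub>C\<^esub> \<longleftrightarrow>
    f (magic_var i j) \<otimes>\<^bsub>C\<^esub> f (magic_var k l) = f (magic_var k l) \<otimes>\<^bsub>C\<^esub> f (magic_var i j)"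
proof -
  interpret star_algebra_hom "MF n" C f
    by (simp add: star_algebra_hom_def star_algebra_hom_axioms_def magic_free_star_algebra C f)
  note x = magic_var_closed [OF ij(1,2)] magic_var_closed [OF ij(3,4)]
  have "magic_var i j \<otimes>\<^bsub>MF n\<^esub> magic_var k l - magic_var k l \<otimes>\<^bsub>MF n\<^esub> magic_var i j
    = magic_var i j \<otimes>\<^bsub>MF n\<^esub> magic_var k l \<ominus>\<^bsub>MF n\<^esub> magic_var k l \<otimes>\<^bsub>MF n\<^esub> magic_var i j"
    using x by (simp add: magic_free_minus)
  then show ?thesis
    using x by (simp add: hom_minus hom_simps B.minus_eq_zero_iff)
qed

abbreviation comm_magic :: "nat \<Rightarrow> magic_elem cstar" where
  "comm_magic n \<equiv> enveloping_cstar (MF n) (magic_relators n \<union> commutators n)"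

abbreviation comm_gen :: "nat \<Rightarrow> nat \<Rightarrow> nat \<Rightarrow> magic_elem" where
  "comm_gen n i j \<equiv> enveloping_class (MF n) (magic_relators n \<union> commutators n) (magic_var i j)"

lemma comm_magic_extend:
  assumes C: "cstar_algebra C" and v: "magic_unitary C n v"
    and comm: "\<And>i j k l. \<lbrakk>i \<in> {1..n}; j \<in> {1..n}; k \<in> {1..n}; l \<in> {1..n}\<rbrakk>
      \<Longrightarrow> v i j \<otimes>\<^bsub>C\<^esub> v k l = v k l \<otimes>\<^bsub>C\<^esub> v i j"
  shows "\<exists>f\<in>cstar_hom (comm_magic n) C. \<forall>i\<in>{1..n}. \<forall>j\<in>{1..n}. f (comm_gen n i j) = v i j"
proof (rule Comm.extend_magic_unitary [OF C v])
  interpret C: cstar_algebra C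
    by (rule C)
  fix f r
  assume f: "f \<in> cstar_hom (MF n) C" "\<And>i j. \<lbrakk>i \<in> {1..n}; j \<in> {1..n}\<rbrakk> \<Longrightarrow> f (magic_var i j) = v i j"
    and "r \<in> magic_relators n \<union> commutators n" "r \<notin> magic_relators n"
  then have "r \<in> commutators n"
    by blast
  then obtain i j k l where r: "r = magic_var i j \<otimes>\<^bsub>MF n\<^esub> magic_var k l - magic_var k l \<otimes>\<^bsub>MF n\<^esub> magic_var i j"
    and ij: "i \<in> {1..n}" "j \<in> {1..n}" "k \<in> {1..n}" "l \<in> {1..n}"
    unfolding commutators_def by blast
  show "f r = \<zero>\<^bsub>C\<^esub>"
    unfolding r hom_commutator [OF C.star_algebra_axioms f(1) ij] f(2) [OF ij(1,2)] f(2) [OF ij(3,4)]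
    by (rule comm [OF ij])
qed

lemma comm_gen_commute:
  assumes ij: "i \<in> {1..n}" "j \<in> {1..n}" "k \<in> {1..n}" "l \<in> {1..n}"
  shows "comm_gen n i j \<otimes>\<^bsub>comm_magic n\<^esub> comm_gen n k l = comm_gen n k l \<otimes>\<^bsub>comm_magic n\<^esub> comm_gen n i j"
  unfolding hom_commutator [OF Comm.E.star_algebra_axioms Comm.enveloping_class_hom ij, symmetric]
  by (rule Comm.class_relator) (use ij in \<open>auto simp: commutators_def\<close>)

lemma comm_magic_commute:
  assumes "x \<in> carrier (comm_magic n)" "y \<in> carrier (comm_magic n)"
  shows "x \<otimes>\<^bsub>comm_magic n\<^esub> y = y \<otimes>\<^bsub>comm_magic n\<^esub> x"
proof (rule Comm.E.dense_commute [OF Comm.generated_dense Comm.generated_closed _ assms])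
  note m = magic_unitaryD [OF Comm.gen_magic_unitary [of n]]
  fix x y
  assume "x \<in> Comm.D n" "y \<in> Comm.D n"
  then show "x \<otimes>\<^bsub>comm_magic n\<^esub> y = y \<otimes>\<^bsub>comm_magic n\<^esub> x"
  proof (rule Comm.E.generated_star_algebra_commute [rotated 3])
    show "{comm_gen n i j |i j. i \<in> {1..n} \<and> j \<in> {1..n}} \<subseteq> carrier (comm_magic n)"
      using m(1) by blast
    show "star (comm_magic n) g = g" if "g \<in> {comm_gen n i j |i j. i \<in> {1..n} \<and> j \<in> {1..n}}" for g
      using m(2) that by blast
    show "g \<otimes>\<^bsub>comm_magic n\<^esub> h = h \<otimes>\<^bsub>comm_magic n\<^esub> g"
      if "g \<in> {comm_gen n i j |i j. i \<in> {1..n} \<and> j \<in> {1..n}}"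
        "h \<in> {comm_gen n i j |i j. i \<in> {1..n} \<and> j \<in> {1..n}}" for g h
      using comm_gen_commute that by blast
  qed
qed

lemma complex_finsum: "finite I \<Longrightarrow> finsum complex_cstar f I = sum f I"
proof (induction I rule: finite_induct)
  interpret cstar_algebra complex_cstar
    by (rule complex_cstar_algebra)
  case empty
  show ?case
    using finsum_empty [of f] by simp
next
  interpret cstar_algebra complex_cstar
    by (rule complex_cstar_algebra)
  case (insert i I)
  then show ?case
    using finsum_insert [of I i f] by simp
qed

theorem comm_magic_quantum_permutation_algebra:
  "quantum_permutation_algebra n (comm_magic n) (comm_gen n)"
proof -
  let ?B = "comm_magic n" and ?u = "comm_gen n"
  note u = Comm.gen_magic_unitary [of n]
  note m = magic_unitaryD [OF u]
  \<comment> \<open>The identity matrix is a magic unitary over the scalars, which commute.\<close>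
  have \<epsilon>: "\<exists>\<epsilon>\<in>cstar_hom ?B complex_cstar. \<forall>i\<in>{1..n}. \<forall>j\<in>{1..n}. \<epsilon> (?u i j) = (if i = j then 1 else 0)"
    by (rule comm_magic_extend [OF complex_cstar_algebra])
       (auto simp: magic_unitary_def complex_finsum)
  have S: "\<exists>S\<in>cstar_hom ?B (opposite ?B). \<forall>i\<in>{1..n}. \<forall>j\<in>{1..n}. S (?u i j) = ?u j i"
    by (rule comm_magic_extend [OF Comm.E.opposite_cstar_algebra magic_unitary_opposite [OF u]])
       (unfold opposite_simps, rule comm_gen_commute)
  interpret P: cstar_algebra_pair ?B ?B
    by unfold_locales
  interpret L: star_algebra_hom ?B P.T "\<lambda>a. P.tn a \<one>\<^bsub>?B\<^esub>"
    by unfold_locales (rule P.tn_left_hom)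
  interpret R: star_algebra_hom ?B P.T "\<lambda>a. P.tn \<one>\<^bsub>?B\<^esub> a"
    by unfold_locales (rule P.tn_right_hom)
  \<comment> \<open>The convolution of the two legs of \<open>u\<close>. Multiplying the factors
    turns it into the sum of elementary tensors prescribed for the comultiplication
    (\<open>v_eq\<close>).\<close>
  let ?v = "\<lambda>i j. \<Oplus>\<^bsub>P.T\<^esub>k\<in>{1..n}. P.tn (?u i k) \<one>\<^bsub>?B\<^esub> \<otimes>\<^bsub>P.T\<^esub> P.tn \<one>\<^bsub>?B\<^esub> (?u k j)"
  have v: "magic_unitary P.T n ?v"
    by (rule P.T.magic_unitary_convolution [OF L.magic_unitary_hom [OF u] R.magic_unitary_hom [OF u]])
       (simp add: P.tn_mult m(1))
  have t: "P.tn (?u i k) \<one>\<^bsub>?B\<^esub> \<otimes>\<^bsub>P.T\<^esub> P.tn \<one>\<^bsub>?B\<^esub> (?u k j) = P.tn (?u i k) (?u k j)"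
    if "i \<in> {1..n}" "j \<in> {1..n}" "k \<in> {1..n}" for i j k
    using that m(1) by (simp add: P.tn_mult del: atLeastAtMost_iff)
  have v_eq: "?v i j = (\<Oplus>\<^bsub>P.T\<^esub>k\<in>{1..n}. P.tn (?u i k) (?u k j))"
    if "i \<in> {1..n}" "j \<in> {1..n}" for i j
    using that m(1) t by (intro P.T.finsum_cong') (auto simp del: atLeastAtMost_iff)
  have tc: "P.tn (?u i k) (?u k j) \<in> carrier P.T" if "i \<in> {1..n}" "j \<in> {1..n}" "k \<in> {1..n}" for i j k
    using that m(1) by (simp del: atLeastAtMost_iff)
  have vc: "?v i j \<in> carrier P.T" if "i \<in> {1..n}" "j \<in> {1..n}" for i j
    unfolding v_eq [OF that] using that tc by (intro P.T.finsum_closed) blast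
  \<comment> \<open>Elementary tensors multiply leg by leg, so commutativity of the algebra passes
    to them, and then to the entries of \<open>?v\<close> by summing twice.\<close>
  have tcomm: "P.tn (?u i k) (?u k j) \<otimes>\<^bsub>P.T\<^esub> P.tn (?u i' k') (?u k' j')
      = P.tn (?u i' k') (?u k' j') \<otimes>\<^bsub>P.T\<^esub> P.tn (?u i k) (?u k j)"
    if "i \<in> {1..n}" "j \<in> {1..n}" "k \<in> {1..n}" "i' \<in> {1..n}" "j' \<in> {1..n}" "k' \<in> {1..n}" for i j k i' j' k'
    using that m(1) by (simp add: P.tn_mult comm_magic_commute del: atLeastAtMost_iff)
  have "?v i j \<otimes>\<^bsub>P.T\<^esub> ?v i' j' = ?v i' j' \<otimes>\<^bsub>P.T\<^esub> ?v i j"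
    if ij: "i \<in> {1..n}" "j \<in> {1..n}" "i' \<in> {1..n}" "j' \<in> {1..n}" for i j i' j'
    unfolding v_eq [OF ij(1,2)]
  proof (rule P.T.finsum_commute)
    show "?v i' j' \<in> carrier P.T"
      using ij by (intro vc)
    fix k
    assume k: "k \<in> {1..n}"
    show "P.tn (?u i k) (?u k j) \<otimes>\<^bsub>P.T\<^esub> ?v i' j' = ?v i' j' \<otimes>\<^bsub>P.T\<^esub> P.tn (?u i k) (?u k j)"
      unfolding v_eq [OF ij(3,4)]
      by (rule P.T.finsum_commute [symmetric]) (use ij k tc tcomm in auto)
  qed (use ij tc in auto)
  from comm_magic_extend [OF P.tensor_cstar_algebra v this]
  have \<Delta>: "\<exists>\<Delta>\<in>cstar_hom ?B P.T. \<forall>i\<in>{1..n}. \<forall>j\<in>{1..n}.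
      \<Delta> (?u i j) = (\<Oplus>\<^bsub>P.T\<^esub>k\<in>{1..n}. P.tn (?u i k) (?u k j))"
    using v_eq by (auto simp del: atLeastAtMost_iff)
  show ?thesis
    unfolding quantum_permutation_algebra_def
    using Comm.E.cstar_algebra_axioms u Comm.is_enveloping_generated \<epsilon> S \<Delta> by blast
qed

section \<open>Orthogonal projections and the theorem\<close>

lemma closed_subspaceD:
  assumes "closed_subspace S"
  shows "0 \<in> S" "\<lbrakk>x \<in> S; y \<in> S\<rbrakk> \<Longrightarrow> x + y \<in> S" "x \<in> S \<Longrightarrow> c *\<^sub>C x \<in> S" "closed S"
  using assms unfolding closed_subspace_def by auto

lemma closed_subspace_diff:
  assumes "closed_subspace S" "x \<in> S" "y \<in> S"
  shows "x - y \<in> S"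
  using closed_subspaceD(2) [OF assms(1,2) closed_subspaceD(3) [OF assms(1,3), of "- 1"]]
  by (simp add: scaleC_minus_left)

lemma closed_subspace_sum:
  assumes "closed_subspace S" "\<And>k. k \<in> K \<Longrightarrow> f k \<in> S"
  shows "sum f K \<in> S"
  using assms(2) closed_subspaceD [OF assms(1)] by (induction K rule: infinite_finite_induct) auto

lemma closed_subspace_INT:
  assumes "\<And>i. i \<in> I \<Longrightarrow> closed_subspace (S i)"
  shows "closed_subspace {x. \<forall>i\<in>I. x \<in> S i}"
proof -
  have "{x. \<forall>i\<in>I. x \<in> S i} = (\<Inter>i\<in>I. S i)"
    by auto
  then show ?thesis
    using assms unfolding closed_subspace_def by (auto intro: closed_INT)
qed

text \<open>\<open>orth_projection\<close> wraps a pointwise description in \<open>Blinfun\<close>,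
  so even its value at one vector is accessible only after the description is known to be bounded
  linear. Hence \<open>ex\<close> asks for a nearest point at every vector.\<close>

lemma orth_projection_eqI:
  assumes S: "closed_subspace S" and ex: "\<And>x. \<exists>y\<in>S. \<forall>z\<in>S. cinner (x - y) z = 0"
    and y: "y \<in> S" "\<And>z. z \<in> S \<Longrightarrow> cinner (x - y) z = 0"
  shows "blinfun_apply (orth_projection S) x = y"
proof -
  define P where "P x = (THE y. y \<in> S \<and> (\<forall>z\<in>S. cinner (x - y) z = 0))" for x
  have uniq: "y = y'" if "y \<in> S" "\<And>z. z \<in> S \<Longrightarrow> cinner (x - y) z = 0"
    "y' \<in> S" "\<And>z. z \<in> S \<Longrightarrow> cinner (x - y') z = 0" for x y y'
  proof -
    have "y - y' \<in> S"
      using S that by (intro closed_subspace_diff)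
    then have "cinner (x - y') (y - y') - cinner (x - y) (y - y') = 0"
      using that by simp
    then have "cinner (y - y') (y - y') = 0"
      by (simp flip: cinner_diff_left)
    then show ?thesis
      by simp
  qed
  have P_eq: "P x = y" if "y \<in> S" "\<And>z. z \<in> S \<Longrightarrow> cinner (x - y) z = 0" for x y
    unfolding P_def by (rule the_equality) (use that uniq in blast)+
  have P: "P x \<in> S" "z \<in> S \<Longrightarrow> cinner (x - P x) z = 0" for x z
    using ex [of x] P_eq by auto
  have "bounded_linear P"
  proof (rule bounded_linear_intro)
    fix x y r
    have "cinner (x + y - (P x + P y)) z = 0" if "z \<in> S" for z
      using P(2) [OF that, of x] P(2) [OF that, of y] by (simp add: cinner_diff_left cinner_add_left)
    then show "P (x + y) = P x + P y"
      using closed_subspaceD(2) [OF S] P(1) by (intro P_eq) auto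
    have "cinner (r *\<^sub>R x - r *\<^sub>R P x) z = 0" if "z \<in> S" for z
      using P(2) [OF that, of x] by (simp add: scaleR_scaleC cinner_diff_left cinner_scaleC_left)
    then show "P (r *\<^sub>R x) = r *\<^sub>R P x"
      using closed_subspaceD(3) [OF S P(1)] by (intro P_eq) (auto simp: scaleR_scaleC)
    have "inner (P x) (P x) = inner x (P x)"
      using P(2) [OF P(1), of x x] by (simp add: inner_eq_Re_cinner cinner_diff_left)
    then have "norm (P x) * norm (P x) \<le> norm x * norm (P x)"
      using norm_cauchy_schwarz [of x "P x"] by (simp add: power2_norm_eq_inner flip: power2_eq_square)
    then show "norm (P x) \<le> norm x * 1"
      by (cases "P x = 0") simp_all
  qed
  then have "blinfun_apply (orth_projection S) = P"
    unfolding orth_projection_def P_def [symmetric] by (rule bounded_linear_Blinfun_apply)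
  then show ?thesis
    using P_eq y by simp
qed

text \<open>Serves twice: with \<open>L = {k}\<close> it extracts a component, and with
  \<open>L = E i j\<close> it computes the projection onto \<open>X i j\<close> in a finer
  decomposition. The omitted components are orthogonal to \<open>S\<close>, which makes the partial
  sum the nearest point.\<close>

lemma orthogonal_decomposition_orth_projection:
  assumes K: "orthogonal_decomposition K Y UNIV" and L: "L \<subseteq> K" and S: "closed_subspace S"
    and eq: "S = sum_of_subspaces L Y" and f: "\<And>k. k \<in> K \<Longrightarrow> f k \<in> Y k"
  shows "blinfun_apply (orth_projection S) (\<Sum>k\<in>K. f k) = (\<Sum>k\<in>L. f k)"
proof -
  have fin: "finite K"
    using K by (simp add: orthogonal_decomposition_def)
  have orth: "cinner x y = 0" if "k \<in> K" "l \<in> K" "k \<noteq> l" "x \<in> Y k" "y \<in> Y l" for k l x y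
    using K that unfolding orthogonal_decomposition_def by blast
  have *: "(\<Sum>k\<in>L. g k) \<in> S" "z \<in> S \<Longrightarrow> cinner ((\<Sum>k\<in>K. g k) - (\<Sum>k\<in>L. g k)) z = 0"
    if g: "\<And>k. k \<in> K \<Longrightarrow> g k \<in> Y k" for g z
  proof -
    show "(\<Sum>k\<in>L. g k) \<in> S"
      unfolding eq sum_of_subspaces_def using g L by blast
    assume "z \<in> S"
    then obtain h where h: "z = (\<Sum>l\<in>L. h l)" "\<And>l. l \<in> L \<Longrightarrow> h l \<in> Y l"
      unfolding eq sum_of_subspaces_def by blast
    have "(\<Sum>k\<in>K. g k) - (\<Sum>k\<in>L. g k) = (\<Sum>k\<in>K - L. g k)"
      using sum_diff [OF fin L, of g] by simp
    moreover have "cinner (g k) z = 0" if "k \<in> K - L" for k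
    proof -
      have "cinner z (g k) = (\<Sum>l\<in>L. cinner (h l) (g k))"
        by (simp add: h(1) cinner_sum_left)
      also have "\<dots> = 0"
      proof (intro sum.neutral ballI)
        fix l
        assume "l \<in> L"
        then show "cinner (h l) (g k) = 0"
          using that L h(2) g by (intro orth [of l k]) auto
      qed
      finally show ?thesis
        by (simp add: cinner_eq_0_commute)
    qed
    ultimately show "cinner ((\<Sum>k\<in>K. g k) - (\<Sum>k\<in>L. g k)) z = 0"
      by (simp add: cinner_sum_left)
  qed
  show ?thesis
  proof (rule orth_projection_eqI [OF S])
    fix x
    have "x \<in> sum_of_subspaces K Y"
      using K unfolding orthogonal_decomposition_def by blast
    then obtain g where "x = (\<Sum>k\<in>K. g k)" "\<And>k. k \<in> K \<Longrightarrow> g k \<in> Y k"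
      unfolding sum_of_subspaces_def by blast
    then show "\<exists>y\<in>S. \<forall>z\<in>S. cinner (x - y) z = 0"
      using * by blast
  qed (use * f in auto)
qed

lemma orth_projection_summand:
  assumes K: "orthogonal_decomposition K Y UNIV" and k: "k \<in> K"
    and f: "\<And>k. k \<in> K \<Longrightarrow> f k \<in> Y k"
  shows "blinfun_apply (orth_projection (Y k)) (\<Sum>k\<in>K. f k) = f k"
proof -
  have "Y k = sum_of_subspaces {k} Y"
    unfolding sum_of_subspaces_def by auto
  moreover have "closed_subspace (Y k)"
    using K k by (simp add: orthogonal_decomposition_def)
  ultimately have "blinfun_apply (orth_projection (Y k)) (\<Sum>k\<in>K. f k) = (\<Sum>k\<in>{k}. f k)"
    using k by (intro orthogonal_decomposition_orth_projection [OF K _ _ _ f]) auto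
  then show ?thesis
    by simp
qed

lemma
  assumes K: "orthogonal_decomposition K Y UNIV"
  shows orth_projection_in: "k \<in> K \<Longrightarrow> blinfun_apply (orth_projection (Y k)) x \<in> Y k"
    and sum_orth_projections: "(\<Sum>k\<in>K. blinfun_apply (orth_projection (Y k)) x) = x"
    and orth_projection_same: "\<lbrakk>k \<in> K; y \<in> Y k\<rbrakk> \<Longrightarrow> blinfun_apply (orth_projection (Y k)) y = y"
    and orth_projection_other:
      "\<lbrakk>k \<in> K; l \<in> K; k \<noteq> l; y \<in> Y l\<rbrakk> \<Longrightarrow> blinfun_apply (orth_projection (Y k)) y = 0"
proof -
  have fin: "finite K" and Y0: "\<And>k. k \<in> K \<Longrightarrow> 0 \<in> Y k"
    using K by (auto simp: orthogonal_decomposition_def closed_subspace_def)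
  have "x \<in> sum_of_subspaces K Y"
    using K unfolding orthogonal_decomposition_def by blast
  then obtain f where f: "x = (\<Sum>k\<in>K. f k)" "\<And>k. k \<in> K \<Longrightarrow> f k \<in> Y k"
    unfolding sum_of_subspaces_def by blast
  show "k \<in> K \<Longrightarrow> blinfun_apply (orth_projection (Y k)) x \<in> Y k"
    and "(\<Sum>k\<in>K. blinfun_apply (orth_projection (Y k)) x) = x"
    using f orth_projection_summand [OF K _ f(2)] by simp_all
  have "blinfun_apply (orth_projection (Y k)) y = (if k = l then y else 0)"
    if "k \<in> K" "l \<in> K" "y \<in> Y l" for k l
    using orth_projection_summand [OF K that(1), of "\<lambda>m. if m = l then y else 0"] that Y0 fin
    by (simp split: if_splits)
  then show "\<lbrakk>k \<in> K; y \<in> Y k\<rbrakk> \<Longrightarrow> blinfun_apply (orth_projection (Y k)) y = y"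
    and "\<lbrakk>k \<in> K; l \<in> K; k \<noteq> l; y \<in> Y l\<rbrakk> \<Longrightarrow> blinfun_apply (orth_projection (Y k)) y = 0"
    by auto
qed

lemma sum_of_subspaces_add:
  assumes "\<And>k. k \<in> K \<Longrightarrow> closed_subspace (Y k)" "x \<in> sum_of_subspaces K Y" "y \<in> sum_of_subspaces K Y"
  shows "x + y \<in> sum_of_subspaces K Y"
proof -
  obtain f where f: "x = (\<Sum>k\<in>K. f k)" "\<forall>k\<in>K. f k \<in> Y k"
    using assms(2) unfolding sum_of_subspaces_def by blast
  obtain g where g: "y = (\<Sum>k\<in>K. g k)" "\<forall>k\<in>K. g k \<in> Y k"
    using assms(3) unfolding sum_of_subspaces_def by blast
  have "x + y = (\<Sum>k\<in>K. f k + g k)" "\<forall>k\<in>K. f k + g k \<in> Y k"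
    using f g closed_subspaceD(2) [OF assms(1)] by (simp_all add: sum.distrib)
  then show ?thesis
    unfolding sum_of_subspaces_def by blast
qed

lemma sum_of_subspaces_superset:
  assumes "\<And>k. k \<in> K \<Longrightarrow> closed_subspace (Y k)" "finite K" "k \<in> K" "y \<in> Y k"
  shows "y \<in> sum_of_subspaces K Y"
proof -
  have "y = (\<Sum>l\<in>K. if l = k then y else 0)" "\<forall>l\<in>K. (if l = k then y else 0) \<in> Y l"
    using assms closed_subspaceD(1) by auto
  then show ?thesis
    unfolding sum_of_subspaces_def by blast
qed

lemma sum_of_subspaces_zero:
  fixes Y :: "'i \<Rightarrow> 'h::complex_hilbert_space set"
  assumes "\<And>k. k \<in> K \<Longrightarrow> closed_subspace (Y k)"
  shows "0 \<in> sum_of_subspaces K Y"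
proof -
  have "0 = (\<Sum>k\<in>K. 0 :: 'h)" "\<forall>k\<in>K. 0 \<in> Y k"
    using closed_subspaceD(1) [OF assms] by simp_all
  then show ?thesis
    unfolding sum_of_subspaces_def by blast
qed

text \<open>All projections are diagonal for \<open>Y\<close>: the one onto \<open>X i j\<close>
  keeps the components with index in \<open>E i j\<close>, so a product keeps those in an
  intersection, which is symmetric.\<close>

lemma orth_projections_commute_if_magic_partition:
  fixes X :: "nat \<Rightarrow> nat \<Rightarrow> 'h::complex_hilbert_space set" and N :: nat
  assumes X: "magic_decomposition n X" and Y: "orthogonal_decomposition {1..N} Y UNIV"
    and E: "magic_partition n {1..N} E"
    and XE: "\<And>i j. \<lbrakk>i \<in> {1..n}; j \<in> {1..n}\<rbrakk> \<Longrightarrow> orthogonal_decomposition (E i j) Y (X i j)"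
    and ij: "i \<in> {1..n}" "j \<in> {1..n}" "k \<in> {1..n}" "l \<in> {1..n}"
  shows "orth_projection (X i j) o\<^sub>L orth_projection (X k l) = orth_projection (X k l) o\<^sub>L orth_projection (X i j)"
proof (rule blinfun_eqI)
  fix x
  have "x \<in> sum_of_subspaces {1..N} Y"
    using Y unfolding orthogonal_decomposition_def by blast
  then obtain f where f: "x = (\<Sum>m\<in>{1..N}. f m)" "\<And>m. m \<in> {1..N} \<Longrightarrow> f m \<in> Y m"
    unfolding sum_of_subspaces_def by blast
  have proj: "blinfun_apply (orth_projection (X i j)) (\<Sum>m\<in>{1..N}. g m) = (\<Sum>m\<in>E i j. g m)"
    if "i \<in> {1..n}" "j \<in> {1..n}" "\<And>m. m \<in> {1..N} \<Longrightarrow> g m \<in> Y m" for i j g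
  proof (rule orthogonal_decomposition_orth_projection [OF Y])
    show "E i j \<subseteq> {1..N}"
      using E that by (auto simp: magic_partition_def)
    show "closed_subspace (X i j)"
      using X that unfolding magic_decomposition_def orthogonal_decomposition_def by blast
    show "X i j = sum_of_subspaces (E i j) Y"
      using XE [OF that(1,2)] by (simp add: orthogonal_decomposition_def)
  qed (rule that)
  have prod: "blinfun_apply (orth_projection (X i j) o\<^sub>L orth_projection (X k l)) x
      = (\<Sum>m\<in>E i j \<inter> E k l. f m)"
    if ij: "i \<in> {1..n}" "j \<in> {1..n}" "k \<in> {1..n}" "l \<in> {1..n}" for i j k l
  proof -
    have sub: "E i j \<subseteq> {1..N}" "E k l \<subseteq> {1..N}"
      using E ij by (auto simp: magic_partition_def)
    \<comment> \<open>The value of the inner projection, padded with zeros to a sum over all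
      components, so that \<open>proj\<close> applies to it again.\<close>
    define g where "g m = (if m \<in> E k l then f m else 0)" for m
    have g: "g m \<in> Y m" if "m \<in> {1..N}" for m
      using f(2) [OF that] Y that unfolding g_def orthogonal_decomposition_def closed_subspace_def by auto
    have "blinfun_apply (orth_projection (X k l)) x = (\<Sum>m\<in>E k l. f m)"
      unfolding f(1) by (rule proj [OF ij(3,4) f(2)])
    also have "\<dots> = (\<Sum>m\<in>{1..N}. g m)"
      unfolding g_def using sub by (intro sum.mono_neutral_cong_left) auto
    finally have "blinfun_apply (orth_projection (X i j) o\<^sub>L orth_projection (X k l)) x = (\<Sum>m\<in>E i j. g m)"
      using proj [OF ij(1,2) g] by simp
    also have "\<dots> = (\<Sum>m\<in>E i j \<inter> E k l. f m)"
      unfolding g_def using finite_subset [OF sub(1)] by (intro sum.mono_neutral_cong_right) auto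
    finally show ?thesis .
  qed
  show "blinfun_apply (orth_projection (X i j) o\<^sub>L orth_projection (X k l)) x
      = blinfun_apply (orth_projection (X k l) o\<^sub>L orth_projection (X i j)) x"
    using prod [OF ij] prod [OF ij(3,4,1,2)] by (simp add: Int_commute)
qed

text \<open>The pieces are the \<open>\<Inter>i. X i (\<sigma> i)\<close> for the permutations \<open>\<sigma>\<close>: refining a vector by the rows one
  after the other splits it into joint pieces, and a nonzero joint piece selects each column once.\<close>

lemma magic_partition_if_orth_projections_commute:
  fixes X :: "nat \<Rightarrow> nat \<Rightarrow> 'h::complex_hilbert_space set"
  assumes X: "magic_decomposition n X"
    and comm: "\<And>i j k l. \<lbrakk>i \<in> {1..n}; j \<in> {1..n}; k \<in> {1..n}; l \<in> {1..n}\<rbrakk> \<Longrightarrow>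
      orth_projection (X i j) o\<^sub>L orth_projection (X k l) = orth_projection (X k l) o\<^sub>L orth_projection (X i j)"
  shows "\<exists>(N :: nat) (Y :: nat \<Rightarrow> 'h set) (E :: nat \<Rightarrow> nat \<Rightarrow> nat set).
       orthogonal_decomposition {1..N} Y UNIV \<and>
       magic_partition n {1..N} E \<and>
       (\<forall>i\<in>{1..n}. \<forall>j\<in>{1..n}. orthogonal_decomposition (E i j) Y (X i j))"
proof -
  let ?I = "{1..n}"
  define P where "P i j = blinfun_apply (orth_projection (X i j))" for i j
  have row: "orthogonal_decomposition ?I (X i) UNIV" if "i \<in> ?I" for i
    using X that unfolding magic_decomposition_def by blast
  have cs: "closed_subspace (X i j)" if "i \<in> ?I" "j \<in> ?I" for i j
    using row that unfolding orthogonal_decomposition_def by blast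
  have orow: "cinner x y = 0" if "i \<in> ?I" "j \<in> ?I" "l \<in> ?I" "j \<noteq> l" "x \<in> X i j" "y \<in> X i l" for i j l x y
    using row [OF that(1)] that unfolding orthogonal_decomposition_def by blast
  have ocol: "cinner x y = 0" if "i \<in> ?I" "k \<in> ?I" "j \<in> ?I" "i \<noteq> k" "x \<in> X i j" "y \<in> X k j" for i j k x y
    using X that unfolding magic_decomposition_def orthogonal_decomposition_def by blast
  have Pin: "P i j x \<in> X i j" and Psame: "x \<in> X i j \<Longrightarrow> P i j x = x" if "i \<in> ?I" "j \<in> ?I" for i j x
    unfolding P_def using orth_projection_in [OF row [OF that(1)] that(2)]
      orth_projection_same [OF row [OF that(1)] that(2)] by auto
  have Pother: "P i j x = 0" if "i \<in> ?I" "j \<in> ?I" "l \<in> ?I" "j \<noteq> l" "x \<in> X i l" for i j l x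
    unfolding P_def using orth_projection_other [OF row [OF that(1)] that(2,3)] that(4,5) by blast
  have Psum: "(\<Sum>j\<in>?I. P i j x) = x" if "i \<in> ?I" for i x
    unfolding P_def using sum_orth_projections [OF row [OF that]] .
  have Pcomm: "P i j (P k l x) = P k l (P i j x)"
    if "i \<in> ?I" "j \<in> ?I" "k \<in> ?I" "l \<in> ?I" for i j k l x
    using comm [OF that] unfolding P_def by (metis blinfun_apply_blinfun_compose)
  define M where "M = {\<sigma>. \<sigma> permutes ?I}"
  have "finite M"
    unfolding M_def by (intro finite_permutations) simp
  then obtain h where h: "bij_betw h {1..card M} M"
    using ex_bij_betw_nat_finite_1 by blast
  define N where "N = card M"
  have hp: "h k permutes ?I" if "k \<in> {1..N}" for k
    using h that unfolding N_def M_def by (auto dest: bij_betwE)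
  have hI: "h k i \<in> ?I" if "k \<in> {1..N}" "i \<in> ?I" for k i
    using permutes_in_image [OF hp [OF that(1)]] that(2) by blast
  \<comment> \<open>For \<open>n = 0\<close> there is one permutation, and its piece is the whole
    space.\<close>
  define Y where "Y k = {x. \<forall>i\<in>?I. x \<in> X i (h k i)}" for k
  define E where "E i j = {k \<in> {1..N}. h k i = j}" for i j
  have Ycs: "closed_subspace (Y k)" if "k \<in> {1..N}" for k
    unfolding Y_def using cs hI that by (intro closed_subspace_INT) blast
  have Yorth: "cinner x y = 0" if kl: "k \<in> {1..N}" "l \<in> {1..N}" "k \<noteq> l" "x \<in> Y k" "y \<in> Y l" for k l x y
  proof -
    have "h k \<noteq> h l"
      using bij_betw_imp_inj_on [OF h] kl unfolding N_def inj_on_def by blast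
    then obtain i where i: "h k i \<noteq> h l i"
      by blast
    \<comment> \<open>Outside \<open>?I\<close> both permutations are the identity, so they differ
      at a row index, where the two pieces lie in orthogonal components.\<close>
    then have "i \<in> ?I"
      using permutes_not_in [OF hp] kl(1,2) by metis
    then show ?thesis
      using orow [OF _ hI hI i, of i x y] kl unfolding Y_def by blast
  qed
  define V where "V = sum_of_subspaces {1..N} Y"
  have V0: "0 \<in> V"
    unfolding V_def by (rule sum_of_subspaces_zero [where K = "{1..N}" and Y = Y, OF Ycs])
  have V_add: "x + y \<in> V" if "x \<in> V" "y \<in> V" for x y
    using sum_of_subspaces_add [where K = "{1..N}" and Y = Y, of x y] Ycs that unfolding V_def by blast
  have V_sum: "sum f J \<in> V" if "\<And>j. j \<in> J \<Longrightarrow> f j \<in> V" for f :: "nat \<Rightarrow> 'h" and J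
    using that by (induction J rule: infinite_finite_induct) (simp_all add: V0 V_add)
  have joint: "x \<in> V" if x: "\<And>i. i \<in> ?I \<Longrightarrow> \<exists>j\<in>?I. x \<in> X i j" for x
  proof (cases "x = 0")
    case True
    then show ?thesis
      using V0 by simp
  next
    case False
    obtain s where s: "\<And>i. i \<in> ?I \<Longrightarrow> s i \<in> ?I \<and> x \<in> X i (s i)"
      using x by metis
    define \<sigma> where "\<sigma> i = (if i \<in> ?I then s i else i)" for i
    have "inj_on \<sigma> ?I"
    proof (rule inj_onI, rule ccontr)
      fix i k
      assume ik: "i \<in> ?I" "k \<in> ?I" "\<sigma> i = \<sigma> k" "i \<noteq> k"
      then have "s i = s k"
        unfolding \<sigma>_def by simp
      \<comment> \<open>\<open>x\<close> lies in two different components of one column, hence is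
        orthogonal to itself.\<close>
      then have "cinner x x = 0"
        using ocol [OF ik(1,2) _ ik(4)] s [OF ik(1)] s [OF ik(2)] by metis
      then show False
        using False by simp
    qed
    moreover have "\<sigma> ` ?I \<subseteq> ?I"
      using s unfolding \<sigma>_def by auto
    ultimately have "bij_betw \<sigma> ?I ?I"
      by (simp add: bij_betw_def endo_inj_surj)
    then have "\<sigma> \<in> M"
      unfolding M_def by (auto intro!: bij_imp_permutes simp: \<sigma>_def)
    then obtain k where k: "k \<in> {1..N}" "h k = \<sigma>"
      using bij_betw_imp_surj_on [OF h] unfolding N_def by (metis imageE)
    have "x \<in> Y k"
      unfolding Y_def using s k(2) by (simp add: \<sigma>_def)
    then show ?thesis
      unfolding V_def using sum_of_subspaces_superset [where K = "{1..N}" and Y = Y, OF Ycs _ k(1)] by simp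
  qed
  \<comment> \<open>\<open>d\<close> counts the rows not yet resolved: nothing is assumed for
    \<open>d = n\<close>, and \<open>d = 0\<close> is \<open>joint\<close>. Row \<open>n - d\<close>
    is resolved by its projections, which keep a vector inside the components already selected
    because they commute with the projections onto those.\<close>
  have split: "x \<in> V" if "d \<le> n" "\<And>i. i \<in> {1..n - d} \<Longrightarrow> \<exists>j\<in>?I. x \<in> X i j" for d x
    using that
  proof (induction d arbitrary: x)
    case 0
    then show ?case
      using joint by simp
  next
    case (Suc d)
    define m where "m = n - d"
    have m: "m \<in> ?I" "{1..m} = insert m {1..n - Suc d}"
      using Suc.prems(1) unfolding m_def by auto
    have "P m j x \<in> V" if j: "j \<in> ?I" for j
    proof (rule Suc.IH)
      fix i
      assume i: "i \<in> {1..n - d}"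
      show "\<exists>j'\<in>?I. P m j x \<in> X i j'"
      proof (cases "i = m")
        case True
        then show ?thesis
          using Pin [OF m(1) j] j by blast
      next
        case False
        then have i': "i \<in> {1..n - Suc d}"
          using i m(2) unfolding m_def by blast
        then have iI: "i \<in> ?I"
          by auto
        obtain j' where j': "j' \<in> ?I" "x \<in> X i j'"
          using Suc.prems(2) [OF i'] by blast
        have "P m j x = P i j' (P m j x)"
          using Pcomm [OF iI j'(1) m(1) j] Psame [OF iI j'] by simp
        then show ?thesis
          using Pin [OF iI j'(1)] j'(1) by metis
      qed
    qed (use Suc.prems(1) in simp)
    then show ?case
      using V_sum [of ?I "\<lambda>j. P m j x"] Psum [OF m(1), of x] by simp
  qed
  have V: "V = UNIV"
    using split [of n] by auto
  have 1: "orthogonal_decomposition {1..N} Y UNIV"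
    unfolding orthogonal_decomposition_def using Ycs Yorth V unfolding V_def by blast
  \<comment> \<open>Rows are partitioned because \<open>h k\<close> maps \<open>?I\<close> into
    itself, columns because it does so bijectively.\<close>
  have 2: "magic_partition n {1..N} E"
    unfolding magic_partition_def indexed_partition_def
  proof (intro conjI ballI)
    fix i
    assume i: "i \<in> ?I"
    show "disjoint_family_on (\<lambda>j. E i j) ?I"
      unfolding disjoint_family_on_def E_def by auto
    show "(\<Union>j\<in>?I. E i j) = {1..N}"
      unfolding E_def using hI i by blast
    show "disjoint_family_on (\<lambda>k. E k i) ?I"
      unfolding disjoint_family_on_def E_def using permutes_inj [OF hp] by (auto dest: injD)
    show "(\<Union>k\<in>?I. E k i) = {1..N}"
    proof
      show "{1..N} \<subseteq> (\<Union>k\<in>?I. E k i)"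
      proof
        fix k
        assume k: "k \<in> {1..N}"
        have "i \<in> h k ` ?I"
          using permutes_image [OF hp [OF k]] i by simp
        then show "k \<in> (\<Union>k\<in>?I. E k i)"
          using k unfolding E_def by blast
      qed
    qed (auto simp: E_def)
  qed (auto simp: E_def)
  have 3: "orthogonal_decomposition (E i j) Y (X i j)" if ij: "i \<in> ?I" "j \<in> ?I" for i j
  proof -
    have "X i j = sum_of_subspaces (E i j) Y"
    proof
      show "X i j \<subseteq> sum_of_subspaces (E i j) Y"
      proof
        fix x
        assume x: "x \<in> X i j"
        have "x \<in> V"
          by (simp add: V)
        then obtain f where f: "x = (\<Sum>k\<in>{1..N}. f k)" "\<And>k. k \<in> {1..N} \<Longrightarrow> f k \<in> Y k"
          unfolding V_def sum_of_subspaces_def by blast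
        \<comment> \<open>\<open>P i j\<close> fixes \<open>x\<close> and acts on each piece as the
          identity or as zero, so the pieces outside \<open>E i j\<close> drop out of
          \<open>x\<close>.\<close>
        have "P i j (f k) = (if k \<in> E i j then f k else 0)" if k: "k \<in> {1..N}" for k
        proof -
          have fk: "f k \<in> X i (h k i)"
            using f(2) [OF k] ij(1) unfolding Y_def by blast
          show ?thesis
          proof (cases "h k i = j")
            case True
            then show ?thesis
              using Psame [OF ij] fk k by (simp add: E_def)
          next
            case False
            then have "P i j (f k) = 0"
              using Pother [OF ij hI [OF k ij(1)] _ fk] by blast
            then show ?thesis
              using False by (simp add: E_def)
          qed
        qed
        then have "P i j x = (\<Sum>k\<in>{1..N}. if k \<in> E i j then f k else 0)"
          unfolding f(1) P_def by (simp add: blinfun.sum_right)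
        also have "\<dots> = (\<Sum>k\<in>E i j. f k)"
          by (intro sum.mono_neutral_cong_right) (auto simp: E_def)
        finally have "x = (\<Sum>k\<in>E i j. f k)"
          using Psame [OF ij x] by simp
        moreover have "\<forall>k\<in>E i j. f k \<in> Y k"
          using f(2) unfolding E_def by blast
        ultimately show "x \<in> sum_of_subspaces (E i j) Y"
          unfolding sum_of_subspaces_def by blast
      qed
      show "sum_of_subspaces (E i j) Y \<subseteq> X i j"
        unfolding sum_of_subspaces_def E_def Y_def
        using ij by (auto intro!: closed_subspace_sum [OF cs [OF ij]])
    qed
    moreover have sub: "k \<in> {1..N}" if "k \<in> E i j" for k
      using that unfolding E_def by blast
    moreover have "finite (E i j)"
      unfolding E_def by simp
    ultimately show ?thesis
      unfolding orthogonal_decomposition_def using Ycs [OF sub] Yorth [OF sub sub] by blast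
  qed
  show ?thesis
    using 1 2 3 by blast
qed

theorem theorem2p8:
  fixes X :: "nat \<Rightarrow> nat \<Rightarrow> 'h::complex_hilbert_space set"
    and n :: nat
    and A :: "'a cstar"
    and u :: "nat \<Rightarrow> nat \<Rightarrow> 'a"
  assumes "magic_decomposition n X"
    and "associated_algebra n X A u"
  shows "(\<forall>a\<in>carrier A. \<forall>b\<in>carrier A. a \<otimes>\<^bsub>A\<^esub> b = b \<otimes>\<^bsub>A\<^esub> a) \<longleftrightarrow>
    (\<exists>(N :: nat) (Y :: nat \<Rightarrow> 'h set) (E :: nat \<Rightarrow> nat \<Rightarrow> nat set).
       orthogonal_decomposition {1..N} Y UNIV \<and>
       magic_partition n {1..N} E \<and>
       (\<forall>i\<in>{1..n}. \<forall>j\<in>{1..n}. orthogonal_decomposition (E i j) Y (X i j)))"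
    (is "?comm \<longleftrightarrow> ?part")
proof -
  obtain \<pi> where \<pi>: "\<pi> \<in> cstar_hom (A\<^sub>s n) (BO :: ('h \<Rightarrow>\<^sub>L 'h) cstar)"
    and \<pi>_gen: "\<And>i j. \<lbrakk>i \<in> {1..n}; j \<in> {1..n}\<rbrakk> \<Longrightarrow> \<pi> (A\<^sub>s_gen n i j) = orth_projection (X i j)"
    and hopf: "hopf_image n BO \<pi> A u"
    using assms(2) unfolding associated_algebra_def by blast
  have rf: "realizes_factorization n BO \<pi> A u"
    using hopf unfolding hopf_image_def by (rule conjunct1)
  then have u: "quantum_permutation_algebra n A u"
    unfolding realizes_factorization_def by (rule conjunct1)
  have "\<exists>\<phi>\<in>cstar_hom (A\<^sub>s n) A. \<exists>\<rho>\<in>cstar_hom A BO.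
      (\<forall>i\<in>{1..n}. \<forall>j\<in>{1..n}. \<phi> (A\<^sub>s_gen n i j) = u i j) \<and> (\<forall>x\<in>carrier (A\<^sub>s n). \<pi> x = \<rho> (\<phi> x))"
    using rf unfolding realizes_factorization_def by (rule conjunct2)
  then obtain \<phi> \<rho> where \<rho>: "\<rho> \<in> cstar_hom A BO"
    and "\<forall>i\<in>{1..n}. \<forall>j\<in>{1..n}. \<phi> (A\<^sub>s_gen n i j) = u i j" "\<forall>x\<in>carrier (A\<^sub>s n). \<pi> x = \<rho> (\<phi> x)"
    by (elim bexE conjE)
  then have \<phi>_gen: "\<And>i j. \<lbrakk>i \<in> {1..n}; j \<in> {1..n}\<rbrakk> \<Longrightarrow> \<phi> (A\<^sub>s_gen n i j) = u i j"
    and fact: "\<And>x. x \<in> carrier (A\<^sub>s n) \<Longrightarrow> \<pi> x = \<rho> (\<phi> x)"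
    by blast+
  note gen = magic_unitaryD [OF As_gen_magic_unitary [of n]]
  have uc: "u i j \<in> carrier A" if "i \<in> {1..n}" "j \<in> {1..n}" for i j
    using u magic_unitaryD(1) that unfolding quantum_permutation_algebra_def by blast
  have \<rho>_u: "\<rho> (u i j) = orth_projection (X i j)" if "i \<in> {1..n}" "j \<in> {1..n}" for i j
    using fact [OF gen(1) [OF that]] \<pi>_gen [OF that] \<phi>_gen [OF that] by simp
  show ?thesis
  proof
    assume ?comm
    then have "orth_projection (X i j) o\<^sub>L orth_projection (X k l) = orth_projection (X k l) o\<^sub>L orth_projection (X i j)"
      if "i \<in> {1..n}" "j \<in> {1..n}" "k \<in> {1..n}" "l \<in> {1..n}" for i j k l
      using cstar_hom_mult [OF \<rho> uc uc, of i j k l] cstar_hom_mult [OF \<rho> uc uc, of k l i j] that uc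
      by (simp add: \<rho>_u del: atLeastAtMost_iff)
    then show ?part
      by (rule magic_partition_if_orth_projections_commute [OF assms(1)])
  next
    assume ?part
    then obtain N :: nat and Y :: "nat \<Rightarrow> 'h set" and E where
      Y: "orthogonal_decomposition {1..N} Y UNIV" and E: "magic_partition n {1..N} E"
      and XE: "\<And>i j. \<lbrakk>i \<in> {1..n}; j \<in> {1..n}\<rbrakk> \<Longrightarrow> orthogonal_decomposition (E i j) Y (X i j)"
      by blast
    let ?B = "comm_magic n" and ?v = "comm_gen n"
    have v: "quantum_permutation_algebra n ?B ?v"
      by (rule comm_magic_quantum_permutation_algebra)
    obtain \<psi> where \<psi>: "\<psi> \<in> cstar_hom (A\<^sub>s n) ?B"
      "\<And>i j. \<lbrakk>i \<in> {1..n}; j \<in> {1..n}\<rbrakk> \<Longrightarrow> \<psi> (A\<^sub>s_gen n i j) = ?v i j"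
      using As_extend [OF Comm.E.cstar_algebra_axioms Comm.gen_magic_unitary [of n]] by blast
    \<comment> \<open>The relations among the projections are inherited from the generators of
      \<open>A\<^sub>s n\<close> through \<open>\<pi>\<close>.\<close>
    have P: "magic_unitary BO n (\<lambda>i j. \<pi> (A\<^sub>s_gen n i j))"
    proof -
      interpret star_algebra_hom "A\<^sub>s n" BO \<pi>
        by (simp add: star_algebra_hom_def star_algebra_hom_axioms_def As_star_algebra BO_star_algebra \<pi>)
      show ?thesis
        by (rule magic_unitary_hom [OF As_gen_magic_unitary])
    qed
    have "\<pi> (A\<^sub>s_gen n i j) \<otimes>\<^bsub>BO\<^esub> \<pi> (A\<^sub>s_gen n k l) = \<pi> (A\<^sub>s_gen n k l) \<otimes>\<^bsub>BO\<^esub> \<pi> (A\<^sub>s_gen n i j)"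
      if "i \<in> {1..n}" "j \<in> {1..n}" "k \<in> {1..n}" "l \<in> {1..n}" for i j k l
      using orth_projections_commute_if_magic_partition [OF assms(1) Y E XE that] that
      by (simp add: \<pi>_gen del: atLeastAtMost_iff)
    from comm_magic_extend [OF BO_cstar_algebra P this]
    obtain \<tau> where \<tau>: "\<tau> \<in> cstar_hom ?B BO"
      "\<And>i j. \<lbrakk>i \<in> {1..n}; j \<in> {1..n}\<rbrakk> \<Longrightarrow> \<tau> (?v i j) = \<pi> (A\<^sub>s_gen n i j)"
      by blast
    have "\<pi> x = (\<tau> \<circ> \<psi>) x" if "x \<in> carrier (A\<^sub>s n)" for x
    proof (rule As_hom_unique [OF BO_cstar_algebra \<pi> cstar_hom_comp [OF \<psi>(1) \<tau>(1)] _ that])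
      show "\<pi> (A\<^sub>s_gen n i j) = (\<tau> \<circ> \<psi>) (A\<^sub>s_gen n i j)" if "i \<in> {1..n}" "j \<in> {1..n}" for i j
        using \<tau>(2) [OF that] \<psi>(2) [OF that] by simp
    qed
    then have all: "\<forall>x\<in>carrier (A\<^sub>s n). \<pi> x = \<tau> (\<psi> x)"
      by simp
    have rf: "realizes_factorization n BO \<pi> ?B ?v"
      unfolding realizes_factorization_def
      by (rule conjI [OF v], rule bexI [OF _ \<psi>(1)], rule bexI [OF _ \<tau>(1)], rule conjI [OF _ all])
         (intro ballI \<psi>(2))
    \<comment> \<open>\<open>?B\<close> is built from the same free algebra as
      \<open>A\<^sub>s n\<close>, so it is one of the competitors in the definition of the Hopf
      image.\<close>
    have "\<forall>(B :: magic_elem cstar) v. realizes_factorization n BO \<pi> B v \<longrightarrow>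
        (\<exists>f\<in>cstar_hom B A. f ` carrier B = carrier A \<and> (\<forall>i\<in>{1..n}. \<forall>j\<in>{1..n}. f (v i j) = u i j))"
      using hopf unfolding hopf_image_def by (rule conjunct2)
    from this [rule_format, OF rf]
    obtain f where f: "f \<in> cstar_hom ?B A" "f ` carrier ?B = carrier A"
      by (elim bexE conjE)
    show ?comm
    proof (intro ballI)
      fix a b
      assume "a \<in> carrier A" "b \<in> carrier A"
      then obtain x y where "a = f x" "x \<in> carrier ?B" "b = f y" "y \<in> carrier ?B"
        unfolding f(2) [symmetric] by blast
      then show "a \<otimes>\<^bsub>A\<^esub> b = b \<otimes>\<^bsub>A\<^esub> a"
        using comm_magic_commute [of x n y] by (simp flip: cstar_hom_mult [OF f(1)])
    qed
  qed
qed

end
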